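(* Let $\alpha$ be an r.e. real and let $V$ be an optimal computer. For every total recursive function $f\colon\mathbb{N}^+\to\mathbb{N}$, if $\sum_{n=1}^\infty 2^{-f(n)}<\infty$, then there exist an oracle deterministic Turing machine $M$ and $c\in\mathbb{N}$ such that, for all $n\in\mathbb{N}^+$, $M^{\mathrm{Dom}\,V\restriction n}(n)=\alpha\restriction(n-f(n)-c)$.
   Context: A real $\alpha$ is r.e. (left-computable) if there is a total recursive $g\colon\mathbb{N}^+\to\mathbb{Q}$ with $g(n)\le\alpha$ for all $n$ and $\lim_n g(n)=\alpha$. $\{0,1\}^*$ is the set of finite binary strings. A computer is a partial recursive function $C\colon\{0,1\}^*\to\{0,1\}^*$ whose domain $\mathrm{Dom}\,C$ is prefix-free. A computer $U$ is optimal if for every computer $C$ there is $d\in\mathbb{N}$ such that for every $p\in\mathrm{Dom}\,C$ there is $q$ with $U(q)=C(p)$ and $|q|\le|p|+d$. For $S\subseteq\{0,1\}^*$ and $n\in\mathbb{Z}$, $S\restriction n=\{s\in S:|s|\le n\}$. For a real $\alpha$ and $n\in\mathbb{N}^+$, $\alpha\restriction n$ is the string of the first $n$ bits of the base-two expansion of $\alpha-\lfloor\alpha\rfloor$ (with infinitely many zeros when there is a choice); for integers $n\le 0$, $\alpha\restriction n$ is the empty string. $M^{A}(n)$ is the output of oracle machine $M$ on input $n$ with oracle set $A$. *)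

theory Defs
  imports Complex_Main "HOL-Library.Sublist"
begin

section \<open>Partial recursive functions\<close>

text \<open>
  Kleene's programs and their evaluation relation. Arities are not tracked: the arity is the
  length of the argument list, and a program applied to an unsuitable list is undefined.
\<close>

datatype recf = Zero | Succ | Proj nat | Comp recf "recf list" | Prim recf recf | Mu recf

inductive rec_eval :: "recf \<Rightarrow> nat list \<Rightarrow> nat \<Rightarrow> bool" where
  eval_Zero: "rec_eval Zero xs 0"
| eval_Succ: "rec_eval Succ [x] (Suc x)"
| eval_Proj: "i < length xs \<Longrightarrow> rec_eval (Proj i) xs (xs ! i)"
| eval_Comp: "length ys = length gs \<Longrightarrow>
    (\<And>i. i < length gs \<Longrightarrow> rec_eval (gs ! i) xs (ys ! i)) \<Longrightarrow>
    rec_eval f ys z \<Longrightarrow> rec_eval (Comp f gs) xs z"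
| eval_Prim0: "rec_eval f xs y \<Longrightarrow> rec_eval (Prim f g) (0 # xs) y"
| eval_PrimSuc: "rec_eval (Prim f g) (n # xs) y \<Longrightarrow> rec_eval g (n # y # xs) z \<Longrightarrow>
    rec_eval (Prim f g) (Suc n # xs) z"
| eval_Mu: "(\<And>m. m < n \<Longrightarrow> \<exists>y. rec_eval f (m # xs) (Suc y)) \<Longrightarrow>
    rec_eval f (n # xs) 0 \<Longrightarrow> rec_eval (Mu f) xs n"

inductive_cases rec_eval_ZeroE: "rec_eval Zero xs y"
inductive_cases rec_eval_SuccE: "rec_eval Succ xs y"
inductive_cases rec_eval_ProjE: "rec_eval (Proj i) xs y"
inductive_cases rec_eval_CompE: "rec_eval (Comp f gs) xs y"
inductive_cases rec_eval_Prim0E: "rec_eval (Prim f g) (0 # xs) y"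
inductive_cases rec_eval_PrimSucE: "rec_eval (Prim f g) (Suc n # xs) y"
inductive_cases rec_eval_MuE: "rec_eval (Mu f) xs y"

lemma rec_eval_functional: "rec_eval r xs y \<Longrightarrow> rec_eval r xs z \<Longrightarrow> y = z"
proof (induction arbitrary: z rule: rec_eval.induct)
  case (eval_Comp ys gs xs f w)
  from eval_Comp.prems obtain ys' where ys': "length ys' = length gs"
      "\<And>i. i < length gs \<Longrightarrow> rec_eval (gs ! i) xs (ys' ! i)" "rec_eval f ys' z"
    by (auto elim: rec_eval_CompE)
  have "ys = ys'"
    using eval_Comp.hyps eval_Comp.IH ys'(1,2) by (intro nth_equalityI) auto
  then show ?case using eval_Comp.IH ys'(3) by blast
next
  case (eval_PrimSuc f g n xs y w)
  from eval_PrimSuc.prems obtain y' where "rec_eval (Prim f g) (n # xs) y'"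
      "rec_eval g (n # y' # xs) z"
    by (rule rec_eval_PrimSucE)
  then show ?case using eval_PrimSuc.IH by metis
next
  case (eval_Mu n f xs)
  from eval_Mu.prems have z: "\<And>m. m < z \<Longrightarrow> \<exists>y. rec_eval f (m # xs) (Suc y)"
      "rec_eval f (z # xs) 0"
    by (auto elim: rec_eval_MuE)
  show ?case
  proof (cases n z rule: linorder_cases)
    case less
    then obtain y where "rec_eval f (n # xs) (Suc y)" using z(1) by blast
    then show ?thesis using eval_Mu.IH(2) by blast
  next
    case greater
    then show ?thesis using z(2) eval_Mu.IH(1) by blast
  qed
next
  case (eval_Prim0 f xs y g w)
  then show ?case by (blast elim: rec_eval_Prim0E)
qed (auto elim: rec_eval_ZeroE rec_eval_SuccE rec_eval_ProjE)

text \<open>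
  A function on the positive integers is represented by a function on \<^typ>\<open>nat\<close> whose value at
  \<open>0\<close> is irrelevant.
\<close>

definition total_recursive_pos :: "(nat \<Rightarrow> nat) \<Rightarrow> bool" where
  "total_recursive_pos f \<longleftrightarrow> (\<exists>r. \<forall>n\<ge>1. rec_eval r [n] (f n))"

text \<open>The triple \<open>(a, b, c)\<close> is used as a code of the rational \<open>(a - b) / (c + 1)\<close>.\<close>

definition total_recursive_rat_pos :: "(nat \<Rightarrow> rat) \<Rightarrow> bool" where
  "total_recursive_rat_pos g \<longleftrightarrow>
    (\<exists>a b c. total_recursive_pos a \<and> total_recursive_pos b \<and> total_recursive_pos c \<and>
      (\<forall>n\<ge>1. g n = (of_nat (a n) - of_nat (b n)) / (of_nat (c n) + 1)))"

definition re_real :: "real \<Rightarrow> bool" where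
  "re_real \<alpha> \<longleftrightarrow>
    (\<exists>g. total_recursive_rat_pos g \<and> (\<forall>n\<ge>1. real_of_rat (g n) \<le> \<alpha>) \<and>
      (\<lambda>n. real_of_rat (g n)) \<longlonglongrightarrow> \<alpha>)"

section \<open>Binary strings and computers\<close>

type_synonym bstring = "bool list"

text \<open>
  The position of a string in the length-lexicographic order
  \<open>\<lambda>, 0, 1, 00, 01, 10, 11, 000, \<dots>\<close>. This bijection is used to identify strings with natural
  numbers, both for recursive functions on strings and for numerical inputs of Turing machines.
\<close>

definition nat_of_str :: "bstring \<Rightarrow> nat" where
  "nat_of_str s = foldl (\<lambda>n b. 2 * n + (if b then 2 else 1)) 0 s"

definition str_of_nat :: "nat \<Rightarrow> bstring" where
  "str_of_nat = inv nat_of_str"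

lemma nat_of_str_Nil: "nat_of_str [] = 0"
  and nat_of_str_snoc: "nat_of_str (s @ [b]) = 2 * nat_of_str s + (if b then 2 else 1)"
  by (simp_all add: nat_of_str_def)

lemma bij_nat_of_str: "bij nat_of_str"
proof (rule bijI)
  show "inj nat_of_str"
  proof (rule injI)
    fix s t
    assume "nat_of_str s = nat_of_str t"
    then show "s = t"
    proof (induction s arbitrary: t rule: rev_induct)
      case Nil
      then show ?case
        by (cases t rule: rev_cases) (auto simp: nat_of_str_Nil nat_of_str_snoc split: if_splits)
    next
      case (snoc b s)
      show ?case
      proof (cases t rule: rev_cases)
        case Nil
        then show ?thesis
          using snoc.prems by (auto simp: nat_of_str_Nil nat_of_str_snoc split: if_splits)
      next
        case (snoc t' b')
        have "b = b' \<and> nat_of_str s = nat_of_str t'"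
          using snoc.prems \<open>t = t' @ [b']\<close>
          by (auto simp: nat_of_str_snoc split: if_splits) presburger+
        then show ?thesis using snoc.IH \<open>t = t' @ [b']\<close> by auto
      qed
    qed
  qed
  have "\<exists>s. nat_of_str s = n" for n
  proof (induction n rule: less_induct)
    case (less n)
    show ?case
    proof (cases "n = 0")
      case True
      then show ?thesis using nat_of_str_Nil by blast
    next
      case False
      then have "(n - 1) div 2 < n" by linarith
      then obtain s where "nat_of_str s = (n - 1) div 2"
        using less by blast
      then have "nat_of_str (s @ [even n]) = n"
        using False by (auto simp: nat_of_str_snoc elim!: evenE oddE)
      then show ?thesis by blast
    qed
  qed
  then show "surj nat_of_str" by (metis surjI)
qed

definition partial_recursive_str :: "(bstring \<rightharpoonup> bstring) \<Rightarrow> bool" where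
  "partial_recursive_str C \<longleftrightarrow>
    (\<exists>r. \<forall>p q. C p = Some q \<longleftrightarrow> rec_eval r [nat_of_str p] (nat_of_str q))"

definition prefix_free :: "bstring set \<Rightarrow> bool" where
  "prefix_free S \<longleftrightarrow> (\<forall>s\<in>S. \<forall>t\<in>S. prefix s t \<longrightarrow> s = t)"

definition is_computer :: "(bstring \<rightharpoonup> bstring) \<Rightarrow> bool" where
  "is_computer C \<longleftrightarrow> partial_recursive_str C \<and> prefix_free (dom C)"

definition optimal_computer :: "(bstring \<rightharpoonup> bstring) \<Rightarrow> bool" where
  "optimal_computer U \<longleftrightarrow> is_computer U \<and>
    (\<forall>C. is_computer C \<longrightarrow>
      (\<exists>d::nat. \<forall>p\<in>dom C. \<exists>q. U q = C p \<and> length q \<le> length p + d))"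

definition restrict_len :: "bstring set \<Rightarrow> int \<Rightarrow> bstring set" (infixl "\<restriction>\<^sub>s" 75) where
  "S \<restriction>\<^sub>s n = {s \<in> S. int (length s) \<le> n}"

section \<open>Base-two expansions\<close>

definition is_expansion :: "(nat \<Rightarrow> bool) \<Rightarrow> real \<Rightarrow> bool" where
  "is_expansion b x \<longleftrightarrow>
    (\<lambda>i. of_bool (b i) / 2 ^ Suc i) sums x \<and> infinite {i. \<not> b i}"

definition bits :: "real \<Rightarrow> nat \<Rightarrow> bool" where
  "bits \<alpha> = (THE b. is_expansion b (\<alpha> - of_int \<lfloor>\<alpha>\<rfloor>))"

definition real_prefix :: "real \<Rightarrow> int \<Rightarrow> bstring" (infixl "\<restriction>\<^sub>r" 75) where
  "\<alpha> \<restriction>\<^sub>r n = map (bits \<alpha>) [0..<nat n]"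

lemma is_expansion_bounds:
  assumes "is_expansion b x"
  shows "0 \<le> x" and "x < 1"
proof -
  have s: "(\<lambda>i. of_bool (b i) / 2 ^ Suc i :: real) sums x" and inf: "infinite {i. \<not> b i}"
    using assms by (auto simp: is_expansion_def)
  show "0 \<le> x"
    by (rule sums_le[OF _ sums_zero s]) auto
  from inf obtain k where k: "\<not> b k"
    using not_finite_existsD by auto
  have h: "(\<lambda>i. (1 / 2) ^ Suc i :: real) sums 1"
    by (rule power_half_series)
  have d: "(\<lambda>i. (1 / 2) ^ Suc i - of_bool (b i) / 2 ^ Suc i :: real) sums (1 - x)"
    by (rule sums_diff[OF h s])
  have "0 < (\<Sum>i. (1 / 2) ^ Suc i - of_bool (b i) / 2 ^ Suc i :: real)"
    by (rule suminf_pos2[where i = k])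
       (use k sums_summable[OF d] in \<open>auto simp: power_one_over divide_simps\<close>)
  then show "x < 1"
    using sums_unique[OF d] by simp
qed

lemma is_expansion_shift:
  assumes "is_expansion b x"
  shows "is_expansion (\<lambda>i. b (Suc i)) (2 * x - of_bool (b 0))"
proof -
  have s: "(\<lambda>i. of_bool (b i) / 2 ^ Suc i :: real) sums x" and inf: "infinite {i. \<not> b i}"
    using assms by (auto simp: is_expansion_def)
  have "(\<lambda>i. of_bool (b (Suc i)) / 2 ^ Suc (Suc i) :: real) sums (x - of_bool (b 0) / 2)"
    by (subst sums_Suc_iff) (use s in simp)
  from sums_mult[OF this, of 2]
  have "(\<lambda>i. of_bool (b (Suc i)) / 2 ^ Suc i :: real) sums (2 * x - of_bool (b 0))"
    by (simp add: right_diff_distrib)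
  moreover have "infinite {i. \<not> b (Suc i)}"
  proof
    assume "finite {i. \<not> b (Suc i)}"
    then have "finite (insert 0 (Suc ` {i. \<not> b (Suc i)}))" by simp
    moreover have "{i. \<not> b i} \<subseteq> insert 0 (Suc ` {i. \<not> b (Suc i)})"
    proof
      fix i
      assume "i \<in> {i. \<not> b i}"
      then show "i \<in> insert 0 (Suc ` {i. \<not> b (Suc i)})" by (cases i) auto
    qed
    ultimately show False using inf finite_subset by blast
  qed
  ultimately show ?thesis by (simp add: is_expansion_def)
qed

lemma is_expansion_bit:
  assumes "is_expansion b x"
  shows "b i \<longleftrightarrow> odd \<lfloor>2 ^ Suc i * x\<rfloor>"
  using assms
proof (induction i arbitrary: b x)
  case 0
  have "0 \<le> 2 * x - of_bool (b 0)" "2 * x - of_bool (b 0) < 1"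
    using is_expansion_bounds[OF is_expansion_shift[OF 0]] by auto
  then have "\<lfloor>2 * x\<rfloor> = of_bool (b 0)" by (cases "b 0") (auto simp: floor_eq_iff)
  then show ?case by simp
next
  case (Suc i)
  have "b (Suc i) \<longleftrightarrow> odd \<lfloor>2 ^ Suc i * (2 * x - of_bool (b 0))\<rfloor>"
    by (rule Suc.IH[OF is_expansion_shift[OF Suc.prems]])
  also have "2 ^ Suc i * (2 * x - of_bool (b 0)) =
      2 ^ Suc (Suc i) * x - of_int (2 ^ Suc i * of_bool (b 0))"
    by (simp add: algebra_simps)
  also have "\<lfloor>\<dots>\<rfloor> = \<lfloor>2 ^ Suc (Suc i) * x\<rfloor> - 2 ^ Suc i * of_bool (b 0)"
    by (rule floor_diff_of_int)
  finally show ?case by simp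
qed

lemma is_expansion_exists:
  assumes "0 \<le> x" and "x < 1"
  shows "is_expansion (\<lambda>i. odd \<lfloor>2 ^ Suc i * x\<rfloor>) x"
proof -
  define F where "F n = \<lfloor>2 ^ n * x\<rfloor>" for n :: nat
  have F_Suc: "F (Suc n) = 2 * F n + of_bool (odd (F (Suc n)))" for n
  proof -
    have "of_int (F n) \<le> 2 ^ n * x" "2 ^ n * x < of_int (F n) + 1"
      by (auto simp: F_def)
    then have "2 * F n \<le> F (Suc n)" "F (Suc n) < 2 * F n + 2"
      unfolding F_def[of "Suc n"] by (auto simp: le_floor_iff floor_less_iff)
    then have "F (Suc n) = 2 * F n \<or> F (Suc n) = 2 * F n + 1" by linarith
    then show ?thesis by auto
  qed
  have part: "(\<Sum>i<n. of_bool (odd (F (Suc i))) / 2 ^ Suc i) = of_int (F n) / (2 ^ n :: real)" for n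
  proof (induction n)
    case 0
    then show ?case using assms by (simp add: F_def floor_eq_iff)
  next
    case (Suc n)
    have "of_int (F (Suc n)) = 2 * of_int (F n) + (of_bool (odd (F (Suc n))) :: real)"
      by (subst F_Suc) simp
    then show ?case using Suc by (simp add: field_simps)
  qed
  have "(\<lambda>n. of_int (F n) / (2 ^ n :: real)) \<longlonglongrightarrow> x"
  proof (rule tendsto_sandwich)
    show "\<forall>\<^sub>F n in sequentially. x - (1 / 2) ^ n \<le> of_int (F n) / (2 ^ n :: real)"
    proof (rule always_eventually, rule allI)
      fix n
      have "2 ^ n * x < of_int (F n) + 1" by (simp add: F_def)
      then have "(2 ^ n * x - 1) / 2 ^ n \<le> of_int (F n) / (2 ^ n :: real)"
        by (intro divide_right_mono) auto
      then show "x - (1 / 2) ^ n \<le> of_int (F n) / (2 ^ n :: real)"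
        by (simp add: diff_divide_distrib power_one_over)
    qed
    show "\<forall>\<^sub>F n in sequentially. of_int (F n) / (2 ^ n :: real) \<le> x"
    proof (rule always_eventually, rule allI)
      fix n
      have "of_int (F n) \<le> 2 ^ n * x" by (simp add: F_def)
      then show "of_int (F n) / (2 ^ n :: real) \<le> x"
        by (simp add: field_simps)
    qed
    have "(\<lambda>n. (1 / 2 :: real) ^ n) \<longlonglongrightarrow> 0" by (rule LIMSEQ_realpow_zero) auto
    from tendsto_diff[OF tendsto_const[of x] this]
    show "(\<lambda>n. x - (1 / 2) ^ n) \<longlonglongrightarrow> x" by simp
  qed auto
  then have 1: "(\<lambda>i. of_bool (odd (F (Suc i))) / 2 ^ Suc i) sums x"
    by (simp add: sums_def part del: power_Suc)
  have 2: "infinite {i. \<not> odd (F (Suc i))}"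
  proof
    assume "finite {i. \<not> odd (F (Suc i))}"
    then obtain N where "\<And>i. i \<in> {i. \<not> odd (F (Suc i))} \<Longrightarrow> i < N"
      by (metis finite_nat_set_iff_bounded)
    then have N: "odd (F (Suc i))" if "N \<le> i" for i
      using that by (metis mem_Collect_eq not_le)
    have E: "F (N + k) + 1 = 2 ^ k * (F N + 1)" for k
    proof (induction k)
      case (Suc k)
      have "F (N + Suc k) = 2 * F (N + k) + 1"
        using F_Suc[of "N + k"] N[of "N + k"] by simp
      then show ?case using Suc by (simp add: algebra_simps)
    qed simp
    have "of_int (F N) + 1 - (1 / 2) ^ k \<le> 2 ^ N * x" for k
    proof -
      have "of_int (F (N + k)) \<le> 2 ^ (N + k) * x" by (simp add: F_def)
      moreover have "of_int (F (N + k)) = (2 ^ k * (of_int (F N) + 1) - 1 :: real)"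
        using arg_cong[OF E[of k], of "of_int :: int \<Rightarrow> real"] by simp
      ultimately have "2 ^ k * (of_int (F N) + 1) - 1 \<le> 2 ^ k * (2 ^ N * x)"
        by (simp add: power_add mult_ac)
      then show ?thesis by (simp add: field_simps power_one_over)
    qed
    moreover have "2 ^ N * x < of_int (F N) + 1" by (simp add: F_def)
    moreover obtain k where "(1 / 2) ^ k < of_int (F N) + 1 - 2 ^ N * x"
      using real_arch_pow_inv[of "of_int (F N) + 1 - 2 ^ N * x" "1 / 2"] calculation(2) by auto
    ultimately show False by (smt (verit))
  qed
  show ?thesis using 1 2 by (simp add: is_expansion_def F_def)
qed

lemma bits_is_expansion: "is_expansion (bits \<alpha>) (\<alpha> - of_int \<lfloor>\<alpha>\<rfloor>)"
  and bits_floor: "bits \<alpha> i \<longleftrightarrow> odd \<lfloor>2 ^ Suc i * (\<alpha> - of_int \<lfloor>\<alpha>\<rfloor>)\<rfloor>"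
proof -
  have "\<exists>!b. is_expansion b (\<alpha> - of_int \<lfloor>\<alpha>\<rfloor>)"
  proof (rule ex1I)
    show "is_expansion (\<lambda>i. odd \<lfloor>2 ^ Suc i * (\<alpha> - of_int \<lfloor>\<alpha>\<rfloor>)\<rfloor>) (\<alpha> - of_int \<lfloor>\<alpha>\<rfloor>)"
      by (rule is_expansion_exists) linarith+
  qed (use is_expansion_bit in blast)
  then show "is_expansion (bits \<alpha>) (\<alpha> - of_int \<lfloor>\<alpha>\<rfloor>)"
    unfolding bits_def by (rule theI')
  then show "bits \<alpha> i \<longleftrightarrow> odd \<lfloor>2 ^ Suc i * (\<alpha> - of_int \<lfloor>\<alpha>\<rfloor>)\<rfloor>"
    by (rule is_expansion_bit)
qed

section \<open>Turing machines with an oracle\<close>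

text \<open>
  Deterministic machines with finitely many two-way infinite tapes. Tape \<open>0\<close> carries the input
  and, on halting, the output; tape \<open>1\<close> is the query tape. Words are written from cell \<open>0\<close>
  rightwards, and extend up to the first cell that does not contain a bit.
\<close>

datatype sym = Blank | Bit bool | Aux nat

datatype move = MoveL | Stay | MoveR

record oracle_tm =
  num_tapes :: nat
  states :: "nat set"
  alphabet :: "sym set"
  start_state :: nat
  halt_state :: nat
  query_state :: nat
  yes_state :: nat
  no_state :: nat
  trans_fun :: "nat \<Rightarrow> sym list \<Rightarrow> nat \<times> (sym \<times> move) list"

definition is_oracle_tm :: "oracle_tm \<Rightarrow> bool" where
  "is_oracle_tm M \<longleftrightarrow>
    2 \<le> num_tapes M \<and> finite (states M) \<and> finite (alphabet M) \<and>
    {start_state M, halt_state M, query_state M, yes_state M, no_state M} \<subseteq> states M \<and>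
    distinct [halt_state M, query_state M, yes_state M, no_state M] \<and>
    {Blank, Bit False, Bit True} \<subseteq> alphabet M \<and>
    (\<forall>q\<in>states M. \<forall>as. length as = num_tapes M \<and> set as \<subseteq> alphabet M \<longrightarrow>
      (case trans_fun M q as of (q', acts) \<Rightarrow>
        q' \<in> states M \<and> length acts = num_tapes M \<and> fst ` set acts \<subseteq> alphabet M))"

text \<open>A tape is given by its contents and its head position.\<close>

type_synonym tape = "(int \<Rightarrow> sym) \<times> int"

type_synonym tm_config = "nat \<times> tape list"

definition tape_word :: "tape \<Rightarrow> bstring \<Rightarrow> bool" where
  "tape_word t w \<longleftrightarrow>
    (\<forall>i<length w. fst t (int i) = Bit (w ! i)) \<and> fst t (int (length w)) \<notin> range Bit"

definition empty_tape :: tape where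
  "empty_tape = (\<lambda>_. Blank, 0)"

definition input_tape :: "bstring \<Rightarrow> tape" where
  "input_tape w =
    (\<lambda>i. if 0 \<le> i \<and> i < int (length w) then Bit (w ! nat i) else Blank, 0)"

fun shift :: "move \<Rightarrow> int" where
  "shift MoveL = - 1"
| "shift Stay = 0"
| "shift MoveR = 1"

definition act :: "sym \<times> move \<Rightarrow> tape \<Rightarrow> tape" where
  "act = (\<lambda>(a, m) (t, h). (t(h := a), h + shift m))"

definition step :: "oracle_tm \<Rightarrow> bstring set \<Rightarrow> tm_config \<Rightarrow> tm_config" where
  "step M A = (\<lambda>(q, ts).
    if q = halt_state M then (q, ts)
    else if q = query_state M then
      (if \<exists>w\<in>A. tape_word (ts ! 1) w then yes_state M else no_state M, ts)
    else (case trans_fun M q (map (\<lambda>(t, h). t h) ts) of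
      (q', acts) \<Rightarrow> (q', map2 act acts ts)))"

definition init_config :: "oracle_tm \<Rightarrow> bstring \<Rightarrow> tm_config" where
  "init_config M x = (start_state M, input_tape x # replicate (num_tapes M - 1) empty_tape)"

definition tm_outputs :: "oracle_tm \<Rightarrow> bstring set \<Rightarrow> bstring \<Rightarrow> bstring \<Rightarrow> bool" where
  "tm_outputs M A x y \<longleftrightarrow>
    (\<exists>k ts. (step M A ^^ k) (init_config M x) = (halt_state M, ts) \<and> tape_word (ts ! 0) y)"

lemma tape_word_unique:
  assumes "tape_word t v" and "tape_word t w"
  shows "v = w"
proof -
  have *: "length w' \<le> length v'" if "tape_word t v'" "tape_word t w'" for v' w'
    using that unfolding tape_word_def by (metis not_le rangeI)
  have "length v = length w"
    using *[of v w] *[of w v] assms by simp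
  then show ?thesis
    using assms unfolding tape_word_def by (intro nth_equalityI) (assumption, metis sym.inject(1))
qed

lemma tm_outputs_functional:
  assumes "tm_outputs M A x y" and "tm_outputs M A x z"
  shows "y = z"
proof -
  define c where "c k = (step M A ^^ k) (init_config M x)" for k
  obtain i ts where i: "c i = (halt_state M, ts)" "tape_word (ts ! 0) y"
    using assms(1) unfolding tm_outputs_def c_def by blast
  obtain j us where j: "c j = (halt_state M, us)" "tape_word (us ! 0) z"
    using assms(2) unfolding tm_outputs_def c_def by blast
  have halted: "c (k + l) = c k" if "c k = (halt_state M, vs)" for k l vs
  proof (induction l)
    case (Suc l)
    have "c (k + Suc l) = step M A (c (k + l))" by (simp add: c_def)
    then show ?case using Suc that by (simp add: step_def)
  qed simp
  have "c i = c j"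
    using halted[OF i(1), of j] halted[OF j(1), of i] by (simp add: add.commute)
  then show ?thesis using i j tape_word_unique by auto
qed

definition tm_outputs_nat ::
    "oracle_tm \<Rightarrow> bstring set \<Rightarrow> nat \<Rightarrow> bstring \<Rightarrow> bool" where
  "tm_outputs_nat M A n y \<longleftrightarrow> tm_outputs M A (str_of_nat n) y"

end

theory Submission
  imports Defs
begin

text \<open>
  Let \<open>\<beta>\<close> be the fractional part of \<open>\<alpha>\<close>. A computer \<open>C\<close> is built which, for every \<open>n\<close>,
  spends weight about \<open>2 ^ (- l n)\<close> on strings of length \<open>n\<close>: the \<open>j\<close>-th of them waits until the
  approximations of \<open>\<beta>\<close> reach \<open>j / 2 ^ (n - l n)\<close> and then outputs the stage at which this happens.
  If \<open>V\<close> simulates \<open>C\<close> with constant \<open>d\<close>, the stages for strings of length \<open>n - d\<close> are outputs of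
  \<open>V\<close> on strings of length at most \<open>n\<close>. An output of \<open>V\<close> is smaller than every stage by which its
  computation is seen to halt. So once all of \<open>Dom V \<restriction> n\<close>, read from the oracle, has halted by
  stage \<open>t\<close>, no further threshold can be reached after \<open>t\<close>, and the \<open>t\<close>-th approximation
  already has the correct bits.
\<close>

section \<open>Total recursive functions of several arguments\<close>

text \<open>The obstacle is the order of choices. The constant \<open>d\<close> is known only after
  the computer has been fixed, yet strings of length \<open>n - d\<close> have to serve precision
  about \<open>n - f n\<close>, and the values \<open>f (n - d)\<close> and \<open>f n\<close> are
  unrelated. The computer is therefore built from lengths \<open>l\<close> that suit every shift at
  once: \<open>l (n - d) \<le> f n + 2 * d + K\<close> for all \<open>d \<le> n\<close>,
  \<open>n \<ge> 1\<close>, while the weights \<open>2 ^ (- l n)\<close> still have sum at most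
  \<open>1\<close>. The penalty \<open>2 * d\<close> keeps the weights of all shifts of
  \<open>f\<close> summable together. The resulting constant is \<open>3 * d + K\<close>:
  \<open>d\<close> for the shorter strings, \<open>2 * d + K\<close> for the lengths.

  Thresholds finer than the required precision do no harm, since \<open>j / 2 ^ m\<close> is also a
  threshold at every higher precision.

  The machine must be one and the same for all \<open>n\<close> and all oracles. It looks for the
  halting stage of a string only after the oracle has confirmed that string, so all its searches
  end.\<close>

definition recfn :: "nat \<Rightarrow> (nat list \<Rightarrow> nat) \<Rightarrow> bool" where
  "recfn k F \<longleftrightarrow> (\<exists>r. \<forall>xs. length xs = k \<longrightarrow> rec_eval r xs (F xs))"

definition recpr :: "nat \<Rightarrow> (nat list \<Rightarrow> bool) \<Rightarrow> bool" where
  "recpr k P \<longleftrightarrow> recfn k (\<lambda>xs. of_bool (P xs))"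

text \<open>Only lists of length \<open>k\<close> count, so a term may be rewritten under
  \<open>length xs = k\<close>. This is how argument lists rebuilt by \<open>map\<close> and
  \<open>!\<close> are identified with \<open>xs\<close> or its tails.\<close>

lemma recfn_cong:
  assumes "recfn k F" "\<And>xs. length xs = k \<Longrightarrow> F xs = G xs"
  shows "recfn k G"
  using assms by (auto simp: recfn_def)

lemma recfn_proj: "i < k \<Longrightarrow> recfn k (\<lambda>xs. xs ! i)"
  unfolding recfn_def by (rule exI[of _ "Proj i"]) (auto intro: eval_Proj)

text \<open>Sums, bounded quantifiers and searches put the bound variable in front of the
  parameters, which are then reached through \<open>tl\<close>; two binders, or the counter and the
  accumulator of a recursion, lead to \<open>tl (tl ys)\<close>.\<close>

lemma recfn_tl: "Suc i < k \<Longrightarrow> recfn k (\<lambda>xs. tl xs ! i)"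
  by (rule recfn_cong[OF recfn_proj[of "Suc i"]]) (auto simp: nth_tl)

lemma recfn_tl2: "Suc (Suc i) < k \<Longrightarrow> recfn k (\<lambda>xs. tl (tl xs) ! i)"
  by (rule recfn_cong[OF recfn_proj[of "Suc (Suc i)"]]) (auto simp: nth_tl)

lemma recfn_compose:
  assumes "recfn (length Gs) F" "\<And>G. G \<in> set Gs \<Longrightarrow> recfn k G"
  shows "recfn k (\<lambda>xs. F (map (\<lambda>G. G xs) Gs))"
proof -
  obtain f where f: "\<And>ys. length ys = length Gs \<Longrightarrow> rec_eval f ys (F ys)"
    using assms(1) by (auto simp: recfn_def)
  obtain g where g: "\<And>G xs. G \<in> set Gs \<Longrightarrow> length xs = k \<Longrightarrow> rec_eval (g G) xs (G xs)"
    using assms(2) unfolding recfn_def by metis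
  have "rec_eval (Comp f (map g Gs)) xs (F (map (\<lambda>G. G xs) Gs))" if "length xs = k" for xs
    by (rule eval_Comp[where ys = "map (\<lambda>G. G xs) Gs"]) (auto intro: f g that)
  then show ?thesis unfolding recfn_def by blast
qed

lemma recfn_compose1:
  "recfn 1 (\<lambda>xs. h (xs ! 0)) \<Longrightarrow> recfn k F \<Longrightarrow> recfn k (\<lambda>xs. h (F xs))"
  using recfn_compose[of "[F]" "\<lambda>xs. h (xs ! 0)" k] by auto

lemma recfn_compose2:
  "recfn 2 (\<lambda>xs. h (xs ! 0) (xs ! 1)) \<Longrightarrow> recfn k F \<Longrightarrow> recfn k G \<Longrightarrow>
    recfn k (\<lambda>xs. h (F xs) (G xs))"
  using recfn_compose[of "[F, G]" "\<lambda>xs. h (xs ! 0) (xs ! 1)" k]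
  by (auto simp: numeral_2_eq_2)

lemma recfn_Suc:
  assumes "recfn k F"
  shows "recfn k (\<lambda>xs. Suc (F xs))"
proof (rule recfn_compose1[OF _ assms])
  have "rec_eval Succ xs (Suc (xs ! 0))" if "length xs = 1" for xs
    using that eval_Succ by (cases xs) auto
  then show "recfn 1 (\<lambda>xs. Suc (xs ! 0))" by (auto simp: recfn_def)
qed

lemma recfn_const: "recfn k (\<lambda>_. c)"
proof (induction c)
  case 0
  then show ?case using eval_Zero by (auto simp: recfn_def)
qed (rule recfn_Suc)

lemma recfn_rec_nat:
  assumes "recfn k Z" "recfn (Suc (Suc k)) (\<lambda>ys. S (ys ! 0) (ys ! 1) (tl (tl ys)))" "recfn k N"
  shows "recfn k (\<lambda>xs. rec_nat (Z xs) (\<lambda>i y. S i y xs) (N xs))"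
proof -
  obtain z where z: "\<And>xs. length xs = k \<Longrightarrow> rec_eval z xs (Z xs)"
    using assms(1) by (auto simp: recfn_def)
  obtain s where "\<And>ys. length ys = Suc (Suc k) \<Longrightarrow>
      rec_eval s ys (S (ys ! 0) (ys ! 1) (tl (tl ys)))"
    using assms(2) by (auto simp: recfn_def)
  then have s: "rec_eval s (i # y # xs) (S i y xs)" if "length xs = k" for i y xs
    using that by (metis (no_types, lifting) One_nat_def length_Cons list.sel(3) nth_Cons_0 nth_Cons_Suc)
  have "rec_eval (Prim z s) (n # xs) (rec_nat (Z xs) (\<lambda>i y. S i y xs) n)"
    if "length xs = k" for n xs
    by (induction n) (auto intro: eval_Prim0 eval_PrimSuc z s that)
  then have "recfn (Suc k) (\<lambda>ys. rec_nat (Z (tl ys)) (\<lambda>i y. S i y (tl ys)) (ys ! 0))"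
    unfolding recfn_def by (intro exI[of _ "Prim z s"]) (auto simp: length_Suc_conv)
  \<comment> \<open>\<open>Prim\<close> recurses on its first argument; composing with
    \<open>N\<close> and with all \<open>k\<close> projections recurses on \<open>N xs\<close> and
    keeps \<open>xs\<close> as the parameters.\<close>
  then have "recfn k (\<lambda>xs. (\<lambda>ys. rec_nat (Z (tl ys)) (\<lambda>i y. S i y (tl ys)) (ys ! 0))
      (map (\<lambda>G. G xs) (N # map (\<lambda>i xs. xs ! i) [0..<k])))"
    using assms(3) by (intro recfn_compose) (auto intro: recfn_proj)
  then show ?thesis
    by (rule recfn_cong) (auto simp: map_nth comp_def)
qed

section \<open>Arithmetic operations\<close>

lemma recfn_add: "recfn k F \<Longrightarrow> recfn k G \<Longrightarrow> recfn k (\<lambda>xs. F xs + G xs)"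
proof -
  assume a: "recfn k F" "recfn k G"
  have e: "rec_nat a (\<lambda>i y. Suc y) b = a + b" for a b by (induction b) auto
  show "recfn k (\<lambda>xs. F xs + G xs)"
    using recfn_rec_nat[of k F "\<lambda>i y xs. Suc y" G] a by (simp add: e recfn_Suc recfn_proj)
qed

lemma recfn_pred: "recfn k F \<Longrightarrow> recfn k (\<lambda>xs. F xs - 1)"
proof -
  assume a: "recfn k F"
  have e: "rec_nat 0 (\<lambda>i y. i) b = b - 1" for b by (induction b) auto
  show "recfn k (\<lambda>xs. F xs - 1)"
    using recfn_rec_nat[of k "\<lambda>_. 0" "\<lambda>i y xs. i" F] a
    by (simp add: e[simplified] recfn_const recfn_proj)
qed

lemma recfn_diff: "recfn k F \<Longrightarrow> recfn k G \<Longrightarrow> recfn k (\<lambda>xs. F xs - G xs)"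
proof -
  assume a: "recfn k F" "recfn k G"
  have e: "rec_nat a (\<lambda>i y. y - 1) b = a - b" for a b by (induction b) auto
  show "recfn k (\<lambda>xs. F xs - G xs)"
    using recfn_rec_nat[of k F "\<lambda>i y xs. y - 1" G] a recfn_pred[OF recfn_proj[of 1 "Suc (Suc k)"]]
    by (simp add: e[simplified])
qed

lemma recfn_sum:
  assumes "recfn (Suc k) (\<lambda>ys. G (ys ! 0) (tl ys))" "recfn k B"
  shows "recfn k (\<lambda>xs. \<Sum>i<B xs. G i xs)"
proof -
  have "recfn (Suc (Suc k)) (\<lambda>ys. G (ys ! 0) (tl (tl ys)))"
  proof (rule recfn_cong)
    \<comment> \<open>The recursion inserts its accumulator behind the counter; this list drops it
      before \<open>G\<close> is applied.\<close>
    let ?Gs = "(\<lambda>ys. ys ! 0) # map (\<lambda>i ys. tl (tl ys) ! i) [0..<k]"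
    show "recfn (Suc (Suc k)) (\<lambda>ys. (\<lambda>ys. G (ys ! 0) (tl ys)) (map (\<lambda>G. G ys) ?Gs))"
      by (rule recfn_compose) (use assms(1) in \<open>auto intro: recfn_proj recfn_tl2\<close>)
    show "(\<lambda>ys. G (ys ! 0) (tl ys)) (map (\<lambda>G. G ys) ?Gs) = G (ys ! 0) (tl (tl ys))"
      if "length ys = Suc (Suc k)" for ys
      using that by (auto simp: comp_def intro!: arg_cong[of _ _ "G _"] nth_equalityI)
  qed
  then have "recfn k (\<lambda>xs. rec_nat 0 (\<lambda>i y. y + G i xs) (B xs))"
    using assms(2) by (intro recfn_rec_nat recfn_const recfn_add recfn_proj) auto
  moreover have "rec_nat 0 (\<lambda>i y. y + G i xs) n = (\<Sum>i<n. G i xs)" for n xs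
    by (induction n) auto
  ultimately show ?thesis by simp
qed

lemma recfn_mult: "recfn k F \<Longrightarrow> recfn k G \<Longrightarrow> recfn k (\<lambda>xs. F xs * G xs)"
proof -
  assume a: "recfn k F" "recfn k G"
  have e: "rec_nat 0 (\<lambda>i y. y + a) b = a * b" for a b :: nat by (induction b) auto
  have "recfn 2 (\<lambda>xs. rec_nat 0 (\<lambda>i y. y + xs ! 0) (xs ! 1))"
    by (intro recfn_rec_nat recfn_const recfn_add recfn_proj recfn_tl2) auto
  then show ?thesis
    using recfn_compose2[where h = "(*)", OF _ a] by (auto simp: e)
qed

lemma recfn_power: "recfn k F \<Longrightarrow> recfn k G \<Longrightarrow> recfn k (\<lambda>xs. F xs ^ G xs)"
proof -
  assume a: "recfn k F" "recfn k G"
  have e: "rec_nat 1 (\<lambda>i y. y * a) b = a ^ b" for a b :: nat by (induction b) auto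
  have "recfn 2 (\<lambda>xs. rec_nat 1 (\<lambda>i y. y * xs ! 0) (xs ! 1))"
    by (intro recfn_rec_nat recfn_const recfn_mult recfn_proj recfn_tl2) auto
  then show ?thesis
    using recfn_compose2[where h = "(^)", OF _ a] by (auto simp only: e)
qed

section \<open>Decidable predicates and bounded quantifiers\<close>

lemma recpr_le: "recfn k F \<Longrightarrow> recfn k G \<Longrightarrow> recpr k (\<lambda>xs. F xs \<le> G xs)"
  unfolding recpr_def
  by (rule recfn_cong[of _ "\<lambda>xs. 1 - (F xs - G xs)"]) (auto intro: recfn_diff recfn_const)

lemma recpr_not: "recpr k P \<Longrightarrow> recpr k (\<lambda>xs. \<not> P xs)"
  unfolding recpr_def
  by (rule recfn_cong[of _ "\<lambda>xs. 1 - of_bool (P xs)"]) (auto intro: recfn_diff recfn_const)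

lemma recpr_conj: "recpr k P \<Longrightarrow> recpr k Q \<Longrightarrow> recpr k (\<lambda>xs. P xs \<and> Q xs)"
  unfolding recpr_def
  by (rule recfn_cong[of _ "\<lambda>xs. of_bool (P xs) * of_bool (Q xs)"])
    (auto intro: recfn_mult)

lemma recpr_disj: "recpr k P \<Longrightarrow> recpr k Q \<Longrightarrow> recpr k (\<lambda>xs. P xs \<or> Q xs)"
  using recpr_not[OF recpr_conj[OF recpr_not recpr_not]] by (simp add: de_Morgan_conj)

lemma recpr_less: "recfn k F \<Longrightarrow> recfn k G \<Longrightarrow> recpr k (\<lambda>xs. F xs < G xs)"
  using recpr_not[OF recpr_le[of k G F]] by (simp add: not_le)

lemma recpr_eq: "recfn k F \<Longrightarrow> recfn k G \<Longrightarrow> recpr k (\<lambda>xs. F xs = G xs)"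
  using recpr_conj[OF recpr_le[of k F G] recpr_le[of k G F]] by (simp add: eq_iff)

lemma recfn_if: "recpr k P \<Longrightarrow> recfn k F \<Longrightarrow> recfn k G \<Longrightarrow>
    recfn k (\<lambda>xs. if P xs then F xs else G xs)"
  unfolding recpr_def
  by (rule recfn_cong[of _ "\<lambda>xs. of_bool (P xs) * F xs + (1 - of_bool (P xs)) * G xs"])
    (auto intro!: recfn_mult recfn_add recfn_diff recfn_const)

lemma recpr_ex:
  assumes "recpr (Suc k) (\<lambda>ys. P (ys ! 0) (tl ys))" "recfn k B"
  shows "recpr k (\<lambda>xs. \<exists>i<B xs. P i xs)"
proof -
  have "recpr k (\<lambda>xs. 0 < (\<Sum>i<B xs. of_bool (P i xs) :: nat))"
    by (intro recpr_less recfn_const recfn_sum assms(1)[unfolded recpr_def] assms(2))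
  moreover have "(0 < (\<Sum>i<n. of_bool (P i xs) :: nat)) \<longleftrightarrow> (\<exists>i<n. P i xs)" for n xs
    by (auto simp: zero_less_iff_neq_zero)
  ultimately show ?thesis by simp
qed

lemma recpr_all:
  assumes "recpr (Suc k) (\<lambda>ys. P (ys ! 0) (tl ys))" "recfn k B"
  shows "recpr k (\<lambda>xs. \<forall>i<B xs. P i xs)"
  using recpr_not[OF recpr_ex[OF recpr_not[OF assms(1)] assms(2)]] by simp

text \<open>\<open>Mu\<close> looks for a zero, hence the indicator of the negation. A witness is
  required only for the parameters \<open>xs\<close> at hand, so the rule also applies to searches
  that fail for other parameters.\<close>

lemma rec_eval_Mu_Least:
  assumes r: "\<And>m. rec_eval r (m # xs) (of_bool (\<not> P m))" and "P m0"
  shows "rec_eval (Mu r) xs (LEAST m. P m)"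
proof (rule eval_Mu)
  show "\<exists>y. rec_eval r (m # xs) (Suc y)" if "m < (LEAST m. P m)" for m
    using r[of m] not_less_Least[OF that] by auto
  show "rec_eval r ((LEAST m. P m) # xs) 0"
    using r[of "LEAST m. P m"] LeastI[of P m0] assms(2) by auto
qed

lemma recpr_program:
  assumes "recpr (Suc k) (\<lambda>ys. P (ys ! 0) (tl ys))"
  obtains r where "\<And>m xs. length xs = k \<Longrightarrow> rec_eval r (m # xs) (of_bool (\<not> P m xs))"
proof -
  obtain r where r: "\<And>ys. length ys = Suc k \<Longrightarrow> rec_eval r ys (of_bool (\<not> P (ys ! 0) (tl ys)))"
    using recpr_not[OF assms] unfolding recpr_def recfn_def by blast
  show ?thesis
  proof (rule that)
    show "rec_eval r (m # xs) (of_bool (\<not> P m xs))" if "length xs = k" for m xs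
      using r[of "m # xs"] that by simp
  qed
qed

lemma recfn_Least:
  assumes "recpr (Suc k) (\<lambda>ys. P (ys ! 0) (tl ys))" "\<And>xs. length xs = k \<Longrightarrow> \<exists>m. P m xs"
  shows "recfn k (\<lambda>xs. LEAST m. P m xs)"
proof -
  obtain r where r: "\<And>m xs. length xs = k \<Longrightarrow> rec_eval r (m # xs) (of_bool (\<not> P m xs))"
    using recpr_program[OF assms(1)] by blast
  then show ?thesis
    using assms(2) rec_eval_Mu_Least unfolding recfn_def by metis
qed

lemma recfn_div: "recfn k F \<Longrightarrow> recfn k G \<Longrightarrow> recfn k (\<lambda>xs. F xs div G xs)"
proof -
  assume a: "recfn k F" "recfn k G"
  \<comment> \<open>Division as a search; the disjunct \<open>y = 0\<close> makes it stop at
    \<open>0\<close>, in agreement with \<open>x div 0 = 0\<close>.\<close>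
  have *: "x div y = (LEAST q. x < y * Suc q \<or> y = 0)" for x y :: nat
  proof (rule Least_equality[symmetric])
    show "x < y * Suc (x div y) \<or> y = 0"
      using dividend_less_times_div[of y x] by auto
    show "x div y \<le> q" if "x < y * Suc q \<or> y = 0" for q
      using that by (metis div_by_0 le0 less_Suc_eq_le less_mult_imp_div_less mult.commute)
  qed
  have "recfn 2 (\<lambda>xs. LEAST q. xs ! 0 < xs ! 1 * Suc q \<or> xs ! 1 = 0)"
  proof (rule recfn_Least)
    fix xs :: "nat list"
    have "xs ! 0 < xs ! 1 * Suc (xs ! 0) \<or> xs ! 1 = 0" by (cases "xs ! 1") auto
    then show "\<exists>m. xs ! 0 < xs ! 1 * Suc m \<or> xs ! 1 = 0" ..
  qed (intro recpr_disj recpr_less recpr_eq recfn_mult recfn_Suc recfn_tl recfn_proj recfn_const; simp)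
  then show ?thesis
    using recfn_compose2[where h = "(div)", OF _ a] by (simp_all only: *)
qed

lemma recpr_odd: "recfn k F \<Longrightarrow> recpr k (\<lambda>xs. odd (F xs))"
proof -
  assume a: "recfn k F"
  have "recpr k (\<lambda>xs. F xs \<noteq> 2 * (F xs div 2))"
    by (intro recpr_not recpr_eq recfn_mult recfn_div recfn_const a)
  moreover have "F xs \<noteq> 2 * (F xs div 2) \<longleftrightarrow> odd (F xs)" for xs by presburger
  ultimately show ?thesis by simp
qed

lemmas recfn_intros = recfn_const recfn_proj recfn_tl recfn_tl2 recfn_Suc recfn_add recfn_diff
  recfn_mult recfn_power recfn_div recfn_if recfn_sum recpr_le recpr_less recpr_eq recpr_not
  recpr_conj recpr_disj recpr_ex recpr_all recpr_odd

section \<open>Evaluation by stages\<close>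

text \<open>
  The value \<open>0\<close> means that no result is found within \<open>s\<close>, the value \<open>Suc y\<close> that the result is
  \<open>y\<close>. The bound \<open>s\<close> only limits the unbounded searches.
\<close>

fun eval_upto :: "recf \<Rightarrow> nat \<Rightarrow> nat list \<Rightarrow> nat" where
  "eval_upto Zero s xs = 1"
| "eval_upto Succ s xs = (if length xs = 1 then Suc (Suc (xs ! 0)) else 0)"
| "eval_upto (Proj i) s xs = (if i < length xs then Suc (xs ! i) else 0)"
| "eval_upto (Comp f gs) s xs =
    (if \<forall>g\<in>set gs. eval_upto g s xs \<noteq> 0 then eval_upto f s (map (\<lambda>g. eval_upto g s xs - 1) gs) else 0)"
| "eval_upto (Prim f g) s xs =
    (if xs = [] then 0
     else rec_nat (eval_upto f s (tl xs)) (\<lambda>i y. if y = 0 then 0 else eval_upto g s (i # (y - 1) # tl xs)) (xs ! 0))"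
| "eval_upto (Mu f) s xs =
    (let m = LEAST m. s \<le> m \<or> eval_upto f s (m # xs) \<le> 1
     in if m < s \<and> eval_upto f s (m # xs) = 1 then Suc m else 0)"

lemma eval_upto_Prim_Suc:
  "eval_upto (Prim f g) s (Suc n # xs) =
    (if eval_upto (Prim f g) s (n # xs) = 0 then 0 else eval_upto g s (n # (eval_upto (Prim f g) s (n # xs) - 1) # xs))"
  by (simp cong: if_cong)

text \<open>The search in the definition stops at values \<open>0\<close> (nothing found within
  \<open>s\<close>) as well as \<open>1\<close> (code of the result zero). So an argument without a
  value blocks the search instead of being skipped, as the semantics of \<open>Mu\<close>
  demands.\<close>

lemma eval_upto_Mu_iff:
  "eval_upto (Mu f) s xs = Suc m \<longleftrightarrow>
    m < s \<and> eval_upto f s (m # xs) = 1 \<and> (\<forall>i<m. 1 < eval_upto f s (i # xs))" (is "?L \<longleftrightarrow> ?R")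
proof
  define n where "n = (LEAST m. s \<le> m \<or> eval_upto f s (m # xs) \<le> 1)"
  assume ?L
  then have "n = m" "m < s" "eval_upto f s (m # xs) = 1"
    by (auto simp: n_def Let_def split: if_splits)
  moreover have "1 < eval_upto f s (i # xs)" if "i < n" for i
    using not_less_Least[OF that[unfolded n_def]] by auto
  ultimately show ?R by auto
next
  assume R: ?R
  then have "(LEAST m. s \<le> m \<or> eval_upto f s (m # xs) \<le> 1) = m"
    by (intro Least_equality) (auto simp: not_less[symmetric] dest: leD)
  then show ?L using R by simp
qed

text \<open>A search that succeeds within \<open>s\<close> has met only nonzero results before its
  end; by induction these results persist, so the search ends at the same place within
  \<open>t\<close>.\<close>

lemma eval_upto_mono: "eval_upto r s xs = Suc y \<Longrightarrow> s \<le> t \<Longrightarrow> eval_upto r t xs = Suc y"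
proof (induction r arbitrary: xs y)
  case (Comp f gs)
  have nz: "\<forall>g\<in>set gs. eval_upto g s xs \<noteq> 0" and f: "eval_upto f s (map (\<lambda>g. eval_upto g s xs - 1) gs) = Suc y"
    using Comp.prems by (auto split: if_splits)
  have "eval_upto g t xs = eval_upto g s xs" if "g \<in> set gs" for g
    using Comp.IH(2)[OF that _ Comp.prems(2)] nz that by (metis not0_implies_Suc)
  then show ?case
    using nz Comp.IH(1)[OF f Comp.prems(2)] by (simp cong: map_cong)
next
  case (Prim f g)
  have "eval_upto (Prim f g) s (n # zs) = Suc y \<Longrightarrow> eval_upto (Prim f g) t (n # zs) = Suc y" for n zs y
  proof (induction n arbitrary: y)
    case 0
    then show ?case using Prim.IH(1) Prim.prems(2) by simp
  next
    case (Suc n)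
    obtain z where z: "eval_upto (Prim f g) s (n # zs) = Suc z" "eval_upto g s (n # z # zs) = Suc y"
      using Suc.prems unfolding eval_upto_Prim_Suc
      by (metis (no_types, lifting) diff_Suc_1 nat.distinct(1) not0_implies_Suc)
    show ?case
      unfolding eval_upto_Prim_Suc Suc.IH[OF z(1)] using Prim.IH(2)[OF z(2) Prim.prems(2)] by simp
  qed
  then show ?case using Prim.prems(1) by (cases xs) auto
next
  case (Mu f)
  have "1 < eval_upto f t (i # xs)" if "i < y" for i
  proof -
    have "1 < eval_upto f s (i # xs)" using Mu.prems that unfolding eval_upto_Mu_iff by blast
    then show ?thesis using Mu.IH[of "i # xs" "eval_upto f s (i # xs) - 1"] Mu.prems(2) by simp
  qed
  then show ?case using Mu unfolding eval_upto_Mu_iff by simp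
qed (auto split: if_splits)

lemma eval_upto_sound: "eval_upto r s xs = Suc y \<Longrightarrow> rec_eval r xs y"
proof (induction r arbitrary: xs y)
  case Succ
  then show ?case by (auto simp: length_Suc_conv intro: eval_Succ split: if_splits)
next
  case (Comp f gs)
  have nz: "\<forall>g\<in>set gs. eval_upto g s xs \<noteq> 0" and f: "eval_upto f s (map (\<lambda>g. eval_upto g s xs - 1) gs) = Suc y"
    using Comp.prems by (auto split: if_splits)
  have "rec_eval g xs (eval_upto g s xs - 1)" if "g \<in> set gs" for g
    using Comp.IH(2)[OF that] nz that by (metis Suc_pred' neq0_conv)
  then show ?case
    by (intro eval_Comp[OF _ _ Comp.IH(1)[OF f]]) auto
next
  case (Prim f g)
  have "eval_upto (Prim f g) s (n # zs) = Suc y \<Longrightarrow> rec_eval (Prim f g) (n # zs) y" for n zs y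
  proof (induction n arbitrary: y)
    case 0
    then show ?case using Prim.IH(1) by (simp add: eval_Prim0)
  next
    case (Suc n)
    obtain z where z: "eval_upto (Prim f g) s (n # zs) = Suc z" "eval_upto g s (n # z # zs) = Suc y"
      using Suc.prems unfolding eval_upto_Prim_Suc
      by (metis (no_types, lifting) diff_Suc_1 nat.distinct(1) not0_implies_Suc)
    show ?case
      by (rule eval_PrimSuc[OF Suc.IH[OF z(1)] Prim.IH(2)[OF z(2)]])
  qed
  then show ?case using Prim.prems(1) by (cases xs) auto
next
  case (Mu f)
  show ?case
  proof (rule eval_Mu)
    show "rec_eval f (y # xs) 0"
      using Mu.prems Mu.IH[of "y # xs" 0] unfolding eval_upto_Mu_iff by simp
    show "\<exists>z. rec_eval f (m # xs) (Suc z)" if "m < y" for m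
    proof -
      have "1 < eval_upto f s (m # xs)" using Mu.prems that unfolding eval_upto_Mu_iff by blast
      then have "eval_upto f s (m # xs) = Suc (Suc (eval_upto f s (m # xs) - 2))" by simp
      then show ?thesis using Mu.IH by blast
    qed
  qed
qed (auto intro: rec_eval.intros split: if_splits)

text \<open>Needed for the finitely many arguments of a composition and the finitely many tests of a
  successful search, which must all be evaluated with one common bound.\<close>

lemma common_stage:
  fixes n :: nat
  assumes "\<And>i. i < n \<Longrightarrow> \<exists>s::nat. P i s" "\<And>i s t. P i s \<Longrightarrow> s \<le> t \<Longrightarrow> P i t"
  shows "\<exists>s. \<forall>i<n. P i s"
  using assms(1)
proof (induction n)
  case (Suc n)
  then obtain s t where "\<forall>i<n. P i s" "P n t" by (metis lessI less_SucI)
  then have "\<forall>i<Suc n. P i (max s t)"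
    using assms(2) by (metis less_Suc_eq max.cobounded1 max.cobounded2)
  then show ?case ..
qed simp

lemma eval_upto_complete: "rec_eval r xs y \<Longrightarrow> \<exists>s. eval_upto r s xs = Suc y"
proof (induction rule: rec_eval.induct)
  case (eval_Comp ys gs xs f z)
  have "\<exists>s. \<forall>i<length gs. eval_upto (gs ! i) s xs = Suc (ys ! i)"
    by (rule common_stage) (use eval_Comp.IH(1) eval_upto_mono in blast)+
  then obtain s where s: "\<forall>i<length gs. eval_upto (gs ! i) s xs = Suc (ys ! i)" ..
  obtain s' where s': "eval_upto f s' ys = Suc z" using eval_Comp.IH(2) by blast
  define t where "t = max s s'"
  have t: "eval_upto (gs ! i) t xs = Suc (ys ! i)" if "i < length gs" for i
    using s that eval_upto_mono[of _ s _ _ t] by (auto simp: t_def)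
  then have "map (\<lambda>g. eval_upto g t xs - 1) gs = ys" "\<forall>g\<in>set gs. eval_upto g t xs \<noteq> 0"
    using eval_Comp.hyps by (auto intro: nth_equalityI simp: in_set_conv_nth)
  moreover have "eval_upto f t ys = Suc z"
    using s' eval_upto_mono[of f s' _ _ t] by (auto simp: t_def)
  ultimately have "eval_upto (Comp f gs) t xs = Suc z" by simp
  then show ?case ..
next
  case (eval_PrimSuc f g n xs y z)
  then obtain s s' where "eval_upto (Prim f g) s (n # xs) = Suc y" "eval_upto g s' (n # y # xs) = Suc z"
    by blast
  then have "eval_upto (Prim f g) (max s s') (n # xs) = Suc y" "eval_upto g (max s s') (n # y # xs) = Suc z"
    by (metis eval_upto_mono max.cobounded1, metis eval_upto_mono max.cobounded2)
  then have "eval_upto (Prim f g) (max s s') (Suc n # xs) = Suc z"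
    unfolding eval_upto_Prim_Suc by simp
  then show ?case ..
next
  case (eval_Mu n f xs)
  have "\<exists>s. \<forall>m<n. \<exists>y. eval_upto f s (m # xs) = Suc (Suc y)"
    by (rule common_stage) (use eval_Mu.IH(1) eval_upto_mono in blast)+
  then obtain s where s: "\<forall>m<n. \<exists>y. eval_upto f s (m # xs) = Suc (Suc y)" ..
  obtain s' where s': "eval_upto f s' (n # xs) = Suc 0" using eval_Mu.IH(2) by blast
  \<comment> \<open>The bound must also exceed \<open>n\<close> itself, because searches try only
    arguments below it.\<close>
  define t where "t = Suc (max n (max s s'))"
  have "s \<le> t" "s' \<le> t" "n < t" by (auto simp: t_def)
  then have "eval_upto (Mu f) t xs = Suc n"
    unfolding eval_upto_Mu_iff using s eval_upto_mono[OF s' \<open>s' \<le> t\<close>] eval_upto_mono[OF _ \<open>s \<le> t\<close>, of f] by fastforce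
  then show ?case ..
qed auto

lemma recpr_list_all:
  "(\<And>g. g \<in> set gs \<Longrightarrow> recpr k (P g)) \<Longrightarrow> recpr k (\<lambda>xs. \<forall>g\<in>set gs. P g xs)"
proof (induction gs)
  case Nil
  then show ?case by (simp add: recpr_def recfn_const)
next
  case (Cons a gs)
  then show ?case by (simp add: recpr_conj)
qed

text \<open>The program \<open>r\<close> is fixed: the induction on \<open>r\<close> builds a
  separate recursive stage function for each program. All the effort goes into rearranging
  arguments.\<close>

lemma recfn_eval_upto: "recfn (Suc k) (\<lambda>ys. eval_upto r (ys ! 0) (tl ys))"
proof (induction r arbitrary: k)
  case Zero
  then show ?case by (simp add: recfn_const)
next
  case Succ
  show ?case
  proof (cases "k = 1")
    case True
    have "recfn (Suc k) (\<lambda>ys. Suc (Suc (tl ys ! 0)))"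
      by (intro recfn_intros) (use True in auto)
    then show ?thesis by (rule recfn_cong) (use True in auto)
  next
    case False
    show ?thesis by (rule recfn_cong[OF recfn_const[of _ 0]]) (use False in auto)
  qed
next
  case (Proj i)
  show ?case
  proof (cases "i < k")
    case True
    have "recfn (Suc k) (\<lambda>ys. Suc (tl ys ! i))"
      by (intro recfn_intros) (use True in auto)
    then show ?thesis by (rule recfn_cong) (use True in auto)
  next
    case False
    show ?thesis by (rule recfn_cong[OF recfn_const[of _ 0]]) (use False in auto)
  qed
next
  case (Comp f gs)
  let ?Gs = "(\<lambda>ys. ys ! 0) # map (\<lambda>g ys. eval_upto g (ys ! 0) (tl ys) - 1) gs"
  have "recfn (Suc k) (\<lambda>xs. (\<lambda>ys. eval_upto f (ys ! 0) (tl ys)) (map (\<lambda>G. G xs) ?Gs))"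
    by (rule recfn_compose) (use Comp in \<open>auto intro!: recfn_diff recfn_const recfn_proj\<close>)
  then have "recfn (Suc k) (\<lambda>xs. if \<forall>g\<in>set gs. eval_upto g (xs ! 0) (tl xs) \<noteq> 0
      then (\<lambda>ys. eval_upto f (ys ! 0) (tl ys)) (map (\<lambda>G. G xs) ?Gs) else 0)"
    by (intro recfn_if recpr_list_all recpr_not recpr_eq recfn_const Comp.IH)
  then show ?case by (rule recfn_cong) (auto simp: comp_def)
next
  case (Prim f g)
  show ?case
  proof (cases k)
    case 0
    show ?thesis
      by (rule recfn_cong[OF recfn_const[of _ 0]]) (use 0 in \<open>auto simp: length_Suc_conv\<close>)
  next
    case (Suc k')
    let ?Gs = "(\<lambda>ys. ys ! 0) # map (\<lambda>i ys. tl (tl ys) ! i) [0..<k']"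
    have 1: "recfn (Suc k) (\<lambda>xs. (\<lambda>ys. eval_upto f (ys ! 0) (tl ys)) (map (\<lambda>G. G xs) ?Gs))"
      by (rule recfn_compose) (use Prim Suc in \<open>auto intro!: recfn_tl2 recfn_proj\<close>)
    \<comment> \<open>Here the arguments are the counter, the accumulator, the stage, the recursion
      argument and then the parameters, so that the stage has index \<open>2\<close> and the
      parameters start at index \<open>4\<close>.\<close>
    let ?Hs = "(\<lambda>ys. ys ! 2) # (\<lambda>ys. ys ! 0) # (\<lambda>ys. ys ! 1 - 1) #
      map (\<lambda>i ys. ys ! (i + 4)) [0..<k']"
    have "recfn (Suc (Suc (Suc k))) (\<lambda>xs. (\<lambda>ys. eval_upto g (ys ! 0) (tl ys)) (map (\<lambda>G. G xs) ?Hs))"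
      by (rule recfn_compose)
        (use Prim Suc in \<open>auto intro!: recfn_diff recfn_const recfn_proj\<close>)
    then have 2: "recfn (Suc (Suc (Suc k))) (\<lambda>xs. if xs ! 1 = 0 then 0 else
        (\<lambda>ys. eval_upto g (ys ! 0) (tl ys)) (map (\<lambda>G. G xs) ?Hs))"
      by (intro recfn_if recpr_eq recfn_const recfn_proj) auto
    have 3: "recfn (Suc (Suc (Suc k))) (\<lambda>ys. if ys ! 1 = 0 then 0 else
        eval_upto g (tl (tl ys) ! 0) (ys ! 0 # (ys ! 1 - 1) # tl (tl (tl (tl ys)))))"
    proof (rule recfn_cong[OF 2])
      fix ys :: "nat list"
      assume l: "length ys = Suc (Suc (Suc k))"
      have "tl (tl (tl (tl ys))) = map (\<lambda>i. ys ! (i + 4)) [0..<k']"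
        using l Suc by (intro nth_equalityI) (auto simp: nth_tl eval_nat_numeral)
      moreover have "tl (tl ys) ! 0 = ys ! 2"
        using l Suc by (simp add: nth_tl numeral_2_eq_2)
      ultimately show "(if ys ! 1 = 0 then 0 else
          (\<lambda>ys. eval_upto g (ys ! 0) (tl ys)) (map (\<lambda>G. G ys) ?Hs)) = (if ys ! 1 = 0 then 0 else
          eval_upto g (tl (tl ys) ! 0) (ys ! 0 # (ys ! 1 - 1) # tl (tl (tl (tl ys)))))"
        by (simp add: comp_def)
    qed
    have "recfn (Suc k) (\<lambda>xs. rec_nat ((\<lambda>ys. eval_upto f (ys ! 0) (tl ys)) (map (\<lambda>G. G xs) ?Gs))
        (\<lambda>i y. if y = 0 then 0 else eval_upto g (xs ! 0) (i # (y - 1) # tl (tl xs))) (tl xs ! 0))"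
      by (rule recfn_rec_nat[where S = "\<lambda>i y xs. if y = 0 then 0
            else eval_upto g (xs ! 0) (i # (y - 1) # tl (tl xs))"])
        (use 1 3 Suc in \<open>auto intro!: recfn_tl\<close>)
    then show ?thesis
    proof (rule recfn_cong)
      fix xs :: "nat list"
      assume l: "length xs = Suc k"
      have "map ((!) (tl (tl xs))) [0..<k'] = tl (tl xs)"
        using l Suc by (intro nth_equalityI) auto
      moreover have "tl xs \<noteq> []" using l Suc by (cases xs) auto
      ultimately show "rec_nat ((\<lambda>ys. eval_upto f (ys ! 0) (tl ys)) (map (\<lambda>G. G xs) ?Gs))
        (\<lambda>i y. if y = 0 then 0 else eval_upto g (xs ! 0) (i # (y - 1) # tl (tl xs))) (tl xs ! 0) =
        eval_upto (Prim f g) (xs ! 0) (tl xs)"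
        by (simp add: comp_def)
    qed
  qed
next
  case (Mu f)
  \<comment> \<open>The search variable precedes the stage, whereas the stage function of
    \<open>f\<close> expects the stage first.\<close>
  let ?Hs = "(\<lambda>ys. ys ! 1) # (\<lambda>ys. ys ! 0) # map (\<lambda>i ys. ys ! (i + 2)) [0..<k]"
  have "recfn (Suc (Suc k)) (\<lambda>xs. (\<lambda>ys. eval_upto f (ys ! 0) (tl ys)) (map (\<lambda>G. G xs) ?Hs))"
    by (rule recfn_compose) (use Mu in \<open>auto intro!: recfn_proj\<close>)
  then have 1: "recfn (Suc (Suc k)) (\<lambda>xs. eval_upto f (tl xs ! 0) (xs ! 0 # tl (tl xs)))"
  proof (rule recfn_cong)
    fix xs :: "nat list"
    assume l: "length xs = Suc (Suc k)"
    have "map (\<lambda>i. xs ! (i + 2)) [0..<k] = tl (tl xs)"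
      using l by (intro nth_equalityI) (auto simp: nth_tl)
    then show "(\<lambda>ys. eval_upto f (ys ! 0) (tl ys)) (map (\<lambda>G. G xs) ?Hs) =
        eval_upto f (tl xs ! 0) (xs ! 0 # tl (tl xs))"
      using l by (simp add: nth_tl comp_def)
  qed
  let ?m = "\<lambda>xs. LEAST m. xs ! 0 \<le> m \<or> eval_upto f (xs ! 0) (m # tl xs) \<le> 1"
  have 2: "recfn (Suc k) ?m"
    by (rule recfn_Least, intro recpr_disj recpr_le recfn_const 1 recfn_tl recfn_proj) auto
  have "recfn (Suc k) (\<lambda>xs. (\<lambda>ys. eval_upto f (tl ys ! 0) (ys ! 0 # tl (tl ys)))
      (map (\<lambda>G. G xs) (?m # map (\<lambda>i xs. xs ! i) [0..<Suc k])))"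
    by (rule recfn_compose) (use 1 2 in \<open>auto intro!: recfn_proj\<close>)
  then have 3: "recfn (Suc k) (\<lambda>xs. eval_upto f (xs ! 0) (?m xs # tl xs))"
  proof (rule recfn_cong)
    fix xs :: "nat list"
    assume "length xs = Suc k"
    then have "map (\<lambda>i. xs ! i) [0..<Suc k] = xs" by (metis map_nth)
    then have "map (\<lambda>G. G xs) (?m # map (\<lambda>i xs. xs ! i) [0..<Suc k]) = ?m xs # xs"
      by (simp add: comp_def del: upt_Suc)
    then show "(\<lambda>ys. eval_upto f (tl ys ! 0) (ys ! 0 # tl (tl ys)))
        (map (\<lambda>G. G xs) (?m # map (\<lambda>i xs. xs ! i) [0..<Suc k])) = eval_upto f (xs ! 0) (?m xs # tl xs)"
      by simp
  qed
  show ?case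
    unfolding eval_upto.simps Let_def
    by (intro recfn_if recpr_conj recpr_less recpr_eq recfn_Suc recfn_const 2 3 recfn_proj) auto
qed

lemma halting_stages:
  obtains H :: "nat \<Rightarrow> nat \<Rightarrow> bool" where
    "recpr 2 (\<lambda>xs. H (xs ! 0) (xs ! 1))"
    "\<And>s t x. H s x \<Longrightarrow> s \<le> t \<Longrightarrow> H t x"
    "\<And>x y. rec_eval r [x] y \<Longrightarrow> \<exists>s. H s x"
    "\<And>s x y. H s x \<Longrightarrow> rec_eval r [x] y \<Longrightarrow> y < s"
proof
  \<comment> \<open>The second conjunct says \<open>Suc y \<le> s\<close> for the value
    \<open>y\<close> found, which yields the bound \<open>y < s\<close>. It has to be imposed:
    \<open>s\<close> limits only the searches, so a large value may be found at a small
    stage.\<close>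
  let ?H = "\<lambda>s x. eval_upto r s [x] \<noteq> 0 \<and> eval_upto r s [x] \<le> s"
  have 1: "recfn 2 (\<lambda>xs. eval_upto r (xs ! 0) [xs ! 1])"
    by (rule recfn_cong[OF recfn_eval_upto[of 1 r, unfolded Suc_1]])
      (auto simp: numeral_2_eq_2 length_Suc_conv)
  show "recpr 2 (\<lambda>xs. ?H (xs ! 0) (xs ! 1))"
    by (intro recpr_conj recpr_not recpr_le recpr_eq 1 recfn_const recfn_proj) auto
  show "?H t x" if "?H s x" "s \<le> t" for s t x
    using that eval_upto_mono[of r s "[x]" _ t] by (metis le_trans not0_implies_Suc)
  show "\<exists>s. ?H s x" if r: "rec_eval r [x] y" for x y
  proof -
    obtain s where s: "eval_upto r s [x] = Suc y" using eval_upto_complete[OF r] by blast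
    then have "eval_upto r (max s (Suc y)) [x] = Suc y" by (rule eval_upto_mono) simp
    then have "?H (max s (Suc y)) x" by simp
    then show ?thesis ..
  qed
  show "y < s" if H: "?H s x" and r: "rec_eval r [x] y" for s x y
  proof -
    obtain z where z: "eval_upto r s [x] = Suc z" using H by (metis not0_implies_Suc)
    then have "z = y" using eval_upto_sound r rec_eval_functional by blast
    then show ?thesis using z H by simp
  qed
qed

section \<open>Register programs on oracle Turing machines\<close>

datatype cond = NonZero nat | Sees "sym \<Rightarrow> bool"

text \<open>A structured language between recursive functions and machines. The Boolean in
  \<open>Write\<close> and \<open>Move\<close> names a tape: \<open>False\<close> is tape
  \<open>0\<close> with input and output, \<open>True\<close> is the query tape
  \<open>1\<close>.\<close>

datatype com =
    Skip
  | Inc nat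
  | Dec nat
  | Write bool "bool option"
  | Move bool move
  | Ask
  | Seq com com (infixr ";;" 60)
  | Branch cond com com
  | Loop cond com

type_synonym store = "(bool \<Rightarrow> tape) \<times> (nat \<Rightarrow> nat)"

fun holds :: "cond \<Rightarrow> store \<Rightarrow> bool" where
  "holds (NonZero i) (T, \<sigma>) \<longleftrightarrow> \<sigma> i \<noteq> 0"
| "holds (Sees p) (T, \<sigma>) \<longleftrightarrow> p (fst (T False) (snd (T False)))"

fun sym_of :: "bool option \<Rightarrow> sym" where
  "sym_of None = Blank"
| "sym_of (Some b) = Bit b"

definition shift_head :: "move \<Rightarrow> tape \<Rightarrow> tape" where
  "shift_head m t = (fst t, snd t + shift m)"

text \<open>\<open>Ask\<close> adds the answer to register \<open>0\<close> instead of storing it: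
  on the machine this is a single head movement, made on leaving the yes-state. Clearing the
  register is left to the program.\<close>

inductive exec :: "bstring set \<Rightarrow> com \<Rightarrow> store \<Rightarrow> store \<Rightarrow> bool" for A where
  exec_Skip: "exec A Skip s s"
| exec_Inc: "exec A (Inc i) (T, \<sigma>) (T, \<sigma>(i := Suc (\<sigma> i)))"
| exec_Dec: "exec A (Dec i) (T, \<sigma>) (T, \<sigma>(i := \<sigma> i - 1))"
| exec_Write: "exec A (Write j a) (T, \<sigma>) (T(j := act (sym_of a, Stay) (T j)), \<sigma>)"
| exec_Move: "exec A (Move j m) (T, \<sigma>) (T(j := shift_head m (T j)), \<sigma>)"
| exec_Ask: "exec A Ask (T, \<sigma>) (T, \<sigma>(0 := \<sigma> 0 + of_bool (\<exists>w\<in>A. tape_word (T True) w)))"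
| exec_Seq: "exec A c s s' \<Longrightarrow> exec A d s' s'' \<Longrightarrow> exec A (c ;; d) s s''"
| exec_BranchT: "holds b s \<Longrightarrow> exec A c s s' \<Longrightarrow> exec A (Branch b c d) s s'"
| exec_BranchF: "\<not> holds b s \<Longrightarrow> exec A d s s' \<Longrightarrow> exec A (Branch b c d) s s'"
| exec_LoopT: "holds b s \<Longrightarrow> exec A c s s' \<Longrightarrow> exec A (Loop b c) s' s'' \<Longrightarrow> exec A (Loop b c) s s''"
| exec_LoopF: "\<not> holds b s \<Longrightarrow> exec A (Loop b c) s s"

fun cond_regs :: "cond \<Rightarrow> nat set" where
  "cond_regs (NonZero i) = {i}"
| "cond_regs (Sees p) = {}"

fun regs :: "com \<Rightarrow> nat set" where
  "regs (Inc i) = {i}"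
| "regs (Dec i) = {i}"
| "regs Ask = {0}"
| "regs (c ;; d) = regs c \<union> regs d"
| "regs (Branch b c d) = cond_regs b \<union> regs c \<union> regs d"
| "regs (Loop b c) = cond_regs b \<union> regs c"
| "regs _ = {}"

lemma finite_regs: "finite (regs c)"
proof (induction c)
  case (Branch b c d)
  then show ?case by (cases b) auto
next
  case (Loop b c)
  then show ?case by (cases b) auto
qed auto

section \<open>Compilation to instruction lists and to machines\<close>

datatype instr =
    IInc nat
  | IDec nat
  | IWrite bool "bool option"
  | IMove bool move
  | IAsk
  | IJumpUnless cond nat
  | IJump nat

fun csize :: "com \<Rightarrow> nat" where
  "csize Skip = 0"
| "csize (c ;; d) = csize c + csize d"
| "csize (Branch b c d) = csize c + csize d + 2"
| "csize (Loop b c) = csize c + 2"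
| "csize _ = 1"

text \<open>The argument \<open>l\<close> is the address of the first instruction, as jumps are
  absolute. Code sizes do not depend on addresses, so \<open>csize\<close> yields every target in
  advance.\<close>

fun compile :: "com \<Rightarrow> nat \<Rightarrow> instr list" where
  "compile Skip l = []"
| "compile (Inc i) l = [IInc i]"
| "compile (Dec i) l = [IDec i]"
| "compile (Write j a) l = [IWrite j a]"
| "compile (Move j m) l = [IMove j m]"
| "compile Ask l = [IAsk]"
| "compile (c ;; d) l = compile c l @ compile d (l + csize c)"
| "compile (Branch b c d) l =
    IJumpUnless b (l + csize c + 2) # compile c (Suc l) @
    IJump (l + csize c + csize d + 2) # compile d (l + csize c + 2)"
| "compile (Loop b c) l =
    IJumpUnless b (l + csize c + 2) # compile c (Suc l) @ [IJump l]"

lemma length_compile [simp]: "length (compile c l) = csize c"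
  by (induction c l rule: compile.induct) auto

abbreviation keep :: "sym list \<Rightarrow> (sym \<times> move) list" where
  "keep as \<equiv> map (\<lambda>a. (a, Stay)) as"

fun test :: "cond \<Rightarrow> sym list \<Rightarrow> bool" where
  "test (NonZero i) as \<longleftrightarrow> as ! (i + 3) \<noteq> Aux 0"
| "test (Sees p) as \<longleftrightarrow> p (as ! 0)"

text \<open>
  A register is the head position on a tape of its own, whose cell \<open>0\<close> is marked by \<open>Aux 0\<close>.
  Tape \<open>2\<close> carries the return address of the current oracle query, since all queries
  come back through the same two states.
\<close>

fun instr_step :: "nat \<Rightarrow> instr \<Rightarrow> nat \<Rightarrow> sym list \<Rightarrow> nat \<times> (sym \<times> move) list" where
  "instr_step N (IInc i) q as = (Suc q, (keep as)[i + 3 := (as ! (i + 3), MoveR)])"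
| "instr_step N (IDec i) q as =
    (Suc q, (keep as)[i + 3 := (as ! (i + 3), if as ! (i + 3) = Aux 0 then Stay else MoveL)])"
| "instr_step N (IWrite j a) q as = (Suc q, (keep as)[of_bool j := (sym_of a, Stay)])"
| "instr_step N (IMove j m) q as = (Suc q, (keep as)[of_bool j := (as ! of_bool j, m)])"
| "instr_step N IAsk q as = (N + 2, (keep as)[2 := (Aux (Suc q), Stay)])"
| "instr_step N (IJumpUnless b l) q as = (if test b as then Suc q else min l N, keep as)"
| "instr_step N (IJump l) q as = (min l N, keep as)"

text \<open>The cap \<open>min l N\<close>, here and for jumps, and the default \<open>N\<close>
  keep the next state in the state set for arbitrary scanned symbols, as \<open>is_oracle_tm\<close>
  demands. \<open>N\<close> is the halting state.\<close>

fun return_address :: "nat \<Rightarrow> sym \<Rightarrow> nat" where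
  "return_address N (Aux l) = min l N"
| "return_address N _ = N"

text \<open>States below \<open>N\<close> are program addresses, and \<open>N\<close>, the address
  after the last instruction, is the halting state, so running off the end halts. The start state
  \<open>N + 1\<close> marks cell \<open>0\<close> of all register tapes. Leaving the yes-state
  \<open>N + 3\<close> raises register \<open>0\<close>, which lives on tape
  \<open>3\<close>.\<close>

definition machine :: "nat \<Rightarrow> instr list \<Rightarrow> oracle_tm" where
  "machine K P = (let N = length P in
    \<lparr>num_tapes = K + 3, states = {..N + 4},
     alphabet = {Blank, Bit False, Bit True} \<union> Aux ` {..N},
     start_state = N + 1, halt_state = N, query_state = N + 2, yes_state = N + 3, no_state = N + 4,
     trans_fun = (\<lambda>q as.
       if q = N + 1 then (0, keep (take 3 as) @ map (\<lambda>_. (Aux 0, Stay)) (drop 3 as))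
       else if q = N + 3 then (return_address N (as ! 2), (keep as)[3 := (as ! 3, MoveR)])
       else if q = N + 4 then (return_address N (as ! 2), keep as)
       else if q < N then instr_step N (P ! q) q as
       else (N, keep as))\<rparr>)"

text \<open>The machine is shown well formed for arbitrary \<open>K\<close> and \<open>P\<close>, so
  an instruction may name a tape that does not exist; the update is then void.\<close>

lemma fst_keep_update: "fst ` set ((keep as)[i := (as ! i, m)]) \<subseteq> set as"
proof (cases "i < length as")
  case True
  then show ?thesis using set_update_subset_insert[of "keep as" i "(as ! i, m)"] by auto
qed (auto simp: list_update_beyond)

lemma fst_keep_update': "fst ` set ((keep as)[i := (a, m)]) \<subseteq> insert a (set as)"
  using set_update_subset_insert[of "keep as" i "(a, m)"] by auto

lemma is_oracle_tm_machine: "is_oracle_tm (machine K P)"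
proof -
  define N where "N = length P"
  let ?S = "{Blank, Bit False, Bit True} \<union> Aux ` {..N}"
  have ret: "return_address N a \<le> N + 4" for a by (cases a) auto
  have sym_of: "sym_of a \<in> ?S" for a
  proof (cases a)
    case (Some b)
    then show ?thesis by (cases b) auto
  qed simp
  have instr: "fst (instr_step N I q as) \<le> N + 4 \<and> length (snd (instr_step N I q as)) = length as \<and>
      fst ` set (snd (instr_step N I q as)) \<subseteq> ?S"
    if "set as \<subseteq> ?S" "q < N" for I q as
  proof (cases I)
    case (IWrite j a)
    have "fst ` set (snd (instr_step N I q as)) \<subseteq> ?S"
      unfolding IWrite instr_step.simps snd_conv
      by (rule order_trans[OF fst_keep_update']) (use sym_of[of a] that(1) in simp)
    then show ?thesis using IWrite that(2) by simp
  next
    case IAsk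
    have "Aux (Suc q) \<in> ?S" using that(2) by auto
    then show ?thesis
      using IAsk that fst_keep_update'[of as 2 "Aux (Suc q)" Stay] by auto
  next
    case (IInc i)
    then show ?thesis using that fst_keep_update[of as "i + 3" MoveR] by auto
  next
    case (IDec i)
    then show ?thesis
      using that fst_keep_update[of as "i + 3" "if as ! (i + 3) = Aux 0 then Stay else MoveL"] by auto
  next
    case (IMove j m)
    then show ?thesis using that fst_keep_update[of as "of_bool j" m] by auto
  qed (use that in auto)
  have "case trans_fun (machine K P) q as of (q', acts) \<Rightarrow>
        q' \<le> N + 4 \<and> length acts = length as \<and> fst ` set acts \<subseteq> ?S"
    if as: "set as \<subseteq> ?S" "length as = K + 3" and q: "q \<le> N + 4" for q as
  proof -
    consider "q = N + 1" | "q = N + 3" | "q = N + 4" | "q < N" | "q = N \<or> q = N + 2"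
      using q by linarith
    then show ?thesis
    proof cases
      case 1
      have "set (take 3 as) \<subseteq> ?S" using as(1) set_take_subset by fast
      then show ?thesis using 1 as by (auto simp: machine_def Let_def N_def[symmetric])
    next
      case 2
      then show ?thesis
        using as fst_keep_update[of as 3 MoveR] ret
        by (auto simp: machine_def Let_def N_def[symmetric])
    next
      case 3
      then show ?thesis using as ret by (auto simp: machine_def Let_def N_def[symmetric])
    next
      case 4
      then show ?thesis
        using instr[OF as(1), of q "P ! q"]
        by (simp add: machine_def Let_def N_def[symmetric] case_prod_beta)
    next
      case 5
      then show ?thesis using as by (auto simp: machine_def Let_def N_def[symmetric])
    qed
  qed
  then show ?thesis
    unfolding is_oracle_tm_def by (auto simp: machine_def Let_def N_def[symmetric])
qed

section \<open>Simulation of programs by the machine\<close>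

definition reg_tape :: "nat \<Rightarrow> tape" where
  "reg_tape v = ((\<lambda>z. if z = 0 then Aux 0 else Blank), int v)"

fun encode :: "nat \<Rightarrow> store \<Rightarrow> tape \<Rightarrow> tape list" where
  "encode K (T, \<sigma>) u = T False # T True # u # map (\<lambda>i. reg_tape (\<sigma> i)) [0..<K]"

abbreviation scan :: "tape \<Rightarrow> sym" where
  "scan \<equiv> (\<lambda>(t, h). t h)"

lemma act_scan: "act (scan t, m) t = shift_head m t"
  by (cases t) (simp add: act_def shift_head_def)

lemma shift_head_Stay [simp]: "shift_head Stay t = t"
  by (simp add: shift_head_def)

lemma map2_act_keep: "map2 act (keep (map scan ts)) ts = ts"
  by (rule nth_equalityI) (auto simp: act_scan)

lemma map2_act_keep_update:
  "map2 act ((keep (map scan ts))[i := x]) ts = ts[i := act x (ts ! i)]"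
  by (cases "i < length ts"; rule nth_equalityI)
    (auto simp: act_scan nth_list_update list_update_beyond)

lemma length_encode: "length (encode K s u) = K + 3"
  by (cases s) auto

lemma encode_nth:
  "encode K (T, \<sigma>) u ! of_bool j = T j"
  "encode K (T, \<sigma>) u ! 2 = u"
  "i < K \<Longrightarrow> encode K (T, \<sigma>) u ! (i + 3) = reg_tape (\<sigma> i)"
  by (auto simp: numeral_3_eq_3 split: bool.splits)

lemma encode_update:
  "(encode K (T, \<sigma>) u)[of_bool j := t] = encode K (T(j := t), \<sigma>) u"
  "(encode K (T, \<sigma>) u)[2 := u'] = encode K (T, \<sigma>) u'"
  "i < K \<Longrightarrow> (encode K (T, \<sigma>) u)[i + 3 := reg_tape v] = encode K (T, \<sigma>(i := v)) u"
proof -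
  show "(encode K (T, \<sigma>) u)[of_bool j := t] = encode K (T(j := t), \<sigma>) u"
    by (cases j) auto
  show "(encode K (T, \<sigma>) u)[i + 3 := reg_tape v] = encode K (T, \<sigma>(i := v)) u" if "i < K"
    using that by (auto simp: numeral_3_eq_3 nth_list_update intro!: nth_equalityI)
qed (simp add: numeral_2_eq_2)

lemma reg_tape_simps:
  "scan (reg_tape v) = Aux 0 \<longleftrightarrow> v = 0"
  "shift_head MoveR (reg_tape v) = reg_tape (Suc v)"
  "0 < v \<Longrightarrow> shift_head MoveL (reg_tape v) = reg_tape (v - 1)"
  by (auto simp: reg_tape_def shift_head_def)

definition reaches :: "oracle_tm \<Rightarrow> bstring set \<Rightarrow> tm_config \<Rightarrow> tm_config \<Rightarrow> bool" where
  "reaches M A x y \<longleftrightarrow> (\<exists>k. (step M A ^^ k) x = y)"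

lemma reaches_refl: "reaches M A x x"
  unfolding reaches_def by (rule exI[of _ 0]) simp

lemma reaches_step: "step M A x = y \<Longrightarrow> reaches M A x y"
  unfolding reaches_def by (rule exI[of _ 1]) simp

lemma reaches_trans: "reaches M A x y \<Longrightarrow> reaches M A y z \<Longrightarrow> reaches M A x z"
  unfolding reaches_def by (metis funpow_add comp_apply)

lemma machine_step:
  assumes "q < length P"
  shows "step (machine K P) A (q, ts) =
    (case instr_step (length P) (P ! q) q (map scan ts) of (q', acts) \<Rightarrow> (q', map2 act acts ts))"
  using assms by (simp add: step_def machine_def Let_def)

lemma test_encode:
  assumes "cond_regs b \<subseteq> {..<K}"
  shows "test b (map scan (encode K s u)) \<longleftrightarrow> holds b s"
proof (cases s; cases b)
  fix T \<sigma> i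
  assume "s = (T, \<sigma>)" "b = NonZero i"
  then show ?thesis
    using assms encode_nth(3)[of i K T \<sigma> u] length_encode[of K s u] reg_tape_simps(1)[of "\<sigma> i"]
    by (simp del: encode.simps)
qed (auto simp: case_prod_beta)

text \<open>The arbitrary context \<open>pre\<close>, \<open>post\<close> lets the code of a
  subprogram sit anywhere in \<open>P\<close>, so the induction hypotheses apply to it with a longer
  \<open>pre\<close>. Tape \<open>2\<close> ends as some \<open>u'\<close>, because queries leave
  their return addresses there.\<close>

lemma exec_machine:
  assumes "exec A c s s'" "regs c \<subseteq> {..<K}" "P = pre @ compile c (length pre) @ post"
  shows "\<exists>u'. reaches (machine K P) A (length pre, encode K s u) (length pre + csize c, encode K s' u')"
  using assms
proof (induction arbitrary: pre post u rule: exec.induct)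
  case (exec_Skip s)
  have "reaches (machine K P) A (length pre, encode K s u) (length pre + csize Skip, encode K s u)"
    by (simp add: reaches_refl)
  then show ?case by blast
next
  case (exec_Inc i T \<sigma>)
  have "step (machine K P) A (length pre, encode K (T, \<sigma>) u) =
      (Suc (length pre), encode K (T, \<sigma>(i := Suc (\<sigma> i))) u)"
    using exec_Inc
    by (subst machine_step)
      (simp_all del: encode.simps add: map2_act_keep_update[unfolded map_map] length_encode
        encode_nth act_scan reg_tape_simps encode_update)
  then show ?case by (intro exI[of _ u] reaches_step) (simp del: encode.simps)
next
  case (exec_Dec i T \<sigma>)
  have "step (machine K P) A (length pre, encode K (T, \<sigma>) u) =
      (Suc (length pre), encode K (T, \<sigma>(i := \<sigma> i - 1)) u)"
    using exec_Dec
    by (subst machine_step)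
      (auto simp del: encode.simps simp add: map2_act_keep_update[unfolded map_map] length_encode encode_nth act_scan
        reg_tape_simps encode_update simp flip: One_nat_def)
  then show ?case by (intro exI[of _ u] reaches_step) (simp del: encode.simps)
next
  case (exec_Write j a T \<sigma>)
  have "step (machine K P) A (length pre, encode K (T, \<sigma>) u) =
      (Suc (length pre), encode K (T(j := act (sym_of a, Stay) (T j)), \<sigma>) u)"
    using exec_Write
    by (subst machine_step)
      (simp_all del: encode.simps add: map2_act_keep_update[unfolded map_map] length_encode encode_nth encode_update)
  then show ?case by (intro exI[of _ u] reaches_step) (simp del: encode.simps)
next
  case (exec_Move j m T \<sigma>)
  have "step (machine K P) A (length pre, encode K (T, \<sigma>) u) =
      (Suc (length pre), encode K (T(j := shift_head m (T j)), \<sigma>) u)"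
    using exec_Move
    by (subst machine_step)
      (simp_all del: encode.simps add: map2_act_keep_update[unfolded map_map] length_encode encode_nth encode_update
        act_scan)
  then show ?case by (intro exI[of _ u] reaches_step) (simp del: encode.simps)
next
  case (exec_Ask T \<sigma>)
  define N where "N = length P"
  define h where "h = snd u"
  \<comment> \<open>A query takes three steps: the return address is stored, which turns tape
    \<open>2\<close> into \<open>u'\<close>; the oracle answers; control returns and a positive
    answer raises register \<open>0\<close>.\<close>
  define u' where "u' = ((fst u)(h := Aux (Suc (length pre))), h)"
  have lt: "length pre < N" "P ! length pre = IAsk" "0 < K"
    using exec_Ask by (auto simp: N_def)
  have sc: "scan u' = Aux (Suc (length pre))" by (simp add: u'_def)
  have act_u: "act (Aux (Suc (length pre)), Stay) u = u'"
    by (cases u) (simp add: act_def u'_def h_def)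
  have 1: "step (machine K P) A (length pre, encode K (T, \<sigma>) u) = (N + 2, encode K (T, \<sigma>) u')"
    using lt by (subst machine_step)
      (simp_all del: encode.simps add: map2_act_keep_update[unfolded map_map] length_encode encode_nth encode_update
        N_def act_u)
  let ?ans = "\<exists>w\<in>A. tape_word (T True) w"
  have 2: "step (machine K P) A (N + 2, encode K (T, \<sigma>) u') =
      (if ?ans then N + 3 else N + 4, encode K (T, \<sigma>) u')"
    by (simp add: step_def machine_def Let_def N_def)
  have 3: "step (machine K P) A (if ?ans then N + 3 else N + 4, encode K (T, \<sigma>) u') =
      (Suc (length pre), encode K (T, \<sigma>(0 := \<sigma> 0 + of_bool ?ans)) u')"
  proof (cases ?ans)
    case True
    have "step (machine K P) A (N + 3, encode K (T, \<sigma>) u') =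
      (Suc (length pre), (encode K (T, \<sigma>) u')[3 := act (scan (encode K (T, \<sigma>) u' ! 3), MoveR) (encode K (T, \<sigma>) u' ! 3)])"
      using lt sc
      by (simp add: step_def machine_def Let_def N_def[symmetric] map2_act_keep_update[unfolded map_map]
        length_encode encode_nth(2) del: encode.simps)
    then show ?thesis
      using True encode_nth(3)[of 0 K T \<sigma> u'] encode_update(3)[of 0 K T \<sigma> u'] lt(3)
      by (simp add: act_scan reg_tape_simps del: encode.simps)
  next
    case False
    then show ?thesis
      using lt sc
      by (simp add: step_def machine_def Let_def N_def[symmetric] map2_act_keep[unfolded map_map]
        length_encode encode_nth(2) del: encode.simps)
  qed
  have "reaches (machine K P) A (length pre, encode K (T, \<sigma>) u)
      (Suc (length pre), encode K (T, \<sigma>(0 := \<sigma> 0 + of_bool ?ans)) u')"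
    by (rule reaches_trans[OF reaches_step[OF 1] reaches_trans[OF reaches_step[OF 2] reaches_step[OF 3]]])
  then show ?case by (intro exI[of _ u']) (simp del: encode.simps)
next
  case (exec_Seq c s s' d s'')
  obtain u1 where 1: "reaches (machine K P) A (length pre, encode K s u)
      (length pre + csize c, encode K s' u1)"
    using exec_Seq.IH(1)[of pre "compile d (length pre + csize c) @ post" u] exec_Seq.prems by auto
  obtain u2 where 2: "reaches (machine K P) A (length pre + csize c, encode K s' u1)
      (length pre + csize c + csize d, encode K s'' u2)"
    using exec_Seq.IH(2)[of "pre @ compile c (length pre)" post u1] exec_Seq.prems by auto
  show ?case using reaches_trans[OF 1 2] by (intro exI[of _ u2]) (simp add: add.assoc)
next
  case (exec_BranchT b s c s' d)
  let ?l = "length pre"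
  let ?pre = "pre @ [IJumpUnless b (?l + csize c + 2)]"
  let ?post = "compile d (?l + csize c + 2) @ post"
  have "step (machine K P) A (?l, encode K s u) = (Suc ?l, encode K s u)"
    using exec_BranchT.prems exec_BranchT.hyps
    by (subst machine_step) (auto simp: test_encode map2_act_keep map2_act_keep[unfolded map_map] simp del: encode.simps)
  moreover obtain u1 where "reaches (machine K P) A (Suc ?l, encode K s u)
      (Suc ?l + csize c, encode K s' u1)"
    using exec_BranchT.IH[of ?pre "IJump (?l + csize c + csize d + 2) # ?post" u] exec_BranchT.prems
    by auto
  moreover have "step (machine K P) A (Suc ?l + csize c, encode K s' u1) =
      (?l + (csize c + csize d + 2), encode K s' u1)"
  proof -
    have "P = (?pre @ compile c (Suc ?l)) @ IJump (?l + csize c + csize d + 2) # ?post"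
      using exec_BranchT.prems by simp
    then have "P ! (Suc ?l + csize c) = IJump (?l + csize c + csize d + 2)"
      by (metis (no_types, lifting) length_append length_compile length_append_singleton nth_append_length)
    then show ?thesis using exec_BranchT.prems
      by (subst machine_step) (auto simp: map2_act_keep[unfolded map_map] simp del: encode.simps)
  qed
  ultimately show ?case
    unfolding csize.simps by (blast intro: reaches_trans reaches_step)
next
  case (exec_BranchF b s d s' c)
  let ?l = "length pre"
  let ?pre = "pre @ IJumpUnless b (?l + csize c + 2) # compile c (Suc ?l) @
      [IJump (?l + csize c + csize d + 2)]"
  have "step (machine K P) A (?l, encode K s u) = (?l + csize c + 2, encode K s u)"
    using exec_BranchF.prems exec_BranchF.hyps
    by (subst machine_step) (auto simp: test_encode map2_act_keep map2_act_keep[unfolded map_map] simp del: encode.simps)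
  moreover obtain u1 where "reaches (machine K P) A (?l + csize c + 2, encode K s u)
      (?l + csize c + 2 + csize d, encode K s' u1)"
    using exec_BranchF.IH[of ?pre post u] exec_BranchF.prems by auto
  moreover have "?l + csize c + 2 + csize d = ?l + csize (Branch b c d)" by simp
  ultimately show ?case
    by (metis reaches_trans reaches_step)
next
  case (exec_LoopT b s c s' s'')
  let ?l = "length pre"
  let ?pre = "pre @ [IJumpUnless b (?l + csize c + 2)]"
  have "step (machine K P) A (?l, encode K s u) = (Suc ?l, encode K s u)"
    using exec_LoopT.prems exec_LoopT.hyps
    by (subst machine_step) (auto simp: test_encode map2_act_keep map2_act_keep[unfolded map_map] simp del: encode.simps)
  moreover obtain u1 where "reaches (machine K P) A (Suc ?l, encode K s u)
      (Suc ?l + csize c, encode K s' u1)"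
    using exec_LoopT.IH(1)[of ?pre "IJump ?l # post" u] exec_LoopT.prems by auto
  moreover have "step (machine K P) A (Suc ?l + csize c, encode K s' u1) = (?l, encode K s' u1)"
  proof -
    have "P = (?pre @ compile c (Suc ?l)) @ IJump ?l # post"
      using exec_LoopT.prems by simp
    then have "P ! (Suc ?l + csize c) = IJump ?l"
      by (metis (no_types, lifting) length_append length_compile length_append_singleton nth_append_length)
    then show ?thesis using exec_LoopT.prems
      by (subst machine_step) (auto simp: map2_act_keep[unfolded map_map] simp del: encode.simps)
  qed
  moreover obtain u2 where "reaches (machine K P) A (?l, encode K s' u1)
      (?l + csize (Loop b c), encode K s'' u2)"
    using exec_LoopT.IH(2)[of pre post u1] exec_LoopT.prems by blast
  ultimately show ?case
    by (blast intro: reaches_trans reaches_step)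
next
  case (exec_LoopF b s c)
  have "step (machine K P) A (length pre, encode K s u) = (length pre + csize (Loop b c), encode K s u)"
    using exec_LoopF.prems exec_LoopF.hyps
    by (subst machine_step) (auto simp: test_encode map2_act_keep map2_act_keep[unfolded map_map] simp del: encode.simps)
  then show ?case by (blast intro: reaches_step)
qed

lemma com_machine:
  obtains M where "is_oracle_tm M"
    "\<And>A w T \<sigma> y. exec A c (\<lambda>j. if j then empty_tape else input_tape w, \<lambda>_. 0) (T, \<sigma>) \<Longrightarrow>
      tape_word (T False) y \<Longrightarrow> tm_outputs M A w y"
proof -
  obtain K where K: "regs c \<subseteq> {..<K}"
    using finite_regs finite_nat_set_iff_bounded by (metis lessThan_iff subsetI)
  let ?P = "compile c 0"
  let ?M = "machine K ?P"
  have "tm_outputs ?M A w y"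
    if ex: "exec A c (\<lambda>j. if j then empty_tape else input_tape w, \<lambda>_. 0) (T, \<sigma>)"
      and y: "tape_word (T False) y" for A w T \<sigma> y
  proof -
    let ?s = "(\<lambda>j. if j then empty_tape else input_tape w, \<lambda>_. 0)"
    \<comment> \<open>The first step only writes the marks \<open>Aux 0\<close>, which makes the
      configuration the encoding of the store with all registers zero.\<close>
    have "step ?M A (init_config ?M w) = (0, encode K ?s empty_tape)"
    proof -
      have "init_config ?M w = (length ?P + 1, input_tape w # replicate (K + 2) empty_tape)"
        by (simp add: init_config_def machine_def Let_def)
      moreover have "act (Aux 0, Stay) empty_tape = reg_tape 0" "scan empty_tape = Blank"
        "act (Blank, Stay) empty_tape = empty_tape"
        by (auto simp: act_def empty_tape_def reg_tape_def)
      ultimately show ?thesis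
        by (simp add: step_def machine_def Let_def numeral_3_eq_3 numeral_2_eq_2 act_scan
            map_replicate_const)
    qed
    moreover obtain u where "reaches ?M A (0, encode K ?s empty_tape) (csize c, encode K (T, \<sigma>) u)"
      using exec_machine[OF ex K, of ?P "[]" "[]" empty_tape] by auto
    ultimately have "reaches ?M A (init_config ?M w) (csize c, encode K (T, \<sigma>) u)"
      by (blast intro: reaches_trans reaches_step)
    then obtain k where "(step ?M A ^^ k) (init_config ?M w) = (halt_state ?M, encode K (T, \<sigma>) u)"
      by (auto simp: reaches_def machine_def Let_def)
    moreover have "tape_word (encode K (T, \<sigma>) u ! 0) y" using y by simp
    ultimately show ?thesis unfolding tm_outputs_def by blast
  qed
  then show ?thesis using that is_oracle_tm_machine by blast
qed

section \<open>Register programs for recursive functions\<close>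

text \<open>The number \<open>n\<close> of rounds is known beforehand and the invariant carries the
  round number, so termination comes with the invariant.\<close>

lemma exec_loop:
  assumes "\<And>k s. k < n \<Longrightarrow> I k s \<Longrightarrow> holds b s \<and> (\<exists>s'. exec A c s s' \<and> I (Suc k) s')"
    and "\<And>s. I n s \<Longrightarrow> \<not> holds b s" and "I 0 s"
  shows "\<exists>s'. exec A (Loop b c) s s' \<and> I n s'"
proof -
  have "\<exists>s'. exec A (Loop b c) s s' \<and> I n s'" if "k \<le> n" "I k s" for k s
    using that
  proof (induction "n - k" arbitrary: k s)
    case 0
    then have "k = n" by simp
    then show ?case using 0 assms(2) exec_LoopF by blast
  next
    case (Suc m)
    then have k: "k < n" by simp
    then obtain s' where s': "holds b s" "exec A c s s'" "I (Suc k) s'"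
      using assms(1) Suc.prems by blast
    have "m = n - Suc k" using Suc.hyps(2) by simp
    then obtain s'' where "exec A (Loop b c) s' s''" "I n s''"
      using Suc.hyps(1)[OF _ _ s'(3)] k by auto
    then show ?case using s' exec_LoopT by blast
  qed
  from this[of 0 s] show ?thesis using assms(3) by simp
qed

lemma exec_Seq_list:
  assumes "\<And>j s. j < length cs \<Longrightarrow> I j s \<Longrightarrow> \<exists>s'. exec A (cs ! j) s s' \<and> I (Suc j) s'" and "I 0 s"
  shows "\<exists>s'. exec A (foldr (;;) cs Skip) s s' \<and> I (length cs) s'"
  using assms
proof (induction cs arbitrary: I s)
  case Nil
  then show ?case by (intro exI[of _ s]) (simp add: exec_Skip)
next
  case (Cons c cs)
  obtain s' where s': "exec A c s s'" "I (Suc 0) s'" using Cons.prems(1)[of 0 s] Cons.prems(2) by auto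
  have "\<exists>s''. exec A (foldr (;;) cs Skip) s' s'' \<and> I (Suc (length cs)) s''"
    by (rule Cons.IH[of "\<lambda>j. I (Suc j)"]) (use Cons.prems(1)[of "Suc _"] s' in auto)
  then show ?case using s' exec_Seq by fastforce
qed

definition clear :: "nat \<Rightarrow> com" where
  "clear i = Loop (NonZero i) (Dec i)"

definition transfer :: "nat \<Rightarrow> nat \<Rightarrow> com" where
  "transfer i j = Loop (NonZero i) (Dec i ;; Inc j)"

text \<open>Reading out a register empties it, so its value is sent to \<open>j\<close> and to a
  scratch register \<open>t\<close>, from which \<open>i\<close> is restored.\<close>

definition copy :: "nat \<Rightarrow> nat \<Rightarrow> nat \<Rightarrow> com" where
  "copy i j t = clear j ;; clear t ;; Loop (NonZero i) (Dec i ;; Inc j ;; Inc t) ;; transfer t i"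

lemma exec_clear: "exec A (clear i) (T, \<sigma>) (T, \<sigma>(i := 0))"
proof (induction "\<sigma> i" arbitrary: \<sigma>)
  case 0
  then have "\<sigma>(i := 0) = \<sigma>" by auto
  then show ?case using 0 exec_LoopF[of "NonZero i" "(T, \<sigma>)" A] by (simp add: clear_def)
next
  case (Suc n)
  then have "exec A (clear i) (T, \<sigma>(i := \<sigma> i - 1)) (T, (\<sigma>(i := \<sigma> i - 1))(i := 0))"
    by (metis diff_Suc_1 fun_upd_same)
  then show ?case
    using exec_LoopT[OF _ exec_Dec] Suc.hyps(2) unfolding clear_def
    by (metis fun_upd_upd holds.simps(1) nat.distinct(1))
qed

lemma exec_transfer:
  assumes "i \<noteq> j"
  shows "exec A (transfer i j) (T, \<sigma>) (T, \<sigma>(j := \<sigma> j + \<sigma> i, i := 0))"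
proof (induction "\<sigma> i" arbitrary: \<sigma>)
  case 0
  then have "\<sigma>(j := \<sigma> j + \<sigma> i, i := 0) = \<sigma>" by auto
  then show ?case using 0 exec_LoopF[of "NonZero i" "(T, \<sigma>)" A] by (simp add: transfer_def)
next
  case (Suc n)
  let ?\<tau> = "\<sigma>(i := \<sigma> i - 1, j := Suc (\<sigma> j))"
  have "exec A (transfer i j) (T, ?\<tau>) (T, ?\<tau>(j := ?\<tau> j + ?\<tau> i, i := 0))"
    by (rule Suc.hyps(1)) (use Suc.hyps(2) assms in auto)
  also have "?\<tau>(j := ?\<tau> j + ?\<tau> i, i := 0) = \<sigma>(j := \<sigma> j + \<sigma> i, i := 0)"
    using Suc.hyps(2) assms by auto
  finally have 1: "exec A (transfer i j) (T, ?\<tau>) (T, \<sigma>(j := \<sigma> j + \<sigma> i, i := 0))" .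
  have "exec A (Dec i ;; Inc j) (T, \<sigma>)
      (T, \<sigma>(i := \<sigma> i - 1, j := Suc ((\<sigma>(i := \<sigma> i - 1)) j)))"
    by (rule exec_Seq[OF exec_Dec exec_Inc])
  then have "exec A (Dec i ;; Inc j) (T, \<sigma>) (T, ?\<tau>)" using assms by simp
  from exec_LoopT[OF _ this 1[unfolded transfer_def]] show ?case
    using Suc.hyps(2) by (simp add: transfer_def)
qed

lemma exec_copy:
  assumes "i \<noteq> j" "i \<noteq> t" "j \<noteq> t"
  shows "exec A (copy i j t) (T, \<sigma>) (T, \<sigma>(j := \<sigma> i, t := 0))"
proof -
  let ?L = "Loop (NonZero i) (Dec i ;; Inc j ;; Inc t)"
  have L: "exec A ?L (T, \<tau>) (T, \<tau>(j := \<tau> j + \<tau> i, t := \<tau> t + \<tau> i, i := 0))" for \<tau>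
  proof (induction "\<tau> i" arbitrary: \<tau>)
    case 0
    then have "\<tau>(j := \<tau> j + \<tau> i, t := \<tau> t + \<tau> i, i := 0) = \<tau>" by auto
    then show ?case using 0 exec_LoopF[of "NonZero i" "(T, \<tau>)" A] by simp
  next
    case (Suc n)
    let ?\<tau> = "\<tau>(i := \<tau> i - 1, j := Suc (\<tau> j), t := Suc (\<tau> t))"
    have "exec A ?L (T, ?\<tau>) (T, ?\<tau>(j := ?\<tau> j + ?\<tau> i, t := ?\<tau> t + ?\<tau> i, i := 0))"
      by (rule Suc.hyps(1)) (use Suc.hyps(2) assms in auto)
    also have "?\<tau>(j := ?\<tau> j + ?\<tau> i, t := ?\<tau> t + ?\<tau> i, i := 0) =
        \<tau>(j := \<tau> j + \<tau> i, t := \<tau> t + \<tau> i, i := 0)"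
      using Suc.hyps(2) assms by auto
    finally have 1: "exec A ?L (T, ?\<tau>) (T, \<tau>(j := \<tau> j + \<tau> i, t := \<tau> t + \<tau> i, i := 0))" .
    let ?\<tau>' = "\<tau>(i := \<tau> i - 1, j := Suc ((\<tau>(i := \<tau> i - 1)) j))"
    have "exec A (Dec i ;; Inc j ;; Inc t) (T, \<tau>) (T, ?\<tau>'(t := Suc (?\<tau>' t)))"
      by (rule exec_Seq[OF exec_Dec exec_Seq[OF exec_Inc exec_Inc]])
    then have "exec A (Dec i ;; Inc j ;; Inc t) (T, \<tau>) (T, ?\<tau>)" using assms by simp
    from exec_LoopT[OF _ this 1] show ?case using Suc.hyps(2) by simp
  qed
  let ?\<sigma> = "\<sigma>(j := 0, t := 0)"
  have "exec A (copy i j t) (T, \<sigma>) (T, (?\<sigma>(j := ?\<sigma> j + ?\<sigma> i, t := ?\<sigma> t + ?\<sigma> i, i := 0))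
      (i := \<sigma> i, t := 0))"
    unfolding copy_def
    by (rule exec_Seq[OF exec_clear exec_Seq[OF exec_clear exec_Seq[OF L]]])
      (use exec_transfer[of t i A T "?\<sigma>(j := ?\<sigma> j + ?\<sigma> i, t := ?\<sigma> t + ?\<sigma> i, i := 0)"] assms in simp)
  also have "(?\<sigma>(j := ?\<sigma> j + ?\<sigma> i, t := ?\<sigma> t + ?\<sigma> i, i := 0))(i := \<sigma> i, t := 0) =
      \<sigma>(j := \<sigma> i, t := 0)"
    using assms by auto
  finally show ?thesis .
qed

text \<open>Registers from \<open>b\<close> on are scratch: their contents are arbitrary before and
  after. The program is constrained only where \<open>r\<close> has a value, which suffices since it
  is run only on such arguments.\<close>

definition computes :: "com \<Rightarrow> recf \<Rightarrow> nat list \<Rightarrow> nat \<Rightarrow> nat \<Rightarrow> bool" where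
  "computes c r ins out b \<longleftrightarrow> (\<forall>A T \<sigma> y. rec_eval r (map \<sigma> ins) y \<longrightarrow>
    (\<exists>\<sigma>'. exec A c (T, \<sigma>) (T, \<sigma>') \<and> \<sigma>' out = y \<and> (\<forall>j<b. j \<noteq> out \<longrightarrow> \<sigma>' j = \<sigma> j)))"

lemma computesD:
  assumes "computes c r ins out b" "rec_eval r (map \<sigma> ins) y"
  obtains \<sigma>' where "exec A c (T, \<sigma>) (T, \<sigma>')" "\<sigma>' out = y" "\<And>j. j < b \<Longrightarrow> j \<noteq> out \<Longrightarrow> \<sigma>' j = \<sigma> j"
  using assms unfolding computes_def by blast

text \<open>The sequence of intermediate values; it serves as the loop invariant for primitive
  recursion.\<close>

lemma rec_eval_Prim_values:
  "rec_eval (Prim f g) (n # xs) y \<Longrightarrow>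
    \<exists>v. rec_eval f xs (v 0) \<and> (\<forall>i<n. rec_eval g (i # v i # xs) (v (Suc i))) \<and> v n = y"
proof (induction n arbitrary: y)
  case 0
  then show ?case by (auto elim: rec_eval_Prim0E)
next
  case (Suc n)
  from Suc.prems obtain z where z: "rec_eval (Prim f g) (n # xs) z" "rec_eval g (n # z # xs) y"
    by (rule rec_eval_PrimSucE)
  obtain v where v: "rec_eval f xs (v 0)" "\<forall>i<n. rec_eval g (i # v i # xs) (v (Suc i))" "v n = z"
    using Suc.IH[OF z(1)] by blast
  show ?case
    by (rule exI[of _ "v(Suc n := y)"]) (use v z in \<open>auto simp: less_Suc_eq\<close>)
qed

text \<open>In the induction \<open>b\<close> is arbitrary: a subprogram is compiled with a larger
  \<open>b\<close>, which protects the registers of the surrounding program and gives it fresh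
  scratch registers.\<close>

lemma recf_com:
  assumes "set ins \<subseteq> {..<b}" "out < b" "out \<notin> set ins"
  shows "\<exists>c. computes c r ins out b"
  using assms
proof (induction r arbitrary: ins out b)
  case Zero
  have "computes (clear out) Zero ins out b"
    unfolding computes_def using exec_clear by (fastforce elim: rec_eval_ZeroE)
  then show ?case ..
next
  case Succ
  show ?case
  proof (cases "\<exists>i. ins = [i]")
    case True
    then obtain i where i: "ins = [i]" by blast
    have "computes (copy i out b ;; Inc out) Succ ins out b"
      unfolding computes_def
    proof (intro allI impI)
      fix A and T :: "bool \<Rightarrow> tape" and \<sigma> :: "nat \<Rightarrow> nat" and y
      assume "rec_eval Succ (map \<sigma> ins) y"
      then have y: "y = Suc (\<sigma> i)" using i by (auto elim: rec_eval_SuccE)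
      have "exec A (copy i out b ;; Inc out) (T, \<sigma>) (T, (\<sigma>(out := \<sigma> i, b := 0))(out := Suc ((\<sigma>(out := \<sigma> i, b := 0)) out)))"
        by (rule exec_Seq[OF exec_copy exec_Inc]) (use Succ i in auto)
      then show "\<exists>\<sigma>'. exec A (copy i out b ;; Inc out) (T, \<sigma>) (T, \<sigma>') \<and> \<sigma>' out = y \<and>
          (\<forall>j<b. j \<noteq> out \<longrightarrow> \<sigma>' j = \<sigma> j)"
        using Succ y
        by (intro exI[of _ "(\<sigma>(out := \<sigma> i, b := 0))(out := Suc ((\<sigma>(out := \<sigma> i, b := 0)) out))"]) auto
    qed
    then show ?thesis ..
  next
    case False
    \<comment> \<open>There is no value on such arguments, so every program meets the
      specification.\<close>
    have "\<not> rec_eval Succ (map \<sigma> ins) y" for \<sigma> y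
      using False by (auto elim!: rec_eval_SuccE)
    then show ?thesis by (auto simp: computes_def)
  qed
next
  case (Proj i)
  show ?case
  proof (cases "i < length ins")
    case True
    have d: "ins ! i \<noteq> out" "ins ! i \<noteq> b" "out \<noteq> b"
      using Proj nth_mem[OF True] by auto
    have "computes (copy (ins ! i) out b) (Proj i) ins out b"
      unfolding computes_def
    proof (intro allI impI)
      fix A and T :: "bool \<Rightarrow> tape" and \<sigma> :: "nat \<Rightarrow> nat" and y
      assume "rec_eval (Proj i) (map \<sigma> ins) y"
      then have y: "y = \<sigma> (ins ! i)" using True by (auto elim: rec_eval_ProjE)
      show "\<exists>\<sigma>'. exec A (copy (ins ! i) out b) (T, \<sigma>) (T, \<sigma>') \<and> \<sigma>' out = y \<and>
          (\<forall>j<b. j \<noteq> out \<longrightarrow> \<sigma>' j = \<sigma> j)"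
        using exec_copy[OF d] y d(3)
        by (intro exI[of _ "\<sigma>(out := \<sigma> (ins ! i), b := 0)"]) auto
    qed
    then show ?thesis ..
  next
    case False
    have "\<not> rec_eval (Proj i) (map \<sigma> ins) y" for \<sigma> y
      using False by (auto elim!: rec_eval_ProjE)
    then show ?thesis by (auto simp: computes_def)
  qed
next
  case (Comp f gs)
  define n where "n = length gs"
  \<comment> \<open>The result of the \<open>j\<close>-th argument goes to register
    \<open>b + j\<close>. With bound \<open>b + n\<close> the later argument programs leave it
    alone.\<close>
  have "\<exists>c. computes c (gs ! j) ins (b + j) (b + n)" if "j < n" for j
    by (rule Comp.IH(2)) (use that Comp.prems in \<open>auto simp: n_def\<close>)
  then obtain C where C: "\<And>j. j < n \<Longrightarrow> computes (C j) (gs ! j) ins (b + j) (b + n)" by metis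
  have "set [b..<b + n] \<subseteq> {..<b + n}" by auto
  then obtain c where c: "computes c f [b..<b + n] out (b + n)"
    using Comp.IH(1)[of "[b..<b + n]" "b + n" out] Comp.prems by auto
  let ?cs = "map C [0..<n]"
  have "computes (foldr (;;) ?cs Skip ;; c) (Comp f gs) ins out b"
    unfolding computes_def
  proof (intro allI impI)
    fix A and T :: "bool \<Rightarrow> tape" and \<sigma> :: "nat \<Rightarrow> nat" and y
    assume "rec_eval (Comp f gs) (map \<sigma> ins) y"
    then obtain ys where ys: "length ys = n"
        "\<And>i. i < n \<Longrightarrow> rec_eval (gs ! i) (map \<sigma> ins) (ys ! i)" "rec_eval f ys y"
      unfolding n_def by (auto elim: rec_eval_CompE)
    let ?I = "\<lambda>j (T', \<tau>). T' = T \<and> (\<forall>i<b. \<tau> i = \<sigma> i) \<and> (\<forall>i<j. \<tau> (b + i) = ys ! i)"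
    have "\<exists>s'. exec A (foldr (;;) ?cs Skip) (T, \<sigma>) s' \<and> ?I (length ?cs) s'"
    proof (rule exec_Seq_list)
      fix j s
      assume j: "j < length ?cs" and "?I j s"
      then obtain \<tau> where s: "s = (T, \<tau>)" and I: "\<forall>i<b. \<tau> i = \<sigma> i" "\<forall>i<j. \<tau> (b + i) = ys ! i"
        by (cases s) auto
      have "map \<tau> ins = map \<sigma> ins" using I(1) Comp.prems(1) by auto
      then have "rec_eval (gs ! j) (map \<tau> ins) (ys ! j)" using ys(2)[of j] j by (simp del: map_eq_conv)
      then obtain \<tau>' where "exec A (C j) (T, \<tau>) (T, \<tau>')" "\<tau>' (b + j) = ys ! j"
          "\<And>i. i < b + n \<Longrightarrow> i \<noteq> b + j \<Longrightarrow> \<tau>' i = \<tau> i"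
        using computesD[OF C[of j]] j by (metis diff_zero length_map length_upt)
      then show "\<exists>s'. exec A (?cs ! j) s s' \<and> ?I (Suc j) s'"
        using s I j by (intro exI[of _ "(T, \<tau>')"]) (auto simp: less_Suc_eq)
    qed auto
    then obtain \<tau> where \<tau>: "exec A (foldr (;;) ?cs Skip) (T, \<sigma>) (T, \<tau>)"
        "\<forall>i<b. \<tau> i = \<sigma> i" "\<forall>i<n. \<tau> (b + i) = ys ! i" by auto
    have "map \<tau> [b..<b + n] = ys"
      using \<tau>(3) ys(1) by (intro nth_equalityI) auto
    then obtain \<tau>' where \<tau>': "exec A c (T, \<tau>) (T, \<tau>')" "\<tau>' out = y"
        "\<And>j. j < b + n \<Longrightarrow> j \<noteq> out \<Longrightarrow> \<tau>' j = \<tau> j"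
      using computesD[OF c] ys(3) by metis
    show "\<exists>\<sigma>'. exec A (foldr (;;) ?cs Skip ;; c) (T, \<sigma>) (T, \<sigma>') \<and> \<sigma>' out = y \<and>
        (\<forall>j<b. j \<noteq> out \<longrightarrow> \<sigma>' j = \<sigma> j)"
      using exec_Seq[OF \<tau>(1) \<tau>'(1)] \<tau>' \<tau>(2) by auto
  qed
  then show ?case ..
next
  case (Prim f g)
  show ?case
  proof (cases ins)
    case Nil
    have "\<not> rec_eval (Prim f g) (map \<sigma> ins) y" for \<sigma> y
      using Nil by (auto elim: rec_eval.cases)
    then show ?thesis by (auto simp: computes_def)
  next
    case (Cons x ins')
    \<comment> \<open>Registers: \<open>b\<close> counts the remaining rounds, \<open>b + 1\<close>
      the completed ones, \<open>b + 2\<close> holds the current value, \<open>b + 3\<close> the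
      next value and the scratch of \<open>copy\<close>.\<close>
    obtain cf where cf: "computes cf f ins' (b + 2) (b + 4)"
      using Prim.IH(1)[of ins' "b + 4" "b + 2"] Prim.prems Cons by force
    obtain cg where cg: "computes cg g ((b + 1) # (b + 2) # ins') (b + 3) (b + 4)"
      using Prim.IH(2)[of "(b + 1) # (b + 2) # ins'" "b + 4" "b + 3"] Prim.prems Cons by force
    let ?body = "Dec b ;; cg ;; clear (b + 2) ;; transfer (b + 3) (b + 2) ;; Inc (b + 1)"
    let ?c = "copy x b (b + 3) ;; clear (b + 1) ;; cf ;; Loop (NonZero b) ?body ;;
      copy (b + 2) out (b + 3)"
    have "computes ?c (Prim f g) ins out b"
      unfolding computes_def
    proof (intro allI impI)
      fix A and T :: "bool \<Rightarrow> tape" and \<sigma> :: "nat \<Rightarrow> nat" and y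
      assume "rec_eval (Prim f g) (map \<sigma> ins) y"
      then obtain v where v: "rec_eval f (map \<sigma> ins') (v 0)"
          "\<And>i. i < \<sigma> x \<Longrightarrow> rec_eval g (i # v i # map \<sigma> ins') (v (Suc i))" "v (\<sigma> x) = y"
        using rec_eval_Prim_values Cons by (metis list.simps(9))
      let ?\<sigma> = "\<sigma>(b := \<sigma> x, b + 3 := 0, b + 1 := 0)"
      have "map ?\<sigma> ins' = map \<sigma> ins'" using Prim.prems(1) Cons by auto
      then obtain \<tau> where \<tau>: "exec A cf (T, ?\<sigma>) (T, \<tau>)" "\<tau> (b + 2) = v 0"
          "\<And>j. j < b + 4 \<Longrightarrow> j \<noteq> b + 2 \<Longrightarrow> \<tau> j = ?\<sigma> j"
        using computesD[OF cf, of ?\<sigma>] v(1) by metis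
      let ?I = "\<lambda>k (T', \<tau>). T' = T \<and> (\<forall>i<b. \<tau> i = \<sigma> i) \<and> \<tau> b = \<sigma> x - k \<and> \<tau> (b + 1) = k \<and>
        \<tau> (b + 2) = v k"
      have "\<exists>s'. exec A (Loop (NonZero b) ?body) (T, \<tau>) s' \<and> ?I (\<sigma> x) s'"
      proof (rule exec_loop[where I = ?I])
        fix k s
        assume k: "k < \<sigma> x" and "?I k s"
        then obtain \<rho> where s: "s = (T, \<rho>)" and I: "\<forall>i<b. \<rho> i = \<sigma> i" "\<rho> b = \<sigma> x - k"
            "\<rho> (b + 1) = k" "\<rho> (b + 2) = v k"
          by (cases s) auto
        let ?\<rho> = "\<rho>(b := \<rho> b - 1)"
        have "map ?\<rho> ins' = map \<sigma> ins'" using Prim.prems(1) Cons I(1) by auto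
        then have "rec_eval g (map ?\<rho> ((b + 1) # (b + 2) # ins')) (v (Suc k))"
          using v(2)[OF k] I by (simp del: map_eq_conv)
        then obtain \<rho>' where \<rho>': "exec A cg (T, ?\<rho>) (T, \<rho>')" "\<rho>' (b + 3) = v (Suc k)"
            "\<And>j. j < b + 4 \<Longrightarrow> j \<noteq> b + 3 \<Longrightarrow> \<rho>' j = ?\<rho> j"
          using computesD[OF cg] by metis
        have "exec A ?body (T, \<rho>) (T, (\<rho>'(b + 2 := 0, b + 2 := 0 + \<rho>' (b + 3), b + 3 := 0))
            (b + 1 := Suc (\<rho>' (b + 1))))"
          using exec_Seq[OF exec_Dec exec_Seq[OF \<rho>'(1) exec_Seq[OF exec_clear
            exec_Seq[OF exec_transfer exec_Inc]]], of "b + 3" "b + 2" "b + 2" "b + 1"] by simp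
        then have "\<exists>s'. exec A ?body s s' \<and> ?I (Suc k) s'"
          unfolding s using \<rho>' I k
          by (intro exI[of _ "(T, (\<rho>'(b + 2 := 0, b + 2 := 0 + \<rho>' (b + 3), b + 3 := 0))
            (b + 1 := Suc (\<rho>' (b + 1))))"]) auto
        then show "holds (NonZero b) s \<and> (\<exists>s'. exec A ?body s s' \<and> ?I (Suc k) s')"
          using s I(2) k by simp
      qed (use \<tau> in auto)
      then obtain \<rho> where \<rho>: "exec A (Loop (NonZero b) ?body) (T, \<tau>) (T, \<rho>)"
          "\<forall>i<b. \<rho> i = \<sigma> i" "\<rho> (b + 2) = y"
        using v(3) by auto
      have "exec A ?c (T, \<sigma>) (T, \<rho>(out := \<rho> (b + 2), b + 3 := 0))"
        by (rule exec_Seq[OF exec_copy exec_Seq[OF exec_clear exec_Seq[OF \<tau>(1)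
          exec_Seq[OF \<rho>(1) exec_copy]]]]) (use Prim.prems Cons in auto)
      then show "\<exists>\<sigma>'. exec A ?c (T, \<sigma>) (T, \<sigma>') \<and> \<sigma>' out = y \<and> (\<forall>j<b. j \<noteq> out \<longrightarrow> \<sigma>' j = \<sigma> j)"
        using \<rho> Prim.prems by (intro exI[of _ "\<rho>(out := \<rho> (b + 2), b + 3 := 0)"]) auto
    qed
    then show ?thesis ..
  qed
next
  case (Mu f)
  \<comment> \<open>Registers: \<open>b\<close> holds the candidate, \<open>b + 1\<close> the value
    of \<open>f\<close> there, \<open>b + 2\<close> is the scratch of the final
    \<open>copy\<close>.\<close>
  obtain cf where cf: "computes cf f (b # ins) (b + 1) (b + 3)"
    using Mu.IH[of "b # ins" "b + 3" "b + 1"] Mu.prems by force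
  let ?body = "Inc b ;; cf"
  let ?c = "clear b ;; cf ;; Loop (NonZero (b + 1)) ?body ;; copy b out (b + 2)"
  have "computes ?c (Mu f) ins out b"
    unfolding computes_def
  proof (intro allI impI)
    fix A and T :: "bool \<Rightarrow> tape" and \<sigma> :: "nat \<Rightarrow> nat" and n
    assume "rec_eval (Mu f) (map \<sigma> ins) n"
    then have "\<forall>m<n. \<exists>y. rec_eval f (m # map \<sigma> ins) (Suc y)" and n: "rec_eval f (n # map \<sigma> ins) 0"
      by (auto elim: rec_eval_MuE)
    \<comment> \<open>Up to \<open>n\<close> the value is zero exactly at \<open>n\<close>, so the
      loop test on \<open>b + 1\<close> ends the loop after exactly \<open>n\<close> rounds.\<close>
    then have "\<forall>m\<le>n. \<exists>y. rec_eval f (m # map \<sigma> ins) y \<and> (y = 0 \<longleftrightarrow> m = n)"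
      by (metis le_neq_implies_less nat.distinct(1))
    then obtain v where v: "\<And>m. m \<le> n \<Longrightarrow> rec_eval f (m # map \<sigma> ins) (v m)"
        "\<And>m. m \<le> n \<Longrightarrow> v m = 0 \<longleftrightarrow> m = n"
      by metis
    have cf': "\<exists>\<tau>'. exec A cf (T, \<tau>) (T, \<tau>') \<and> (\<forall>i<b. \<tau>' i = \<sigma> i) \<and> \<tau>' b = \<tau> b \<and> \<tau>' (b + 1) = v (\<tau> b)"
      if "\<forall>i<b. \<tau> i = \<sigma> i" "\<tau> b \<le> n" for \<tau>
    proof -
      have "map \<tau> ins = map \<sigma> ins" using Mu.prems(1) that(1) by auto
      then have "rec_eval f (map \<tau> (b # ins)) (v (\<tau> b))" using v(1)[OF that(2)] by (simp del: map_eq_conv)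
      then obtain \<tau>' where "exec A cf (T, \<tau>) (T, \<tau>')" "\<tau>' (b + 1) = v (\<tau> b)"
          "\<And>j. j < b + 3 \<Longrightarrow> j \<noteq> b + 1 \<Longrightarrow> \<tau>' j = \<tau> j"
        using computesD[OF cf] by metis
      then show ?thesis using that by (intro exI[of _ \<tau>']) auto
    qed
    obtain \<tau> where \<tau>: "exec A cf (T, \<sigma>(b := 0)) (T, \<tau>)" "\<forall>i<b. \<tau> i = \<sigma> i" "\<tau> b = 0" "\<tau> (b + 1) = v 0"
      using cf'[of "\<sigma>(b := 0)"] by auto
    let ?I = "\<lambda>k (T', \<tau>). T' = T \<and> (\<forall>i<b. \<tau> i = \<sigma> i) \<and> \<tau> b = k \<and> \<tau> (b + 1) = v k"
    have "\<exists>s'. exec A (Loop (NonZero (b + 1)) ?body) (T, \<tau>) s' \<and> ?I n s'"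
    proof (rule exec_loop[where I = ?I])
      fix k s
      assume k: "k < n" and "?I k s"
      then obtain \<rho> where s: "s = (T, \<rho>)" and I: "\<forall>i<b. \<rho> i = \<sigma> i" "\<rho> b = k" "\<rho> (b + 1) = v k"
        by (cases s) auto
      obtain \<rho>' where "exec A cf (T, \<rho>(b := Suc (\<rho> b))) (T, \<rho>')" "\<forall>i<b. \<rho>' i = \<sigma> i"
          "\<rho>' b = Suc k" "\<rho>' (b + 1) = v (Suc k)"
        using cf'[of "\<rho>(b := Suc (\<rho> b))"] I k by auto
      then have "\<exists>s'. exec A ?body s s' \<and> ?I (Suc k) s'"
        unfolding s by (intro exI[of _ "(T, \<rho>')"]) (auto intro: exec_Seq exec_Inc)
      then show "holds (NonZero (b + 1)) s \<and> (\<exists>s'. exec A ?body s s' \<and> ?I (Suc k) s')"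
        using s I v(2)[of k] k by simp
    qed (use \<tau> v(2)[of n] in auto)
    then obtain \<rho> where \<rho>: "exec A (Loop (NonZero (b + 1)) ?body) (T, \<tau>) (T, \<rho>)"
        "\<forall>i<b. \<rho> i = \<sigma> i" "\<rho> b = n" by auto
    have "exec A ?c (T, \<sigma>) (T, \<rho>(out := \<rho> b, b + 2 := 0))"
      by (rule exec_Seq[OF exec_clear exec_Seq[OF \<tau>(1) exec_Seq[OF \<rho>(1) exec_copy]]])
        (use Mu.prems in auto)
    then show "\<exists>\<sigma>'. exec A ?c (T, \<sigma>) (T, \<sigma>') \<and> \<sigma>' out = n \<and> (\<forall>j<b. j \<noteq> out \<longrightarrow> \<sigma>' j = \<sigma> j)"
      using \<rho> Mu.prems by (intro exI[of _ "\<rho>(out := \<rho> b, b + 2 := 0)"]) auto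
  qed
  then show ?case ..
qed

lemma recfn_com:
  assumes "recfn (length ins) F" "set ins \<subseteq> {..<b}" "out < b" "out \<notin> set ins"
  obtains c where "\<And>A T \<sigma>. \<exists>\<sigma>'. exec A c (T, \<sigma>) (T, \<sigma>') \<and> \<sigma>' out = F (map \<sigma> ins) \<and>
      (\<forall>j<b. j \<noteq> out \<longrightarrow> \<sigma>' j = \<sigma> j)"
proof -
  obtain r where "\<And>xs. length xs = length ins \<Longrightarrow> rec_eval r xs (F xs)"
    using assms(1) by (auto simp: recfn_def)
  moreover obtain c where "computes c r ins out b" using recf_com assms(2-4) by blast
  ultimately show ?thesis using that[of c] unfolding computes_def by simp
qed

section \<open>Processing the oracle\<close>

lemma str_of_nat_inverse [simp]: "str_of_nat (nat_of_str s) = s"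
  unfolding str_of_nat_def by (rule inv_f_f[OF bij_is_inj[OF bij_nat_of_str]])

lemma nat_of_str_inverse [simp]: "nat_of_str (str_of_nat n) = n"
  unfolding str_of_nat_def by (rule surj_f_inv_f[OF bij_is_surj[OF bij_nat_of_str]])

text \<open>The number \<open>nat_of_str s + 1\<close> is written in base two as a \<open>1\<close>
  followed by \<open>s\<close>. Length and bits of \<open>s\<close> can be read off from
  this.\<close>

lemma nat_of_str_bounds:
  "2 ^ length s \<le> nat_of_str s + 1" "nat_of_str s + 1 < 2 ^ Suc (length s)"
  by (induction s rule: rev_induct) (auto simp: nat_of_str_Nil nat_of_str_snoc)

lemma nth_nat_of_str:
  "i < length s \<Longrightarrow> s ! i \<longleftrightarrow> odd ((nat_of_str s + 1) div 2 ^ (length s - Suc i))"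
proof (induction s rule: rev_induct)
  case (snoc b s)
  have s: "nat_of_str (s @ [b]) + 1 = 2 * (nat_of_str s + 1) + of_bool b"
    by (simp add: nat_of_str_snoc)
  show ?case
  proof (cases "i < length s")
    case True
    then have "length (s @ [b]) - Suc i = Suc (length s - Suc i)" by simp
    moreover have "(2 * (nat_of_str s + 1) + of_bool b) div 2 ^ Suc e = (nat_of_str s + 1) div 2 ^ e" for e
      by (simp add: div_mult2_eq)
    ultimately show ?thesis
      using snoc.IH[OF True] True s by (simp add: nth_append del: power_Suc)
  next
    case False
    then show ?thesis using snoc.prems s by (simp add: nth_append)
  qed
qed simp

lemma length_str_of_nat: "length (str_of_nat v) = (LEAST l. v + 1 < 2 ^ Suc l)"
proof (rule Least_equality[symmetric])
  show "v + 1 < 2 ^ Suc (length (str_of_nat v))"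
    using nat_of_str_bounds(2)[of "str_of_nat v"] by simp
  fix l
  assume "v + 1 < 2 ^ Suc l"
  then have "(2::nat) ^ length (str_of_nat v) < 2 ^ Suc l"
    using nat_of_str_bounds(1)[of "str_of_nat v"] by simp
  then show "length (str_of_nat v) \<le> l"
    by (simp add: less_Suc_eq_le del: power_Suc)
qed

lemma recfn_length_str_of_nat: "recfn 1 (\<lambda>xs. length (str_of_nat (xs ! 0)))"
  unfolding length_str_of_nat
proof (rule recfn_Least)
  show "recpr (Suc 1) (\<lambda>ys. tl ys ! 0 + 1 < 2 ^ Suc (ys ! 0))"
    by (intro recfn_intros) auto
  show "\<exists>l. xs ! 0 + 1 < 2 ^ Suc l" for xs :: "nat list"
    using nat_of_str_bounds(2)[of "str_of_nat (xs ! 0)"] by auto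
qed

definition digit :: "nat \<Rightarrow> nat \<Rightarrow> nat" where
  "digit v i = of_bool (odd ((v + 1) div 2 ^ (length (str_of_nat v) - Suc i)))"

lemma digit_iff: "i < length (str_of_nat v) \<Longrightarrow> digit v i \<noteq> 0 \<longleftrightarrow> str_of_nat v ! i"
  using nth_nat_of_str[of i "str_of_nat v"] by (simp add: digit_def)

lemma recfn_digit: "recfn 2 (\<lambda>xs. digit (xs ! 0) (xs ! 1))"
proof -
  have "recpr 2 (\<lambda>xs. odd ((xs ! 0 + 1) div 2 ^ (length (str_of_nat (xs ! 0)) - Suc (xs ! 1))))"
    by (intro recfn_intros recfn_compose1[OF recfn_length_str_of_nat]) auto
  then show ?thesis by (simp add: digit_def recpr_def)
qed

lemma write_com:
  assumes "x < b"
  obtains W where "\<And>A T \<sigma>. snd (T j) = 0 \<Longrightarrow> \<exists>T' \<sigma>'. exec A W (T, \<sigma>) (T', \<sigma>') \<and>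
      tape_word (T' j) (str_of_nat (\<sigma> x)) \<and> snd (T' j) = 0 \<and> T' (\<not> j) = T (\<not> j) \<and>
      (\<forall>i<b. \<sigma>' i = \<sigma> i)"
proof -
  obtain cl where cl: "\<And>A T \<sigma>. \<exists>\<sigma>'. exec A cl (T, \<sigma>) (T, \<sigma>') \<and>
      \<sigma>' b = length (str_of_nat (map \<sigma> [x] ! 0)) \<and> (\<forall>j<b + 5. j \<noteq> b \<longrightarrow> \<sigma>' j = \<sigma> j)"
    by (rule recfn_com[of "[x]" "\<lambda>xs. length (str_of_nat (xs ! 0))" "b + 5" b])
      (use assms recfn_length_str_of_nat in auto)
  obtain cd where cd: "\<And>A T \<sigma>. \<exists>\<sigma>'. exec A cd (T, \<sigma>) (T, \<sigma>') \<and>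
      \<sigma>' (b + 3) = digit (map \<sigma> [x, b + 2] ! 0) (map \<sigma> [x, b + 2] ! 1) \<and>
      (\<forall>j<b + 5. j \<noteq> b + 3 \<longrightarrow> \<sigma>' j = \<sigma> j)"
    by (rule recfn_com[of "[x, b + 2]" "\<lambda>xs. digit (xs ! 0) (xs ! 1)" "b + 5" "b + 3"])
      (use assms recfn_digit in \<open>auto simp: numeral_2_eq_2\<close>)
  let ?br = "Branch (NonZero (b + 3)) (Write j (Some True)) (Write j (Some False))"
  let ?body = "Dec (b + 1) ;; cd ;; ?br ;; Move j MoveR ;; Inc (b + 2)"
  let ?back = "Dec b ;; Move j MoveL"
  \<comment> \<open>The blank cuts off the rest of a longer word that may be on the tape, such as
    the input when the output is written. Register \<open>b\<close> keeps the length for the way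
    back to cell \<open>0\<close>, where the next word has to start.\<close>
  let ?W = "cl ;; copy b (b + 1) (b + 4) ;; clear (b + 2) ;; Loop (NonZero (b + 1)) ?body ;;
    Write j None ;; Loop (NonZero b) ?back"
  have "\<exists>T' \<sigma>'. exec A ?W (T, \<sigma>) (T', \<sigma>') \<and> tape_word (T' j) (str_of_nat (\<sigma> x)) \<and>
      snd (T' j) = 0 \<and> T' (\<not> j) = T (\<not> j) \<and> (\<forall>i<b. \<sigma>' i = \<sigma> i)"
    if h0: "snd (T j) = 0" for A T \<sigma>
  proof -
    define s where "s = str_of_nat (\<sigma> x)"
    obtain \<tau> where \<tau>: "exec A cl (T, \<sigma>) (T, \<tau>)" "\<tau> b = length s" "\<forall>i<b. \<tau> i = \<sigma> i"
      using cl[of A T \<sigma>] by (auto simp: s_def)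
    let ?\<tau> = "\<tau>(b + 1 := length s, b + 4 := 0, b + 2 := 0)"
    let ?I = "\<lambda>k (T', \<rho> :: nat \<Rightarrow> nat). T' (\<not> j) = T (\<not> j) \<and> snd (T' j) = int k \<and>
      (\<forall>i<k. fst (T' j) (int i) = Bit (s ! i)) \<and> (\<forall>i<b. \<rho> i = \<sigma> i) \<and> \<rho> b = length s \<and>
      \<rho> (b + 1) = length s - k \<and> \<rho> (b + 2) = k"
    have "\<exists>s'. exec A (Loop (NonZero (b + 1)) ?body) (T, ?\<tau>) s' \<and> ?I (length s) s'"
    proof (rule exec_loop[where I = ?I])
      fix k st
      assume k: "k < length s" and "?I k st"
      then obtain T1 \<rho> where st: "st = (T1, \<rho>)" and I: "T1 (\<not> j) = T (\<not> j)" "snd (T1 j) = int k"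
          "\<forall>i<k. fst (T1 j) (int i) = Bit (s ! i)" "\<forall>i<b. \<rho> i = \<sigma> i" "\<rho> b = length s"
          "\<rho> (b + 1) = length s - k" "\<rho> (b + 2) = k"
        by (cases st) auto
      let ?\<rho> = "\<rho>(b + 1 := \<rho> (b + 1) - 1)"
      obtain \<rho>' where \<rho>': "exec A cd (T1, ?\<rho>) (T1, \<rho>')" "\<rho>' (b + 3) = digit (\<sigma> x) k"
          "\<forall>i<b + 5. i \<noteq> b + 3 \<longrightarrow> \<rho>' i = ?\<rho> i"
        using cd[of A T1 ?\<rho>] I assms by auto
      let ?T2 = "T1(j := act (Bit (s ! k), Stay) (T1 j))"
      have "\<rho>' (b + 3) \<noteq> 0 \<longleftrightarrow> s ! k" using \<rho>'(2) digit_iff k by (simp add: s_def)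
      then have br: "exec A ?br (T1, \<rho>') (?T2, \<rho>')"
        using exec_BranchT[OF _ exec_Write[of A j "Some True" T1 \<rho>']]
          exec_BranchF[OF _ exec_Write[of A j "Some False" T1 \<rho>']] by (cases "s ! k") auto
      let ?T3 = "?T2(j := shift_head MoveR (?T2 j))" and ?\<rho>3 = "\<rho>'(b + 2 := Suc (\<rho>' (b + 2)))"
      have "exec A ?body (T1, \<rho>) (?T3, ?\<rho>3)"
        by (rule exec_Seq[OF exec_Dec exec_Seq[OF \<rho>'(1) exec_Seq[OF br exec_Seq[OF exec_Move exec_Inc]]]])
      moreover have "?I (Suc k) (?T3, ?\<rho>3)"
        using I \<rho>'(3) k by (auto simp: act_def shift_head_def case_prod_beta less_Suc_eq)
      ultimately have "\<exists>s'. exec A ?body st s' \<and> ?I (Suc k) s'" unfolding st by blast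
      then show "holds (NonZero (b + 1)) st \<and> (\<exists>s'. exec A ?body st s' \<and> ?I (Suc k) s')"
        using st I k by simp
    qed (use \<tau> h0 in auto)
    then obtain T1 \<rho> where L1: "exec A (Loop (NonZero (b + 1)) ?body) (T, ?\<tau>) (T1, \<rho>)"
        and I: "T1 (\<not> j) = T (\<not> j)" "snd (T1 j) = int (length s)"
          "\<forall>i<length s. fst (T1 j) (int i) = Bit (s ! i)" "\<forall>i<b. \<rho> i = \<sigma> i" "\<rho> b = length s"
      by auto
    let ?T2 = "T1(j := act (sym_of None, Stay) (T1 j))"
    have T2: "tape_word (?T2 j) s" "snd (?T2 j) = int (length s)"
      using I by (auto simp: tape_word_def act_def case_prod_beta)
    let ?J = "\<lambda>k (T', \<rho> :: nat \<Rightarrow> nat). T' (\<not> j) = T (\<not> j) \<and> fst (T' j) = fst (?T2 j) \<and>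
      snd (T' j) = int (length s) - int k \<and> (\<forall>i<b. \<rho> i = \<sigma> i) \<and> \<rho> b = length s - k"
    have "\<exists>s'. exec A (Loop (NonZero b) ?back) (?T2, \<rho>) s' \<and> ?J (length s) s'"
    proof (rule exec_loop[where I = ?J])
      fix k st
      assume k: "k < length s" and J: "?J k st"
      obtain T3 \<rho>3 where st: "st = (T3, \<rho>3)" by (cases st)
      have "exec A ?back st (T3(j := shift_head MoveL (T3 j)), \<rho>3(b := \<rho>3 b - 1))"
        unfolding st by (rule exec_Seq[OF exec_Dec exec_Move])
      moreover have "?J (Suc k) (T3(j := shift_head MoveL (T3 j)), \<rho>3(b := \<rho>3 b - 1))"
        using J k by (auto simp: st shift_head_def)
      ultimately have "\<exists>s'. exec A ?back st s' \<and> ?J (Suc k) s'" by blast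
      then show "holds (NonZero b) st \<and> (\<exists>s'. exec A ?back st s' \<and> ?J (Suc k) s')"
        using st J k by simp
    qed (use I T2 in auto)
    then obtain T4 \<rho>4 where L2: "exec A (Loop (NonZero b) ?back) (?T2, \<rho>) (T4, \<rho>4)"
        and J: "T4 (\<not> j) = T (\<not> j)" "fst (T4 j) = fst (?T2 j)" "snd (T4 j) = 0" "\<forall>i<b. \<rho>4 i = \<sigma> i"
      by auto
    have "exec A (copy b (b + 1) (b + 4)) (T, \<tau>) (T, \<tau>(b + 1 := length s, b + 4 := 0))"
      using exec_copy[of b "b + 1" "b + 4" A T \<tau>] \<tau>(2) by simp
    then have "exec A ?W (T, \<sigma>) (T4, \<rho>4)"
      by (rule exec_Seq[OF \<tau>(1) exec_Seq[OF _ exec_Seq[OF exec_clear exec_Seq[OF L1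
        exec_Seq[OF exec_Write L2]]]]])
    moreover have "tape_word (T4 j) s" using T2(1) J(2) by (simp add: tape_word_def)
    ultimately show ?thesis using J unfolding s_def by blast
  qed
  then show ?thesis using that by blast
qed

text \<open>Horner's scheme for \<open>nat_of_str\<close>, with register \<open>8\<close> for
  doubling. Register \<open>7\<close> counts the moves, so that the head returns to cell
  \<open>0\<close>, where the output will be written.\<close>

lemma read_com:
  obtains R where "\<And>A w. \<exists>\<sigma>. exec A R (\<lambda>j. if j then empty_tape else input_tape w, \<lambda>_. 0)
      (\<lambda>j. if j then empty_tape else input_tape w, \<sigma>) \<and> \<sigma> 1 = nat_of_str w \<and>
      (\<forall>i<7. i \<noteq> 1 \<longrightarrow> \<sigma> i = 0)"
proof -
  obtain cd where cd: "\<And>A T \<sigma>. \<exists>\<sigma>'. exec A cd (T, \<sigma>) (T, \<sigma>') \<and>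
      \<sigma>' 8 = 2 * (map \<sigma> [1] ! 0) \<and> (\<forall>j<9. j \<noteq> 8 \<longrightarrow> \<sigma>' j = \<sigma> j)"
  proof (rule recfn_com[of "[1]" "\<lambda>xs. 2 * xs ! 0" 9 8])
    show "recfn (length [1]) (\<lambda>xs. 2 * xs ! 0)" by (intro recfn_intros) auto
  qed auto
  let ?br = "Branch (Sees (\<lambda>a. a = Bit True)) (Inc 1 ;; Inc 1) (Inc 1)"
  let ?body = "cd ;; clear 1 ;; transfer 8 1 ;; ?br ;; Inc 7 ;; Move False MoveR"
  let ?back = "Dec 7 ;; Move False MoveL"
  let ?R = "Loop (Sees (\<lambda>a. a \<noteq> Blank)) ?body ;; Loop (NonZero 7) ?back"
  have "\<exists>\<sigma>. exec A ?R (\<lambda>j. if j then empty_tape else input_tape w, \<lambda>_. 0)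
      (\<lambda>j. if j then empty_tape else input_tape w, \<sigma>) \<and> \<sigma> 1 = nat_of_str w \<and>
      (\<forall>i<7. i \<noteq> 1 \<longrightarrow> \<sigma> i = 0)" for A w
  proof -
    define tp where "tp k = (\<lambda>j. if j then empty_tape else (fst (input_tape w), int k))" for k
    have tp0: "tp 0 = (\<lambda>j. if j then empty_tape else input_tape w)"
      by (auto simp: tp_def input_tape_def)
    have scan: "k < length w \<Longrightarrow> fst (tp k False) (snd (tp k False)) = Bit (w ! k)"
      "fst (tp (length w) False) (snd (tp (length w) False)) = Blank" for k
      by (auto simp: tp_def input_tape_def)
    have move: "(tp k)(False := shift_head MoveR (tp k False)) = tp (Suc k)"
      "(tp (Suc k))(False := shift_head MoveL (tp (Suc k) False)) = tp k" for k
      by (auto simp: tp_def shift_head_def)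
    let ?I = "\<lambda>k (T, \<rho> :: nat \<Rightarrow> nat). T = tp k \<and> \<rho> 1 = nat_of_str (take k w) \<and> \<rho> 7 = k \<and>
      (\<forall>i<7. i \<noteq> 1 \<longrightarrow> \<rho> i = 0)"
    have "\<exists>s'. exec A (Loop (Sees (\<lambda>a. a \<noteq> Blank)) ?body) (tp 0, \<lambda>_. 0) s' \<and> ?I (length w) s'"
    proof (rule exec_loop[where I = ?I])
      fix k st
      assume k: "k < length w" and "?I k st"
      then obtain \<rho> where st: "st = (tp k, \<rho>)" and I: "\<rho> 1 = nat_of_str (take k w)" "\<rho> 7 = k"
          "\<forall>i<7. i \<noteq> 1 \<longrightarrow> \<rho> i = 0"
        by (cases st) auto
      obtain \<rho>1 where \<rho>1: "exec A cd (tp k, \<rho>) (tp k, \<rho>1)" "\<rho>1 8 = 2 * \<rho> 1" "\<forall>j<9. j \<noteq> 8 \<longrightarrow> \<rho>1 j = \<rho> j"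
        using cd[of A "tp k" \<rho>] by auto
      let ?\<rho>2 = "\<rho>1(1 := 0, 1 := (\<rho>1(1 := 0)) 1 + (\<rho>1(1 := 0)) 8, 8 := 0)"
      let ?\<rho>3 = "?\<rho>2(1 := ?\<rho>2 1 + (if w ! k then 2 else 1))"
      have "exec A (Inc 1 ;; Inc 1) (tp k, ?\<rho>2) (tp k, (?\<rho>2(1 := Suc (?\<rho>2 1)))(1 := Suc ((?\<rho>2(1 := Suc (?\<rho>2 1))) 1)))"
        by (rule exec_Seq[OF exec_Inc exec_Inc])
      then have br: "exec A ?br (tp k, ?\<rho>2) (tp k, ?\<rho>3)"
        using exec_BranchT[of "Sees (\<lambda>a. a = Bit True)" "(tp k, ?\<rho>2)" A "Inc 1 ;; Inc 1" _ "Inc 1"]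
          exec_BranchF[of "Sees (\<lambda>a. a = Bit True)", OF _ exec_Inc[of A 1 "tp k" ?\<rho>2]] scan(1)[OF k]
        by (cases "w ! k") auto
      have "exec A ?body (tp k, \<rho>) ((tp k)(False := shift_head MoveR (tp k False)), ?\<rho>3(7 := Suc (?\<rho>3 7)))"
        by (rule exec_Seq[OF \<rho>1(1) exec_Seq[OF exec_clear exec_Seq[OF exec_transfer
          exec_Seq[OF br exec_Seq[OF exec_Inc exec_Move]]]]]) simp
      moreover have "?I (Suc k) (tp (Suc k), ?\<rho>3(7 := Suc (?\<rho>3 7)))"
        using I \<rho>1(2,3) k by (auto simp: take_Suc_conv_app_nth nat_of_str_snoc)
      ultimately have "\<exists>s'. exec A ?body st s' \<and> ?I (Suc k) s'" unfolding st move by blast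
      then show "holds (Sees (\<lambda>a. a \<noteq> Blank)) st \<and> (\<exists>s'. exec A ?body st s' \<and> ?I (Suc k) s')"
        using st scan(1)[OF k] by simp
    next
      fix st
      assume "?I (length w) st"
      then show "\<not> holds (Sees (\<lambda>a. a \<noteq> Blank)) st" using scan(2) by (cases st) simp
    qed (auto simp: nat_of_str_Nil)
    then obtain \<rho> where L1: "exec A (Loop (Sees (\<lambda>a. a \<noteq> Blank)) ?body) (tp 0, \<lambda>_. 0) (tp (length w), \<rho>)"
        and I: "\<rho> 1 = nat_of_str w" "\<rho> 7 = length w" "\<forall>i<7. i \<noteq> 1 \<longrightarrow> \<rho> i = 0" by auto
    let ?J = "\<lambda>k (T, \<rho> :: nat \<Rightarrow> nat). T = tp (length w - k) \<and> \<rho> 1 = nat_of_str w \<and> \<rho> 7 = length w - k \<and>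
      (\<forall>i<7. i \<noteq> 1 \<longrightarrow> \<rho> i = 0)"
    have "\<exists>s'. exec A (Loop (NonZero 7) ?back) (tp (length w), \<rho>) s' \<and> ?J (length w) s'"
    proof (rule exec_loop[where I = ?J])
      fix k st
      assume k: "k < length w" and J: "?J k st"
      then obtain \<rho> where st: "st = (tp (length w - k), \<rho>)" by (cases st) auto
      define m where "m = length w - Suc k"
      have m: "length w - k = Suc m" using k by (simp add: m_def)
      have "exec A ?back st ((tp (length w - k))(False := shift_head MoveL (tp (length w - k) False)),
          \<rho>(7 := \<rho> 7 - 1))"
        unfolding st by (rule exec_Seq[OF exec_Dec exec_Move])
      then have "exec A ?back st (tp m, \<rho>(7 := \<rho> 7 - 1))" by (simp only: m move)
      moreover have "?J (Suc k) (tp m, \<rho>(7 := \<rho> 7 - 1))" using J k by (auto simp: st m_def)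
      ultimately have "\<exists>s'. exec A ?back st s' \<and> ?J (Suc k) s'" by blast
      then show "holds (NonZero 7) st \<and> (\<exists>s'. exec A ?back st s' \<and> ?J (Suc k) s')"
        using st J k by simp
    qed (use I in auto)
    then obtain \<rho>' where "exec A (Loop (NonZero 7) ?back) (tp (length w), \<rho>) (tp 0, \<rho>')"
        "\<rho>' 1 = nat_of_str w" "\<forall>i<7. i \<noteq> 1 \<longrightarrow> \<rho>' i = 0" by auto
    then show ?thesis using exec_Seq[OF L1] unfolding tp0 by blast
  qed
  then show ?thesis using that by blast
qed

text \<open>The strings with numbers below \<open>2 ^ Suc n\<close>, among them all strings of
  length at most \<open>n\<close>, are put to the oracle one by one. A halting stage is searched
  only for those in \<open>A\<close>, where it exists by assumption.\<close>

lemma oracle_machine: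
  assumes Y: "recfn 2 (\<lambda>xs. Y (xs ! 0) (xs ! 1))" and H: "recpr 2 (\<lambda>xs. H (xs ! 0) (xs ! 1))"
    and mono: "\<And>s t x. H s x \<Longrightarrow> s \<le> t \<Longrightarrow> H t x"
  obtains M where "is_oracle_tm M"
    "\<And>A n. (\<And>x. str_of_nat x \<in> A \<Longrightarrow> \<exists>s. H s x) \<Longrightarrow>
      \<exists>t. (\<forall>x<2 ^ Suc n. str_of_nat x \<in> A \<longrightarrow> H t x) \<and> tm_outputs_nat M A n (str_of_nat (Y n t))"
proof -
  obtain R where R: "\<And>A w. \<exists>\<sigma>. exec A R (\<lambda>j. if j then empty_tape else input_tape w, \<lambda>_. 0)
      (\<lambda>j. if j then empty_tape else input_tape w, \<sigma>) \<and> \<sigma> 1 = nat_of_str w \<and>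
      (\<forall>i<7. i \<noteq> 1 \<longrightarrow> \<sigma> i = 0)"
    using read_com by blast
  obtain W1 where W1: "\<And>A T \<sigma>. snd (T True) = 0 \<Longrightarrow> \<exists>T' \<sigma>'. exec A W1 (T, \<sigma>) (T', \<sigma>') \<and>
      tape_word (T' True) (str_of_nat (\<sigma> 3)) \<and> snd (T' True) = 0 \<and> T' (\<not> True) = T (\<not> True) \<and>
      (\<forall>i<7. \<sigma>' i = \<sigma> i)"
    using write_com[of 3 7 True] by auto
  obtain W0 where W0: "\<And>A T \<sigma>. snd (T False) = 0 \<Longrightarrow> \<exists>T' \<sigma>'. exec A W0 (T, \<sigma>) (T', \<sigma>') \<and>
      tape_word (T' False) (str_of_nat (\<sigma> 6)) \<and> snd (T' False) = 0 \<and> T' (\<not> False) = T (\<not> False) \<and>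
      (\<forall>i<7. \<sigma>' i = \<sigma> i)"
    using write_com[of 6 7 False] by auto
  obtain cp where cp: "\<And>A T \<sigma>. \<exists>\<sigma>'. exec A cp (T, \<sigma>) (T, \<sigma>') \<and>
      \<sigma>' 4 = 2 ^ Suc (map \<sigma> [1] ! 0) \<and> (\<forall>j<7. j \<noteq> 4 \<longrightarrow> \<sigma>' j = \<sigma> j)"
  proof (rule recfn_com[of "[1]" "\<lambda>xs. 2 ^ Suc (xs ! 0)" 7 4])
    show "recfn (length [1]) (\<lambda>xs. 2 ^ Suc (xs ! 0))" by (intro recfn_intros) auto
  qed auto
  obtain cy where cy: "\<And>A T \<sigma>. \<exists>\<sigma>'. exec A cy (T, \<sigma>) (T, \<sigma>') \<and>
      \<sigma>' 6 = Y (map \<sigma> [1, 2] ! 0) (map \<sigma> [1, 2] ! 1) \<and> (\<forall>j<7. j \<noteq> 6 \<longrightarrow> \<sigma>' j = \<sigma> j)"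
    by (rule recfn_com[of "[1, 2]" "\<lambda>xs. Y (xs ! 0) (xs ! 1)" 7 6])
      (use Y in \<open>auto simp: numeral_2_eq_2\<close>)
  have "recpr (Suc 1) (\<lambda>ys. H (ys ! 0) (tl ys ! 0))"
  proof -
    have "recfn 2 (\<lambda>ys. of_bool (H (ys ! 0) (tl ys ! 0)))"
      by (rule recfn_cong[OF H[unfolded recpr_def]]) (auto simp: nth_tl)
    then show ?thesis by (simp add: recpr_def numeral_2_eq_2)
  qed
  then obtain r where r: "\<And>m xs. length xs = 1 \<Longrightarrow> rec_eval r (m # xs) (of_bool (\<not> H m (xs ! 0)))"
    using recpr_program[of 1 "\<lambda>m xs. H m (xs ! 0)"] by blast
  \<comment> \<open>The search for a stage may diverge on strings outside \<open>A\<close>, so it is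
    compiled from \<open>Mu r\<close> by \<open>recf_com\<close>, which covers partial
    programs.\<close>
  obtain ch where ch: "computes ch (Mu r) [3] 5 7" using recf_com[of "[3]" 7 5 "Mu r"] by auto
  \<comment> \<open>Registers: \<open>0\<close> answer, \<open>1\<close> input \<open>n\<close>,
    \<open>2\<close> stage accumulated so far, \<open>3\<close> current string, \<open>4\<close>
    remaining rounds, \<open>5\<close> stage just found, \<open>6\<close> number of the
    output.\<close>
  let ?br = "Branch (NonZero 0) (clear 0 ;; ch ;; transfer 5 2) Skip"
  let ?body = "Dec 4 ;; W1 ;; Ask ;; ?br ;; Inc 3"
  let ?c = "R ;; cp ;; Loop (NonZero 4) ?body ;; cy ;; W0"
  obtain M where M: "is_oracle_tm M"
    "\<And>A w T \<sigma> y. exec A ?c (\<lambda>j. if j then empty_tape else input_tape w, \<lambda>_. 0) (T, \<sigma>) \<Longrightarrow>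
      tape_word (T False) y \<Longrightarrow> tm_outputs M A w y"
    using com_machine by blast
  have "\<exists>t. (\<forall>x<2 ^ Suc n. str_of_nat x \<in> A \<longrightarrow> H t x) \<and> tm_outputs_nat M A n (str_of_nat (Y n t))"
    if A: "\<And>x. str_of_nat x \<in> A \<Longrightarrow> \<exists>s. H s x" for A n
  proof -
    let ?T = "\<lambda>j. if j then empty_tape else input_tape (str_of_nat n)"
    obtain \<sigma> where \<sigma>: "exec A R (?T, \<lambda>_. 0) (?T, \<sigma>)" "\<sigma> 1 = n" "\<forall>i<7. i \<noteq> 1 \<longrightarrow> \<sigma> i = 0"
      using R[of A "str_of_nat n"] by auto
    obtain \<tau> where \<tau>: "exec A cp (?T, \<sigma>) (?T, \<tau>)" "\<tau> 4 = 2 ^ Suc n" "\<forall>i<7. i \<noteq> 4 \<longrightarrow> \<tau> i = \<sigma> i"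
      using cp[of A ?T \<sigma>] \<sigma>(2) by auto
    let ?I = "\<lambda>k (T, \<rho> :: nat \<Rightarrow> nat). T False = input_tape (str_of_nat n) \<and> snd (T True) = 0 \<and> \<rho> 0 = 0 \<and> \<rho> 1 = n \<and>
      \<rho> 3 = k \<and> \<rho> 4 = 2 ^ Suc n - k \<and> (\<forall>x<k. str_of_nat x \<in> A \<longrightarrow> H (\<rho> 2) x)"
    have "\<exists>s'. exec A (Loop (NonZero 4) ?body) (?T, \<tau>) s' \<and> ?I (2 ^ Suc n) s'"
    proof (rule exec_loop[where I = ?I])
      fix k st
      assume k: "k < 2 ^ Suc n" and "?I k st"
      then obtain T \<rho> where st: "st = (T, \<rho>)" and I: "T False = input_tape (str_of_nat n)"
          "snd (T True) = 0" "\<rho> 0 = 0" "\<rho> 1 = n" "\<rho> 3 = k" "\<rho> 4 = 2 ^ Suc n - k"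
          "\<forall>x<k. str_of_nat x \<in> A \<longrightarrow> H (\<rho> 2) x"
        by (cases st) auto
      let ?\<rho> = "\<rho>(4 := \<rho> 4 - 1)"
      obtain T' \<rho>1 where \<rho>1: "exec A W1 (T, ?\<rho>) (T', \<rho>1)" "tape_word (T' True) (str_of_nat k)"
          "snd (T' True) = 0" "T' False = T False" "\<forall>i<7. \<rho>1 i = ?\<rho> i"
        using W1[of T A ?\<rho>] I by auto
      let ?\<rho>2 = "\<rho>1(0 := \<rho>1 0 + of_bool (\<exists>w\<in>A. tape_word (T' True) w))"
      have ask: "(\<exists>w\<in>A. tape_word (T' True) w) \<longleftrightarrow> str_of_nat k \<in> A"
        using \<rho>1(2) tape_word_unique by blast
      have "\<exists>\<rho>3. exec A ?br (T', ?\<rho>2) (T', \<rho>3) \<and> \<rho>3 0 = 0 \<and> (\<forall>i<5. i \<notin> {0, 2} \<longrightarrow> \<rho>3 i = \<rho>1 i) \<and>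
          \<rho>1 2 \<le> \<rho>3 2 \<and> (str_of_nat k \<in> A \<longrightarrow> H (\<rho>3 2) k)"
      proof (cases "str_of_nat k \<in> A")
        case True
        then obtain s where "H s k" using A by blast
        then have "rec_eval (Mu r) [k] (LEAST s. H s k)"
          using rec_eval_Mu_Least[of r "[k]" "\<lambda>m. H m k" s] r[of "[k]"] by simp
        moreover have "map (?\<rho>2(0 := 0)) [3] = [k]" using \<rho>1(5) I(5) by simp
        ultimately have "rec_eval (Mu r) (map (?\<rho>2(0 := 0)) [3]) (LEAST s. H s k)" by (simp only:)
        with ch have "\<exists>\<rho>3. exec A ch (T', ?\<rho>2(0 := 0)) (T', \<rho>3) \<and> \<rho>3 5 = (LEAST s. H s k) \<and>
            (\<forall>i<7. i \<noteq> 5 \<longrightarrow> \<rho>3 i = (?\<rho>2(0 := 0)) i)"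
          unfolding computes_def by blast
        then obtain \<rho>3 where \<rho>3: "exec A ch (T', ?\<rho>2(0 := 0)) (T', \<rho>3)" "\<rho>3 5 = (LEAST s. H s k)"
            "\<forall>i<7. i \<noteq> 5 \<longrightarrow> \<rho>3 i = (?\<rho>2(0 := 0)) i"
          by blast
        have "exec A (clear 0 ;; ch ;; transfer 5 2) (T', ?\<rho>2) (T', \<rho>3(2 := \<rho>3 2 + \<rho>3 5, 5 := 0))"
          by (rule exec_Seq[OF exec_clear exec_Seq[OF \<rho>3(1) exec_transfer]]) simp
        then have "exec A ?br (T', ?\<rho>2) (T', \<rho>3(2 := \<rho>3 2 + \<rho>3 5, 5 := 0))"
          by (rule exec_BranchT[rotated]) (use True ask in simp)
        \<comment> \<open>The stages found are added up instead of maximised. The sum exceeds none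
          of its terms from below, so by monotonicity it is a common stage.\<close>
        moreover have "H (\<rho>3 2 + \<rho>3 5) k"
        proof (rule mono)
          show "H (\<rho>3 5) k" unfolding \<rho>3(2) using \<open>H s k\<close> by (rule LeastI)
        qed simp
        ultimately show ?thesis
          using \<rho>3 by (intro exI[of _ "\<rho>3(2 := \<rho>3 2 + \<rho>3 5, 5 := 0)"]) auto
      next
        case False
        have "exec A ?br (T', ?\<rho>2) (T', ?\<rho>2)"
          by (rule exec_BranchF[OF _ exec_Skip]) (use False ask \<rho>1(5) I(3) in simp)
        then show ?thesis using False ask \<rho>1(5) I(3) by (intro exI[of _ ?\<rho>2]) simp
      qed
      then obtain \<rho>3 where \<rho>3: "exec A ?br (T', ?\<rho>2) (T', \<rho>3)" "\<rho>3 0 = 0"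
          "\<forall>i<5. i \<notin> {0, 2} \<longrightarrow> \<rho>3 i = \<rho>1 i" "\<rho>1 2 \<le> \<rho>3 2" "str_of_nat k \<in> A \<longrightarrow> H (\<rho>3 2) k"
        by blast
      have "exec A ?body st (T', \<rho>3(3 := Suc (\<rho>3 3)))"
        unfolding st
        by (rule exec_Seq[OF exec_Dec exec_Seq[OF \<rho>1(1) exec_Seq[OF exec_Ask exec_Seq[OF \<rho>3(1) exec_Inc]]]])
      moreover have "?I (Suc k) (T', \<rho>3(3 := Suc (\<rho>3 3)))"
      proof -
        have "\<rho>3 1 = n" "\<rho>3 3 = k" "\<rho>3 4 = 2 ^ Suc n - Suc k" "\<rho> 2 \<le> \<rho>3 2"
          using \<rho>3(3,4) \<rho>1(5) I by auto
        then show ?thesis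
          using \<rho>3(2,5) \<rho>1(3,4) I(1,7) mono by (auto simp: less_Suc_eq simp del: power_Suc)
      qed
      ultimately have "\<exists>s'. exec A ?body st s' \<and> ?I (Suc k) s'" by blast
      then show "holds (NonZero 4) st \<and> (\<exists>s'. exec A ?body st s' \<and> ?I (Suc k) s')"
        using st I(6) k by simp
    qed (use \<sigma> \<tau> in \<open>auto simp: empty_tape_def\<close>)
    then obtain T \<rho> where L: "exec A (Loop (NonZero 4) ?body) (?T, \<tau>) (T, \<rho>)"
        and I: "T False = input_tape (str_of_nat n)" "\<rho> 1 = n"
          "\<forall>x<2 ^ Suc n. str_of_nat x \<in> A \<longrightarrow> H (\<rho> 2) x"
      by auto
    obtain \<rho>1 where \<rho>1: "exec A cy (T, \<rho>) (T, \<rho>1)" "\<rho>1 6 = Y n (\<rho> 2)"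
      using cy[of A T \<rho>] I(2) by auto
    have "snd (T False) = 0" using I(1) by (simp add: input_tape_def)
    then obtain T' \<rho>2 where W: "exec A W0 (T, \<rho>1) (T', \<rho>2)" "tape_word (T' False) (str_of_nat (Y n (\<rho> 2)))"
      using W0[of T A \<rho>1] \<rho>1(2) by auto
    have "exec A ?c (?T, \<lambda>_. 0) (T', \<rho>2)"
      by (rule exec_Seq[OF \<sigma>(1) exec_Seq[OF \<tau>(1) exec_Seq[OF L exec_Seq[OF \<rho>1(1) W(1)]]]])
    then have "tm_outputs_nat M A n (str_of_nat (Y n (\<rho> 2)))"
      unfolding tm_outputs_nat_def using M(2) W(2) by blast
    then show ?thesis using I(3) by blast
  qed
  then show ?thesis using that M(1) by blast
qed

section \<open>The approximations and the computer\<close>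

lemma total_recursive_pos_recfn:
  assumes "total_recursive_pos f" "recfn k F" "\<And>xs. length xs = k \<Longrightarrow> 1 \<le> F xs"
  shows "recfn k (\<lambda>xs. f (F xs))"
proof -
  obtain r where r: "\<And>n. 1 \<le> n \<Longrightarrow> rec_eval r [n] (f n)"
    using assms(1) by (auto simp: total_recursive_pos_def)
  obtain s where s: "\<And>xs. length xs = k \<Longrightarrow> rec_eval s xs (F xs)"
    using assms(2) by (auto simp: recfn_def)
  have "rec_eval (Comp r [s]) xs (f (F xs))" if "length xs = k" for xs
    by (rule eval_Comp[where ys = "[F xs]"]) (use r s assms(3) that in auto)
  then show ?thesis unfolding recfn_def by blast
qed

text \<open>A leading \<open>1\<close> followed by the first \<open>m\<close> bits, and these bits
  together are the integer part of \<open>2 ^ m\<close> times the fractional part. So the output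
  string is determined by one floor.\<close>

lemma nat_of_str_real_prefix:
  "nat_of_str (\<alpha> \<restriction>\<^sub>r int m) + 1 = 2 ^ m + nat \<lfloor>2 ^ m * (\<alpha> - of_int \<lfloor>\<alpha>\<rfloor>)\<rfloor>"
proof (induction m)
  case 0
  have "\<lfloor>\<alpha> - of_int \<lfloor>\<alpha>\<rfloor>\<rfloor> = 0" by (simp add: floor_eq_iff)
  then show ?case by (simp add: real_prefix_def nat_of_str_Nil)
next
  case (Suc m)
  define \<beta> where "\<beta> = \<alpha> - of_int \<lfloor>\<alpha>\<rfloor>"
  define u where "u = \<lfloor>2 ^ m * \<beta>\<rfloor>"
  define w where "w = \<lfloor>2 ^ Suc m * \<beta>\<rfloor>"
  have "0 \<le> \<beta>" by (simp add: \<beta>_def)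
  then have u0: "0 \<le> u" by (simp add: u_def)
  have "of_int u \<le> 2 ^ m * \<beta>" "2 ^ m * \<beta> < of_int u + 1" by (auto simp: u_def)
  then have "2 * u \<le> w" "w < 2 * u + 2"
    unfolding w_def by (auto simp: le_floor_iff floor_less_iff)
  then have "w = 2 * u \<or> w = 2 * u + 1" by linarith
  then have w: "w = 2 * u + of_bool (odd w)" by auto
  have "bits \<alpha> m \<longleftrightarrow> odd w" unfolding w_def \<beta>_def by (rule bits_floor)
  moreover have "\<alpha> \<restriction>\<^sub>r int (Suc m) = \<alpha> \<restriction>\<^sub>r int m @ [bits \<alpha> m]"
    by (simp add: real_prefix_def nat_add_distrib)
  ultimately have "nat_of_str (\<alpha> \<restriction>\<^sub>r int (Suc m)) + 1 = 2 * (nat_of_str (\<alpha> \<restriction>\<^sub>r int m) + 1) + of_bool (odd w)"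
    by (simp add: nat_of_str_snoc)
  also have "\<dots> = 2 ^ Suc m + (2 * nat u + of_bool (odd w))"
    unfolding Suc.IH by (simp add: u_def \<beta>_def)
  also have "2 * nat u + of_bool (odd w) = nat w"
    using u0 by (subst (2) w) (simp add: nat_add_distrib nat_mult_distrib)
  finally show ?case by (simp add: w_def \<beta>_def)
qed

text \<open>
  \<open>G j m s\<close> says that the \<open>s\<close>-th approximation of the fractional part of \<open>\<alpha>\<close>
  has reached \<open>j / 2 ^ m\<close>. A rational \<open>\<alpha>\<close> is approximated by itself, so that every
  \<open>j / 2 ^ m\<close> not exceeding the fractional part is reached.
\<close>

lemma re_real_approximation:
  fixes \<alpha> :: real
  defines "\<beta> \<equiv> \<alpha> - of_int \<lfloor>\<alpha>\<rfloor>"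
  assumes "re_real \<alpha>"
  obtains G :: "nat \<Rightarrow> nat \<Rightarrow> nat \<Rightarrow> bool" where
    "recpr 3 (\<lambda>xs. G (xs ! 0) (xs ! 1) (xs ! 2))"
    "\<And>j m s. G j m s \<Longrightarrow> real j \<le> 2 ^ m * \<beta>"
    "\<And>j m. real j \<le> 2 ^ m * \<beta> \<Longrightarrow> \<exists>s. G j m s"
    "\<And>i j m s. G (j * 2 ^ i) (m + i) s \<longleftrightarrow> G j m s"
proof -
  have \<beta>: "0 \<le> \<beta>" by (simp add: \<beta>_def)
  \<comment> \<open>Stage \<open>s\<close> is represented by the fraction
    \<open>a s / (c s + 1)\<close> of natural numbers, which makes reaching \<open>j / 2 ^ m\<close>
    a comparison of natural numbers.\<close>
  have "\<exists>a c. recfn 1 (\<lambda>xs. a (xs ! 0)) \<and> recfn 1 (\<lambda>xs. c (xs ! 0)) \<and>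
      (\<forall>s. real (a s) \<le> \<beta> * real (c s + 1)) \<and>
      (\<forall>j m. real j \<le> 2 ^ m * \<beta> \<longrightarrow> (\<exists>s. j * (c s + 1) \<le> 2 ^ m * a s))"
  proof (cases "\<beta> \<in> \<rat>")
    case True
    then obtain p q where pq: "q \<noteq> 0" "\<bar>\<beta>\<bar> = real p / real q"
      by (rule Rats_abs_nat_div_natE)
    then have b: "\<beta> * real q = real p" using \<beta> by simp
    have "j * q \<le> 2 ^ m * p" if "real j \<le> 2 ^ m * \<beta>" for j m
    proof -
      have "real j * real q \<le> 2 ^ m * \<beta> * real q" using that by (rule mult_right_mono) simp
      then have "real (j * q) \<le> real (2 ^ m * p)" by (simp add: b mult.assoc)
      then show ?thesis by (simp only: of_nat_le_iff)
    qed
    then show ?thesis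
      using pq(1) b by (intro exI[of _ "\<lambda>_. p"] exI[of _ "\<lambda>_. q - 1"]) (auto intro: recfn_const)
  next
    case False
    obtain g where g: "total_recursive_rat_pos g" "\<And>n. n \<ge> 1 \<Longrightarrow> real_of_rat (g n) \<le> \<alpha>"
        "(\<lambda>n. real_of_rat (g n)) \<longlonglongrightarrow> \<alpha>"
      using assms(2) unfolding re_real_def by blast
    obtain a b c where abc: "total_recursive_pos a" "total_recursive_pos b" "total_recursive_pos c"
        "\<And>n. n \<ge> 1 \<Longrightarrow> g n = (of_nat (a n) - of_nat (b n)) / (of_nat (c n) + 1)"
      using g(1) unfolding total_recursive_rat_pos_def by blast
    \<comment> \<open>The integer part may be negative, so its negative and positive parts are
      separate constants for the arithmetic on naturals.\<close>
    define z1 z2 where "z1 = nat (- \<lfloor>\<alpha>\<rfloor>)" and "z2 = nat \<lfloor>\<alpha>\<rfloor>"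
    have z: "of_int \<lfloor>\<alpha>\<rfloor> = real z2 - real z1" by (simp add: z1_def z2_def)
    define c' where "c' s = c (Suc s)" for s
    \<comment> \<open>The truncating difference replaces a negative approximation by
      \<open>0\<close>, which is still at most \<open>\<beta>\<close>.\<close>
    define a' where "a' s = (a (Suc s) + z1 * (c' s + 1)) - (b (Suc s) + z2 * (c' s + 1))" for s
    define h where "h s = real_of_rat (g (Suc s)) - of_int \<lfloor>\<alpha>\<rfloor>" for s
    have h: "h s * real (c' s + 1) =
        real (a (Suc s) + z1 * (c' s + 1)) - real (b (Suc s) + z2 * (c' s + 1))" for s
    proof -
      have "real_of_rat (g (Suc s)) = (real (a (Suc s)) - real (b (Suc s))) / real (c' s + 1)"
        using abc(4)[of "Suc s"] by (simp add: c'_def of_rat_divide of_rat_diff of_rat_add)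
      then have "real_of_rat (g (Suc s)) * real (c' s + 1) = real (a (Suc s)) - real (b (Suc s))"
        by (simp del: of_nat_add of_nat_Suc)
      then show ?thesis unfolding h_def z by (simp add: algebra_simps)
    qed
    have "real (x - y) = max 0 (real x - real y)" for x y
      by (cases "y \<le> x") auto
    then have a': "real (a' s) = max 0 (h s * real (c' s + 1))" for s
      by (simp only: h a'_def)
    have "real (a' s) \<le> \<beta> * real (c' s + 1)" for s
    proof -
      have "h s \<le> \<beta>" using g(2)[of "Suc s"] by (simp add: h_def \<beta>_def)
      then have "h s * real (c' s + 1) \<le> \<beta> * real (c' s + 1)" by (rule mult_right_mono) simp
      then show ?thesis using \<beta> unfolding a' by simp
    qed
    moreover have "\<exists>s. j * (c' s + 1) \<le> 2 ^ m * a' s" if j: "real j \<le> 2 ^ m * \<beta>" for j m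
    proof -
      \<comment> \<open>Irrationality makes the inequality strict, so the threshold is passed at
        some finite stage.\<close>
      have "real j / 2 ^ m \<noteq> \<beta>"
      proof
        assume "real j / 2 ^ m = \<beta>"
        moreover have "real j / 2 ^ m \<in> \<rat>" by (intro Rats_divide Rats_power) auto
        ultimately show False using False by simp
      qed
      moreover have "real j / 2 ^ m \<le> \<beta>" using j by (simp add: field_simps)
      ultimately have "real j / 2 ^ m + of_int \<lfloor>\<alpha>\<rfloor> < \<alpha>" by (simp add: \<beta>_def)
      moreover have "(\<lambda>s. real_of_rat (g (Suc s))) \<longlonglongrightarrow> \<alpha>"
        using g(3) by (rule LIMSEQ_Suc)
      ultimately have "\<forall>\<^sub>F s in sequentially. real j / 2 ^ m + of_int \<lfloor>\<alpha>\<rfloor> < real_of_rat (g (Suc s))"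
        by (rule order_tendstoD(1)[rotated])
      then obtain s where "real j / 2 ^ m < h s"
        unfolding h_def eventually_sequentially by (metis less_diff_eq order_refl)
      then have "real j \<le> 2 ^ m * h s" by (simp add: field_simps)
      then have "real j * real (c' s + 1) \<le> 2 ^ m * h s * real (c' s + 1)"
        by (rule mult_right_mono) simp
      also have "\<dots> \<le> 2 ^ m * real (a' s)" unfolding a' by (simp add: mult.assoc)
      finally have "real (j * (c' s + 1)) \<le> real (2 ^ m * a' s)" by (simp add: algebra_simps)
      then show ?thesis by (metis of_nat_le_iff)
    qed
    moreover have rc: "recfn 1 (\<lambda>xs. c' (xs ! 0))"
      unfolding c'_def
      by (rule total_recursive_pos_recfn[OF abc(3)], intro recfn_intros) auto
    moreover have "recfn 1 (\<lambda>xs. a' (xs ! 0))"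
      unfolding a'_def
      by (intro recfn_intros rc total_recursive_pos_recfn[OF abc(1)] total_recursive_pos_recfn[OF abc(2)]) auto
    ultimately show ?thesis by blast
  qed
  then obtain a c where ac: "recfn 1 (\<lambda>xs. a (xs ! 0))" "recfn 1 (\<lambda>xs. c (xs ! 0))"
      "\<And>s. real (a s) \<le> \<beta> * real (c s + 1)"
      "\<And>j m. real j \<le> 2 ^ m * \<beta> \<Longrightarrow> \<exists>s. j * (c s + 1) \<le> 2 ^ m * a s"
    by blast
  let ?G = "\<lambda>j m s. j * (c s + 1) \<le> 2 ^ m * a s"
  show ?thesis
  proof (rule that)
    show "recpr 3 (\<lambda>xs. ?G (xs ! 0) (xs ! 1) (xs ! 2))"
      by (intro recfn_intros recfn_compose1[OF ac(1)] recfn_compose1[OF ac(2)]) auto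
    show "real j \<le> 2 ^ m * \<beta>" if "?G j m s" for j m s
    proof -
      have "real j * real (c s + 1) \<le> 2 ^ m * real (a s)"
        using that by (metis of_nat_le_iff of_nat_mult of_nat_numeral of_nat_power)
      also have "\<dots> \<le> 2 ^ m * (\<beta> * real (c s + 1))" by (rule mult_left_mono[OF ac(3)]) simp
      finally have "real j * real (c s + 1) \<le> (2 ^ m * \<beta>) * real (c s + 1)" by (simp only: mult.assoc)
      then show ?thesis by (rule mult_right_le_imp_le) simp
    qed
    \<comment> \<open>The two fractions are equal. This transfers a threshold of precision
      \<open>m\<close> to the higher precision that the computer uses.\<close>
    show "?G (j * 2 ^ i) (m + i) s \<longleftrightarrow> ?G j m s" for i j m s
    proof -
      have "j * 2 ^ i * (c s + 1) = 2 ^ i * (j * (c s + 1))" "2 ^ (m + i) * a s = 2 ^ i * (2 ^ m * a s)"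
        by (simp_all add: power_add algebra_simps)
      then show ?thesis by (simp only: mult_le_cancel1) simp
    qed
  qed (use ac(4) in blast)
qed

text \<open>
  The lengths \<open>l n\<close> absorb the additive constant of an optimal computer: \<open>l n\<close> is
  the minimum of \<open>f (n + e) + 2 * e\<close> over all \<open>e\<close>, up to a constant. The minimum is attained
  for \<open>e \<le> f n\<close>, which makes it computable.
\<close>

lemma shift_stable_lengths:
  assumes f: "total_recursive_pos f" and sum: "summable (\<lambda>n. 2 powr (- real (f (Suc n))))"
  obtains l K where "recfn 1 (\<lambda>xs. l (xs ! 0))" "\<And>n. (\<Sum>k<n. (1 / 2 :: real) ^ l k) \<le> 1"
    "\<And>n d. 1 \<le> n + d \<Longrightarrow> l n \<le> f (n + d) + 2 * d + K"
proof -
  \<comment> \<open>The value \<open>f 0\<close> is unspecified, so it is replaced by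
    \<open>f 1\<close>.\<close>
  define f0 where "f0 n = f (if n = 0 then 1 else n)" for n
  have rf0: "recfn 1 (\<lambda>xs. f0 (xs ! 0))"
    unfolding f0_def by (rule total_recursive_pos_recfn[OF f], intro recfn_intros) auto
  define F where "F n = (LEAST y. \<exists>e<Suc (f0 n). f0 (n + e) + 2 * e \<le> y)" for n
  have ex: "\<exists>y. \<exists>e<Suc (f0 n). f0 (n + e) + 2 * e \<le> y" for n
    by (intro exI[of _ "f0 n"] exI[of _ 0]) simp
  have rF: "recfn 1 (\<lambda>xs. F (xs ! 0))"
    unfolding F_def
  proof (rule recfn_Least)
    show "recpr (Suc 1) (\<lambda>ys. \<exists>e<Suc (f0 (tl ys ! 0)). f0 (tl ys ! 0 + e) + 2 * e \<le> ys ! 0)"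
      by (intro recfn_intros recfn_compose1[OF rf0]) auto
  qed (rule ex)
  have F_le: "F n \<le> f0 (n + d) + 2 * d" for n d
  proof (cases "d < Suc (f0 n)")
    case True
    then show ?thesis unfolding F_def by (intro Least_le) auto
  next
    case False
    have "F n \<le> f0 n" unfolding F_def by (intro Least_le exI[of _ 0]) simp
    then show ?thesis using False by simp
  qed
  have F_ge: "\<exists>e<Suc (f0 n). f0 (n + e) + 2 * e \<le> F n" for n
    unfolding F_def using ex[of n] by (rule LeastI_ex)
  let ?h = "1 / 2 :: real"
  have "summable (\<lambda>n. ?h ^ f0 (Suc n))"
    using sum by (simp add: f0_def powr_minus powr_realpow power_one_over inverse_eq_divide)
  then have sum0: "summable (\<lambda>n. ?h ^ f0 n)" by (rule summable_Suc_iff[where f = "\<lambda>n. ?h ^ f0 n", THEN iffD1])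
  define B where "B = (\<Sum>n. ?h ^ f0 n)"
  \<comment> \<open>A shift of the argument only omits terms, so \<open>B\<close> is the same bound
    for all shifts \<open>e\<close>.\<close>
  have B: "(\<Sum>k<n. ?h ^ f0 (k + e)) \<le> B" for n e
  proof -
    have "(\<Sum>k<n. ?h ^ f0 (k + e)) = (\<Sum>i\<in>(\<lambda>k. k + e) ` {..<n}. ?h ^ f0 i)"
      by (simp add: sum.reindex)
    also have "\<dots> \<le> B" unfolding B_def by (rule sum_le_suminf[OF sum0]) auto
    finally show ?thesis .
  qed
  have B0: "0 \<le> B" using B[of 0 0] by simp
  have sumF: "(\<Sum>k<n. ?h ^ F k) \<le> 2 * B" for n
  proof -
    \<comment> \<open>A bound on the minimising \<open>e\<close> that is uniform in
      \<open>k < n\<close>; it makes both sums finite and exchangeable.\<close>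
    define M where "M = Suc (\<Sum>k<n. f0 k)"
    have "?h ^ F k \<le> (\<Sum>e<M. ?h ^ (f0 (k + e) + 2 * e))" if "k < n" for k
    proof -
      obtain e where e: "e < Suc (f0 k)" "f0 (k + e) + 2 * e \<le> F k" using F_ge by blast
      have "f0 k \<le> (\<Sum>k<n. f0 k)" using that by (intro member_le_sum) auto
      then have "e \<in> {..<M}" using e(1) by (simp add: M_def)
      then have "?h ^ (f0 (k + e) + 2 * e) \<le> (\<Sum>e<M. ?h ^ (f0 (k + e) + 2 * e))"
        by (intro member_le_sum) auto
      moreover have "?h ^ F k \<le> ?h ^ (f0 (k + e) + 2 * e)"
        using e(2) by (intro power_decreasing) auto
      ultimately show ?thesis by linarith
    qed
    then have "(\<Sum>k<n. ?h ^ F k) \<le> (\<Sum>k<n. \<Sum>e<M. ?h ^ (f0 (k + e) + 2 * e))"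
      by (intro sum_mono) auto
    also have "\<dots> = (\<Sum>e<M. ?h ^ (2 * e) * (\<Sum>k<n. ?h ^ f0 (k + e)))"
      by (subst sum.swap) (simp add: power_add sum_distrib_left mult.commute)
    also have "\<dots> \<le> (\<Sum>e<M. ?h ^ e * B)"
    proof (rule sum_mono)
      fix e
      \<comment> \<open>Half of the penalty exponent already gives a geometric series with sum at
        most \<open>2\<close>.\<close>
      have "?h ^ (2 * e) \<le> ?h ^ e" by (intro power_decreasing) auto
      then show "?h ^ (2 * e) * (\<Sum>k<n. ?h ^ f0 (k + e)) \<le> ?h ^ e * B"
        by (intro mult_mono B) (auto intro: sum_nonneg)
    qed
    also have "\<dots> = (\<Sum>e<M. ?h ^ e) * B" by (simp add: sum_distrib_right)
    also have "\<dots> \<le> 2 * B"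
    proof (rule mult_right_mono[OF _ B0])
      have "(\<Sum>e<M. ?h ^ e) = 2 - 2 * ?h ^ M" by (induction M) auto
      then show "(\<Sum>e<M. ?h ^ e) \<le> 2" by simp
    qed
    finally show ?thesis .
  qed
  \<comment> \<open>Lengthening every \<open>F n\<close> by \<open>K\<close> scales the total weight
    from at most \<open>2 * B\<close> down to at most \<open>1\<close>.\<close>
  obtain K where K: "2 * B < 2 ^ K" using real_arch_pow[of 2 "2 * B"] by auto
  show ?thesis
  proof (rule that[of "\<lambda>n. F n + K" K])
    show "recfn 1 (\<lambda>xs. F (xs ! 0) + K)" by (intro recfn_intros rF)
    show "(\<Sum>k<n. ?h ^ (F k + K)) \<le> 1" for n
    proof -
      have "(\<Sum>k<n. ?h ^ (F k + K)) = (\<Sum>k<n. ?h ^ F k) * ?h ^ K"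
        by (simp add: power_add sum_distrib_right)
      also have "\<dots> \<le> 2 ^ K * ?h ^ K"
        using sumF[of n] K by (intro mult_right_mono) auto
      finally show ?thesis by (simp flip: power_mult_distrib)
    qed
    show "F n + K \<le> f (n + d) + 2 * d + K" if "1 \<le> n + d" for n d
      using F_le[of n d] that by (simp add: f0_def split: if_splits)
  qed
qed

section \<open>Construction of the computer\<close>

lemma partial_recursive_Least:
  assumes "recpr 2 (\<lambda>xs. Q (xs ! 0) (xs ! 1))"
  shows "partial_recursive_str (\<lambda>p. if \<exists>s. Q s (nat_of_str p)
    then Some (str_of_nat (LEAST s. Q s (nat_of_str p))) else None)"
proof -
  have "recpr (Suc 1) (\<lambda>ys. Q (ys ! 0) (tl ys ! 0))"
  proof -
    have "recfn 2 (\<lambda>ys. of_bool (Q (ys ! 0) (tl ys ! 0)))"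
      by (rule recfn_cong[OF assms[unfolded recpr_def]]) (auto simp: nth_tl)
    then show ?thesis by (simp add: recpr_def numeral_2_eq_2)
  qed
  then obtain r where r': "\<And>m xs. length xs = 1 \<Longrightarrow> rec_eval r (m # xs) (of_bool (\<not> Q m (xs ! 0)))"
    using recpr_program[of 1 "\<lambda>m xs. Q m (xs ! 0)"] by blast
  have r: "rec_eval r [m, x] (of_bool (\<not> Q m x))" for m x
    using r'[of "[x]" m] by simp
  have eq: "(\<exists>s. Q s x) \<and> (LEAST s. Q s x) = y \<longleftrightarrow> rec_eval (Mu r) [x] y" for x y
  proof
    assume "(\<exists>s. Q s x) \<and> (LEAST s. Q s x) = y"
    then show "rec_eval (Mu r) [x] y" using rec_eval_Mu_Least[of r "[x]" "\<lambda>m. Q m x"] r by blast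
  next
    \<comment> \<open>This direction is the divergence of the program outside the domain: any value
      of \<open>Mu r\<close> is a witness for \<open>Q\<close>.\<close>
    assume y: "rec_eval (Mu r) [x] y"
    then have "rec_eval r [y, x] 0" by (auto elim: rec_eval_MuE)
    then have "of_bool (\<not> Q y x) = (0 :: nat)" using r rec_eval_functional by blast
    then have "Q y x" by simp
    moreover from this have "rec_eval (Mu r) [x] (LEAST s. Q s x)"
      using rec_eval_Mu_Least[of r "[x]" "\<lambda>m. Q m x"] r by blast
    ultimately show "(\<exists>s. Q s x) \<and> (LEAST s. Q s x) = y"
      using y rec_eval_functional by blast
  qed
  have "str_of_nat k = q \<longleftrightarrow> k = nat_of_str q" for k q by auto
  then show ?thesis
    unfolding partial_recursive_str_def by (intro exI[of _ "Mu r"]) (auto simp flip: eq)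
qed


text \<open>In the reading with a leading \<open>1\<close>, every extension of \<open>p\<close> lies
  strictly to the left of the right end of the dyadic interval of \<open>p\<close>.\<close>

lemma nat_of_str_append_less:
  "nat_of_str (p @ t) + 1 < (nat_of_str p + 2) * 2 ^ length t"
proof (induction t rule: rev_induct)
  case (snoc b t)
  then show ?case
    using nat_of_str_snoc[of "p @ t" b] by (simp add: algebra_simps)
qed simp

text \<open>The numerator of the sum of \<open>(1 / 2) ^ l k\<close> over \<open>k < n\<close>, for
  the common denominator \<open>2 ^ (\<Sum>i<n. l i)\<close>. It reduces comparisons with this sum
  to natural numbers.\<close>

definition kraft_num :: "(nat \<Rightarrow> nat) \<Rightarrow> nat \<Rightarrow> nat" where
  "kraft_num l n = (\<Sum>k<n. 2 ^ ((\<Sum>i<n. l i) - l k))"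

lemma kraft_num: "real (kraft_num l n) = 2 ^ (\<Sum>i<n. l i) * (\<Sum>k<n. (1 / 2) ^ l k)"
proof -
  have "(2::real) ^ ((\<Sum>i<n. l i) - l k) = 2 ^ (\<Sum>i<n. l i) * (1 / 2) ^ l k" if "k < n" for k
  proof -
    have "l k \<le> (\<Sum>i<n. l i)" using that by (intro member_le_sum) auto
    then show ?thesis by (simp add: power_diff power_one_over)
  qed
  then show ?thesis by (simp add: kraft_num_def sum_distrib_left)
qed

text \<open>
  The strings of length \<open>n\<close> in the domain are those whose dyadic interval is contained in the
  \<open>n\<close>-th of consecutive intervals of lengths \<open>(1 / 2) ^ l 0\<close>, \<open>(1 / 2) ^ l 1\<close>, \<dots>
  Since these have disjoint interiors, the domain is prefix-free.
\<close>

lemma interval_computer: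
  assumes l: "recfn 1 (\<lambda>xs. l (xs ! 0))" and kraft: "\<And>n. (\<Sum>k<n. (1 / 2 :: real) ^ l k) \<le> 1"
    and G: "recpr 3 (\<lambda>xs. G (xs ! 0) (xs ! 1) (xs ! 2))"
  obtains C where "is_computer C"
    "\<And>n j. l n \<le> n \<Longrightarrow> 1 \<le> j \<Longrightarrow> j < 2 ^ (n - l n) \<Longrightarrow> \<exists>s. G j (n - l n) s \<Longrightarrow>
      \<exists>p. length p = n \<and> C p = Some (str_of_nat (LEAST s. G j (n - l n) s))"
proof -
  define S where "S n = (\<Sum>k<n. (1 / 2 :: real) ^ l k)" for n
  define D where "D n = (\<Sum>i<n. l i)" for n
  have S_mono: "S m \<le> S n" if "m \<le> n" for m n
    unfolding S_def using that by (intro sum_mono2) auto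
  have S_Suc: "S (Suc n) = S n + (1 / 2) ^ l n" for n by (simp add: S_def)
  have S_nonneg: "0 \<le> S n" for n unfolding S_def by (intro sum_nonneg) auto
  have num: "real (kraft_num l n) = 2 ^ D n * S n" for n
    by (simp add: kraft_num S_def D_def)
  \<comment> \<open>Clearing the denominator \<open>2 ^ D n\<close> turns comparisons with
    \<open>2 ^ m * S n\<close> into recursive predicates.\<close>
  have below: "kraft_num l n * 2 ^ m \<le> w * 2 ^ D n \<longleftrightarrow> 2 ^ m * S n \<le> real w" for n m w
  proof -
    have "kraft_num l n * 2 ^ m \<le> w * 2 ^ D n \<longleftrightarrow>
        real (kraft_num l n * 2 ^ m) \<le> real (w * 2 ^ D n)" by (simp only: of_nat_le_iff)
    also have "\<dots> \<longleftrightarrow> (2 ^ m * S n) * 2 ^ D n \<le> real w * 2 ^ D n" by (simp add: num mult_ac)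
    finally show ?thesis by simp
  qed
  have above: "w * 2 ^ D n \<le> kraft_num l n * 2 ^ m \<longleftrightarrow> real w \<le> 2 ^ m * S n" for n m w
  proof -
    have "w * 2 ^ D n \<le> kraft_num l n * 2 ^ m \<longleftrightarrow>
        real (w * 2 ^ D n) \<le> real (kraft_num l n * 2 ^ m)" by (simp only: of_nat_le_iff)
    also have "\<dots> \<longleftrightarrow> real w * 2 ^ D n \<le> (2 ^ m * S n) * 2 ^ D n" by (simp add: num mult_ac)
    finally show ?thesis by simp
  qed
  \<comment> \<open>The ceiling of \<open>2 ^ n * S n\<close>: the least value of a string of length
    \<open>n\<close> whose interval starts at or after \<open>S n\<close>.\<close>
  define lo where "lo n = (LEAST w. kraft_num l n * 2 ^ n \<le> w * 2 ^ D n)" for n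
  have lo_ex: "\<exists>w. kraft_num l n * 2 ^ n \<le> w * 2 ^ D n" for n
    unfolding below by (rule real_arch_simple)
  have lo: "2 ^ n * S n \<le> real (lo n)" "real (lo n) < 2 ^ n * S n + 1" for n
  proof -
    have "kraft_num l n * 2 ^ n \<le> lo n * 2 ^ D n"
      unfolding lo_def by (rule LeastI_ex[OF lo_ex])
    then show "2 ^ n * S n \<le> real (lo n)" by (simp only: below)
    show "real (lo n) < 2 ^ n * S n + 1"
    proof (cases "lo n")
      case 0
      then show ?thesis using S_nonneg[of n] by (simp add: add_nonneg_pos)
    next
      case (Suc w)
      then have "\<not> kraft_num l n * 2 ^ n \<le> w * 2 ^ D n"
        unfolding lo_def by (intro not_less_Least) simp
      then show ?thesis using Suc by (simp add: below)
    qed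
  qed
  define len where "len x = length (str_of_nat x)" for x
  \<comment> \<open>The string as a binary number, obtained by removing the leading \<open>1\<close>
    from \<open>x + 1\<close>.\<close>
  define val where "val x = x + 1 - 2 ^ len x" for x
  \<comment> \<open>The first two conjuncts place the interval of the string between
    \<open>S n\<close> and \<open>S (Suc n)\<close>. The shift by \<open>lo\<close> numbers the
    admissible strings from \<open>1\<close>, and the number is the threshold waited for.\<close>
  define Q where "Q s x \<longleftrightarrow> lo (len x) \<le> val x \<and>
    (val x + 1) * 2 ^ D (Suc (len x)) \<le> kraft_num l (Suc (len x)) * 2 ^ len x \<and>
    G (val x + 1 - lo (len x)) (len x - l (len x)) s" for s x
  define C where "C p = (if \<exists>s. Q s (nat_of_str p)
    then Some (str_of_nat (LEAST s. Q s (nat_of_str p))) else None)" for p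
  have rD: "recfn 1 (\<lambda>xs. D (xs ! 0))"
    unfolding D_def by (intro recfn_intros recfn_compose1[OF l]) auto
  have rN: "recfn 1 (\<lambda>xs. kraft_num l (xs ! 0))"
    unfolding kraft_num_def by (intro recfn_intros recfn_compose1[OF l]) auto
  have rlo: "recfn 1 (\<lambda>xs. lo (xs ! 0))"
    unfolding lo_def
  proof (rule recfn_Least)
    show "recpr (Suc 1) (\<lambda>ys. kraft_num l (tl ys ! 0) * 2 ^ (tl ys ! 0) \<le> ys ! 0 * 2 ^ D (tl ys ! 0))"
      by (intro recfn_intros recfn_compose1[OF rN] recfn_compose1[OF rD]) auto
  qed (rule lo_ex)
  have rlen: "recfn 1 (\<lambda>xs. len (xs ! 0))" unfolding len_def by (rule recfn_length_str_of_nat)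
  have rval: "recfn 1 (\<lambda>xs. val (xs ! 0))"
    unfolding val_def by (intro recfn_intros recfn_compose1[OF rlen]) auto
  have rG: "recpr 2 (\<lambda>xs. G (val (xs ! 1) + 1 - lo (len (xs ! 1))) (len (xs ! 1) - l (len (xs ! 1))) (xs ! 0))"
  proof -
    let ?Gs = "[\<lambda>xs. val (xs ! 1) + 1 - lo (len (xs ! 1)), \<lambda>xs. len (xs ! 1) - l (len (xs ! 1)), \<lambda>xs. xs ! 0]"
    have "recfn 2 (\<lambda>xs. (\<lambda>ys. of_bool (G (ys ! 0) (ys ! 1) (ys ! 2))) (map (\<lambda>F. F xs) ?Gs))"
    proof (rule recfn_compose)
      show "recfn (length ?Gs) (\<lambda>ys. of_bool (G (ys ! 0) (ys ! 1) (ys ! 2)))"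
        using G by (simp add: recpr_def numeral_3_eq_3)
      have 1: "recfn 2 (\<lambda>xs. val (xs ! 1) + 1 - lo (len (xs ! 1)))"
        by (intro recfn_intros recfn_compose1[OF rval] recfn_compose1[OF rlo] recfn_compose1[OF rlen]) auto
      have 2: "recfn 2 (\<lambda>xs. len (xs ! 1) - l (len (xs ! 1)))"
        by (intro recfn_intros recfn_compose1[OF l] recfn_compose1[OF rlen]) auto
      have 3: "recfn 2 (\<lambda>xs. xs ! 0)" by (intro recfn_intros) auto
      show "recfn 2 F" if "F \<in> set ?Gs" for F using that 1 2 3 by auto
    qed
    then show ?thesis by (simp add: recpr_def)
  qed
  have rQ: "recpr 2 (\<lambda>xs. Q (xs ! 0) (xs ! 1))"
    unfolding Q_def
    by (intro recpr_conj rG; intro recfn_intros recfn_compose1[OF rval] recfn_compose1[OF rlo]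
      recfn_compose1[OF rlen] recfn_compose1[OF rD] recfn_compose1[OF rN]) auto
  have val: "nat_of_str p + 1 = 2 ^ length p + val (nat_of_str p)" for p
    using nat_of_str_bounds(1)[of p] by (simp add: val_def len_def)
  have domD: "2 ^ length p * S (length p) \<le> real (val (nat_of_str p))"
    "real (val (nat_of_str p)) + 1 \<le> 2 ^ length p * S (Suc (length p))" if p: "p \<in> dom C" for p
  proof -
    obtain s where "Q s (nat_of_str p)" using p by (auto simp: C_def split: if_splits)
    then have *: "lo (length p) \<le> val (nat_of_str p)"
      "(val (nat_of_str p) + 1) * 2 ^ D (Suc (length p)) \<le> kraft_num l (Suc (length p)) * 2 ^ length p"
      by (auto simp: Q_def len_def)
    show "2 ^ length p * S (length p) \<le> real (val (nat_of_str p))"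
      using lo(1)[of "length p"] *(1) by linarith
    show "real (val (nat_of_str p)) + 1 \<le> 2 ^ length p * S (Suc (length p))"
      using *(2) unfolding above by simp
  qed
  have "is_computer C"
    unfolding is_computer_def
  proof
    show "partial_recursive_str C"
      unfolding C_def by (rule partial_recursive_Least[OF rQ])
    show "prefix_free (dom C)"
      unfolding prefix_free_def
    proof (intro ballI impI)
      fix p p'
      assume p: "p \<in> dom C" "p' \<in> dom C" and "prefix p p'"
      then obtain t where t: "p' = p @ t" by (auto simp: prefix_def)
      let ?v = "val (nat_of_str p)" and ?v' = "val (nat_of_str p')"
      have "nat_of_str p + 2 = 2 ^ length p + ?v + 1" using val[of p] by simp
      then have "nat_of_str p' + 1 < (2 ^ length p + ?v + 1) * 2 ^ length t"
        using nat_of_str_append_less[of p t] by (simp only: t)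
      then have "2 ^ length p' + ?v' < (2 ^ length p + ?v + 1) * 2 ^ length t"
        by (simp only: val)
      \<comment> \<open>The interval of the extension starts before the interval of \<open>p\<close>
        ends, which forces both lengths into the same interval of the sequence
        \<open>S\<close>.\<close>
      then have "?v' < (?v + 1) * 2 ^ length t"
        by (simp add: t power_add algebra_simps)
      then have "real ?v' < real ((?v + 1) * 2 ^ length t)" by (simp only: of_nat_less_iff)
      then have "real ?v' < (real ?v + 1) * 2 ^ length t"
        by (simp add: algebra_simps)
      moreover have "2 ^ length p' * S (length p') \<le> real ?v'" by (rule domD(1)[OF p(2)])
      moreover have "(real ?v + 1) * 2 ^ length t \<le> 2 ^ length p * S (Suc (length p)) * 2 ^ length t"
        by (intro mult_right_mono domD(2)[OF p(1)]) simp
      moreover have "2 ^ length p * S (Suc (length p)) * 2 ^ length t = 2 ^ length p' * S (Suc (length p))"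
        by (simp add: t power_add)
      ultimately have "2 ^ length p' * S (length p') < 2 ^ length p' * S (Suc (length p))" by linarith
      then have "S (length p') < S (Suc (length p))" by simp
      then have "length p' < Suc (length p)" using S_mono by (meson leD not_le)
      then show "p = p'" using t by simp
    qed
  qed
  moreover have "\<exists>p. length p = n \<and> C p = Some (str_of_nat (LEAST s. G j (n - l n) s))"
    if n: "l n \<le> n" and j: "1 \<le> j" "j < 2 ^ (n - l n)" and ex: "\<exists>s. G j (n - l n) s" for n j
  proof -
    define v where "v = lo n + j - 1"
    have v1: "v + 1 = lo n + j" using j(1) by (simp add: v_def)
    \<comment> \<open>Rounding up to \<open>lo n\<close> costs less than one string, hence the
      strict bound on \<open>j\<close>: \<open>lo n + j < 2 ^ n * S n + 1 + j \<le> 2 ^ n * S n + 2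
      ^ (n - l n)\<close>.\<close>
    have "real (v + 1) \<le> 2 ^ n * S (Suc n)"
    proof -
      have "j + 1 \<le> 2 ^ (n - l n)" using j(2) by simp
      then have "real (j + 1) \<le> real (2 ^ (n - l n))" by (simp only: of_nat_le_iff)
      then have "real j + 1 \<le> 2 ^ (n - l n)" by simp
      also have "(2::real) ^ (n - l n) = 2 ^ n * (1 / 2) ^ l n"
        using n by (simp add: power_diff power_one_over)
      finally show ?thesis using lo(2)[of n] unfolding v1 S_Suc by (simp add: algebra_simps)
    qed
    then have up: "(v + 1) * 2 ^ D (Suc n) \<le> kraft_num l (Suc n) * 2 ^ n"
      unfolding above .
    \<comment> \<open>The total weight is at most \<open>1\<close>, so \<open>v\<close> fits into
      \<open>n\<close> bits.\<close>
    have "real (v + 1) \<le> 2 ^ n * S (Suc n)" by fact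
    also have "\<dots> \<le> 2 ^ n * 1"
      using kraft[of "Suc n"] by (intro mult_left_mono) (simp_all add: S_def)
    finally have "real (v + 1) \<le> real (2 ^ n)" by simp
    then have v2: "v + 1 \<le> 2 ^ n" by (simp only: of_nat_le_iff)
    \<comment> \<open>The number of the string of length \<open>n\<close> with binary value
      \<open>v\<close>, by the leading \<open>1\<close> convention.\<close>
    define p where "p = str_of_nat (2 ^ n + v - 1)"
    have np: "nat_of_str p = 2 ^ n + v - 1" by (simp add: p_def)
    have lp: "length p = n"
    proof -
      have 1: "2 ^ length p \<le> 2 ^ n + v" "2 ^ n + v < 2 ^ Suc (length p)"
        using nat_of_str_bounds[of p] unfolding np by auto
      have "(2::nat) ^ length p < 2 ^ Suc n" using 1(1) v2 by simp
      moreover have "(2::nat) ^ n < 2 ^ Suc (length p)" using 1(2) by simp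
      ultimately show ?thesis by (metis less_Suc_eq_le order_antisym power_less_imp_less_exp one_less_numeral_iff semiring_norm(76))
    qed
    have "val (nat_of_str p) = v" using val[of p] np lp by simp
    moreover have "len (nat_of_str p) = n" by (simp add: len_def lp)
    moreover have "lo n \<le> v" "v + 1 - lo n = j" using j(1) v1 by (auto simp: v_def)
    ultimately have "Q s (nat_of_str p) \<longleftrightarrow> G j (n - l n) s" for s
      using up by (simp add: Q_def)
    then have "C p = Some (str_of_nat (LEAST s. G j (n - l n) s))"
      using ex by (simp add: C_def)
    then show ?thesis using lp by blast
  qed
  ultimately show ?thesis using that by blast
qed


section \<open>Choice of the constant and correctness of the output\<close>

theorem theorem3p2:
  fixes \<alpha> :: real and V :: "bstring \<rightharpoonup> bstring"
  assumes "re_real \<alpha>" and "optimal_computer V"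
  shows "\<forall>f :: nat \<Rightarrow> nat.
    total_recursive_pos f \<and> summable (\<lambda>n. 2 powr (- real (f (Suc n)))) \<longrightarrow>
    (\<exists>M (c :: nat). is_oracle_tm M \<and>
      (\<forall>n\<ge>1. tm_outputs_nat M (dom V \<restriction>\<^sub>s int n) n
        (\<alpha> \<restriction>\<^sub>r (int n - int (f n) - int c))))"
proof (intro allI impI, elim conjE)
  fix f :: "nat \<Rightarrow> nat"
  assume f: "total_recursive_pos f" and sum: "summable (\<lambda>n. 2 powr (- real (f (Suc n))))"
  define \<beta> where "\<beta> = \<alpha> - of_int \<lfloor>\<alpha>\<rfloor>"
  have \<beta>: "0 \<le> \<beta>" "\<beta> < 1" by (auto simp: \<beta>_def) linarith
  obtain G :: "nat \<Rightarrow> nat \<Rightarrow> nat \<Rightarrow> bool" where G: "recpr 3 (\<lambda>xs. G (xs ! 0) (xs ! 1) (xs ! 2))"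
    "\<And>j m s. G j m s \<Longrightarrow> real j \<le> 2 ^ m * \<beta>"
    "\<And>j m. real j \<le> 2 ^ m * \<beta> \<Longrightarrow> \<exists>s. G j m s"
    "\<And>i j m s. G (j * 2 ^ i) (m + i) s \<longleftrightarrow> G j m s"
    using re_real_approximation[OF assms(1)] unfolding \<beta>_def by blast
  obtain l K where l: "recfn 1 (\<lambda>xs. l (xs ! 0))" "\<And>n. (\<Sum>k<n. (1 / 2 :: real) ^ l k) \<le> 1"
    "\<And>n d. 1 \<le> n + d \<Longrightarrow> l n \<le> f (n + d) + 2 * d + K"
    using shift_stable_lengths[OF f sum] by blast
  obtain C where C: "is_computer C"
    "\<And>n j. l n \<le> n \<Longrightarrow> 1 \<le> j \<Longrightarrow> j < 2 ^ (n - l n) \<Longrightarrow> \<exists>s. G j (n - l n) s \<Longrightarrow>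
      \<exists>p. length p = n \<and> C p = Some (str_of_nat (LEAST s. G j (n - l n) s))"
    using interval_computer[OF l(1,2) G(1)] by blast
  obtain d :: nat where d: "\<And>p. p \<in> dom C \<Longrightarrow> \<exists>q. V q = C p \<and> length q \<le> length p + d"
    using assms(2) C(1) unfolding optimal_computer_def by blast
  have "partial_recursive_str V" using assms(2) by (simp add: optimal_computer_def is_computer_def)
  then obtain r where r: "\<And>p q. V p = Some q \<longleftrightarrow> rec_eval r [nat_of_str p] (nat_of_str q)"
    unfolding partial_recursive_str_def by blast
  obtain H :: "nat \<Rightarrow> nat \<Rightarrow> bool" where H: "recpr 2 (\<lambda>xs. H (xs ! 0) (xs ! 1))"
    "\<And>s t x. H s x \<Longrightarrow> s \<le> t \<Longrightarrow> H t x"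
    "\<And>x y. rec_eval r [x] y \<Longrightarrow> \<exists>s. H s x"
    "\<And>s x y. H s x \<Longrightarrow> rec_eval r [x] y \<Longrightarrow> y < s"
    using halting_stages[of r] by blast
  \<comment> \<open>One \<open>d\<close> pays for passing from length \<open>n\<close> to
    \<open>n - d\<close>, and \<open>2 * d + K\<close> is the surplus in the bound on
    \<open>l (n - d)\<close>.\<close>
  define c where "c = 3 * d + K"
  define prec where "prec n = n - (f (if n = 0 then 1 else n) + c)" for n
  \<comment> \<open>The approximations need not increase with the stage, so all stages up to and
    including \<open>t\<close> are inspected.\<close>
  define k where "k n t = (LEAST k. \<not> (\<exists>s<Suc t. G (k + 1) (prec n) s))" for n t
  \<comment> \<open>The number of the string of length \<open>prec n\<close> with binary value
    \<open>k n t\<close>.\<close>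
  define Y where "Y n t = 2 ^ prec n - 1 + k n t" for n t
  have k_ex: "\<exists>k. \<not> (\<exists>s<Suc t. G (k + 1) (prec n) s)" for n t
  proof (rule exI, rule notI, elim exE conjE)
    fix s
    assume "G (2 ^ prec n + 1) (prec n) s"
    from G(2)[OF this] have "(2::real) ^ prec n + 1 \<le> 2 ^ prec n * \<beta>" by simp
    also have "\<dots> \<le> 2 ^ prec n * 1" using \<beta> by (intro mult_left_mono) auto
    finally show False by simp
  qed
  have rprec: "recfn 1 (\<lambda>xs. prec (xs ! 0))"
    unfolding prec_def by (intro recfn_intros total_recursive_pos_recfn[OF f]) auto
  have rG: "recpr (Suc (Suc 2)) (\<lambda>ys. G (tl ys ! 0 + 1) (prec (tl (tl ys) ! 0)) (ys ! 0))"
  proof -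
    let ?Gs = "[\<lambda>ys. tl ys ! 0 + 1, \<lambda>ys. prec (tl (tl ys) ! 0), \<lambda>ys. ys ! 0]"
    have "recfn (Suc (Suc 2)) (\<lambda>xs. (\<lambda>ys. of_bool (G (ys ! 0) (ys ! 1) (ys ! 2)))
        (map (\<lambda>F. F xs) ?Gs))"
    proof (rule recfn_compose)
      show "recfn (length ?Gs) (\<lambda>ys. of_bool (G (ys ! 0) (ys ! 1) (ys ! 2)))"
        using G(1) by (simp add: recpr_def numeral_3_eq_3)
      have 1: "recfn (Suc (Suc 2)) (\<lambda>ys. tl ys ! 0 + 1)" by (intro recfn_intros) auto
      have 2: "recfn (Suc (Suc 2)) (\<lambda>ys. prec (tl (tl ys) ! 0))"
        by (intro recfn_compose1[OF rprec] recfn_tl2) auto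
      have 3: "recfn (Suc (Suc 2)) (\<lambda>ys. ys ! 0)" by (intro recfn_intros) auto
      show "recfn (Suc (Suc 2)) F" if "F \<in> set ?Gs" for F using that 1 2 3 by auto
    qed
    then show ?thesis by (simp add: recpr_def)
  qed
  have rk: "recfn 2 (\<lambda>xs. k (xs ! 0) (xs ! 1))"
    unfolding k_def
  proof (rule recfn_Least)
    show "recpr (Suc 2) (\<lambda>ys. \<not> (\<exists>s<Suc (tl ys ! 1). G (ys ! 0 + 1) (prec (tl ys ! 0)) s))"
      by (intro recpr_not recpr_ex rG recfn_intros) auto
  qed (rule k_ex)
  have rY: "recfn 2 (\<lambda>xs. Y (xs ! 0) (xs ! 1))"
    unfolding Y_def by (intro recfn_intros rk recfn_compose1[OF rprec]) auto
  obtain M where M: "is_oracle_tm M"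
    "\<And>A n. (\<And>x. str_of_nat x \<in> A \<Longrightarrow> \<exists>s. H s x) \<Longrightarrow>
      \<exists>t. (\<forall>x<2 ^ Suc n. str_of_nat x \<in> A \<longrightarrow> H t x) \<and> tm_outputs_nat M A n (str_of_nat (Y n t))"
    using oracle_machine[OF rY H(1)] H(2) by blast
  have "tm_outputs_nat M (dom V \<restriction>\<^sub>s int n) n (\<alpha> \<restriction>\<^sub>r (int n - int (f n) - int c))" if n: "1 \<le> n" for n
  proof -
    let ?A = "dom V \<restriction>\<^sub>s int n"
    have "\<exists>s. H s x" if "str_of_nat x \<in> ?A" for x
      using that H(3)[of x] r[of "str_of_nat x"] by (auto simp: restrict_len_def)
    then obtain t where t: "\<And>x. x < 2 ^ Suc n \<Longrightarrow> str_of_nat x \<in> ?A \<Longrightarrow> H t x"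
      and out: "tm_outputs_nat M ?A n (str_of_nat (Y n t))"
      using M(2)[of ?A n] by blast
    define m where "m = prec n"
    have m: "m = n - (f n + c)" using n by (simp add: m_def prec_def)
    have "real (k n t) \<le> 2 ^ m * \<beta>"
    proof (cases "k n t")
      case (Suc i)
      then have "\<exists>s<Suc t. G (i + 1) m s"
        using not_less_Least[of i "\<lambda>k. \<not> (\<exists>s<Suc t. G (k + 1) (prec n) s)"]
        unfolding k_def m_def by auto
      then obtain s where "G (Suc i) m s" by auto
      from G(2)[OF this] show ?thesis by (simp only: Suc)
    qed (use \<beta> in simp)
    moreover have "2 ^ m * \<beta> < real (k n t) + 1"
    proof (rule ccontr)
      assume "\<not> 2 ^ m * \<beta> < real (k n t) + 1"
      define j where "j = k n t + 1"
      have j: "real j \<le> 2 ^ m * \<beta>" using \<open>\<not> 2 ^ m * \<beta> < real (k n t) + 1\<close> by (simp add: j_def)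
      \<comment> \<open>Because of \<open>\<beta> < 1\<close> the missed threshold lies in the range
        \<open>j < 2 ^ m\<close> that the computer serves.\<close>
      have "2 ^ m * \<beta> < 2 ^ m * 1" using \<beta> by (intro mult_strict_left_mono) auto
      with j have "real j < 2 ^ m * 1" by (rule le_less_trans)
      then have "real j < real (2 ^ m)" by simp
      then have j2: "j < 2 ^ m" by (simp only: of_nat_less_iff)
      \<comment> \<open>A positive \<open>m\<close> shows that the subtraction in
        \<open>prec\<close> was not truncated, so \<open>n\<close> leaves room for
        \<open>f n + c\<close>.\<close>
      have "0 < m" using j2 by (cases m) (auto simp: j_def)
      then have nd: "f n + c < n" by (simp add: m)
      define n' where "n' = n - d"
      have n': "n' + d = n" using nd by (simp add: n'_def c_def)
      have "l n' \<le> f n + 2 * d + K" using l(3)[of n' d] n n' by simp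
      \<comment> \<open>Both follow from \<open>c = 3 * d + K\<close>:
        \<open>n' - l n' \<ge> (n - d) - (f n + 2 * d + K) = m\<close>.\<close>
      then have ln: "l n' \<le> n'" "m \<le> n' - l n'" using nd n' by (auto simp: m c_def)
      \<comment> \<open>The computer works with \<open>i\<close> more bits than \<open>m\<close>,
        and \<open>j\<close> is rescaled accordingly.\<close>
      then obtain i where i: "n' - l n' = m + i" using le_Suc_ex by blast
      define s where "s = (LEAST s. G (j * 2 ^ i) (n' - l n') s)"
      have ex: "\<exists>s. G (j * 2 ^ i) (n' - l n') s" using G(3)[OF j] unfolding i G(4) .
      have "0 < j * 2 ^ i" unfolding nat_0_less_mult_iff by (simp add: j_def)
      then have "1 \<le> j * 2 ^ i" by linarith
      moreover have "j * 2 ^ i < 2 ^ (n' - l n')" using j2 by (simp add: i power_add)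
      ultimately obtain p where p: "length p = n'" "C p = Some (str_of_nat s)"
        using C(2)[OF ln(1) _ _ ex] unfolding s_def by blast
      have "G (j * 2 ^ i) (n' - l n') s" unfolding s_def using ex by (rule LeastI_ex)
      then have "G j m s" by (simp only: i G(4))
      moreover have "\<not> (\<exists>s<Suc t. G j m s)"
        unfolding j_def m_def k_def using k_ex by (rule LeastI_ex)
      ultimately have "t < s" by (metis not_less_eq)
      obtain q where q: "V q = Some (str_of_nat s)" "length q \<le> n"
        using d[of p] p n' by auto
      have "nat_of_str q < 2 ^ Suc n"
      proof -
        have "nat_of_str q + 1 < 2 ^ Suc (length q)" by (rule nat_of_str_bounds)
        also have "\<dots> \<le> (2::nat) ^ Suc n" using q(2) by (intro power_increasing) auto
        finally show ?thesis by simp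
      qed
      then have "H t (nat_of_str q)" using q by (intro t) (auto simp: restrict_len_def)
      moreover have "rec_eval r [nat_of_str q] s" using q(1) r[of q "str_of_nat s"] by simp
      \<comment> \<open>The stage \<open>s\<close> is itself the output on \<open>q\<close>, and
        \<open>H t\<close> bounds outputs by \<open>t\<close>; but all stages up to \<open>t\<close>
        were excluded.\<close>
      ultimately have "s < t" by (rule H(4))
      then show False using \<open>t < s\<close> by simp
    qed
    ultimately have "\<lfloor>2 ^ m * \<beta>\<rfloor> = int (k n t)" by (simp add: floor_eq_iff)
    then have "nat_of_str (\<alpha> \<restriction>\<^sub>r int m) + 1 = 2 ^ m + k n t"
      using nat_of_str_real_prefix[of \<alpha> m] by (simp add: \<beta>_def)
    then have "nat_of_str (\<alpha> \<restriction>\<^sub>r int m) = Y n t" by (simp add: Y_def m_def)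
    then have "str_of_nat (Y n t) = \<alpha> \<restriction>\<^sub>r int m" by (metis str_of_nat_inverse)
    moreover have "\<alpha> \<restriction>\<^sub>r int m = \<alpha> \<restriction>\<^sub>r (int n - int (f n) - int c)"
    proof -
      \<comment> \<open>For a negative difference both sides are \<open>0\<close>, and the prefix is
        the empty string.\<close>
      have "nat (int n - int (f n) - int c) = m" unfolding m by linarith
      then show ?thesis by (simp add: real_prefix_def)
    qed
    ultimately show ?thesis using out by simp
  qed
  then show "\<exists>M (c :: nat). is_oracle_tm M \<and>
      (\<forall>n\<ge>1. tm_outputs_nat M (dom V \<restriction>\<^sub>s int n) n (\<alpha> \<restriction>\<^sub>r (int n - int (f n) - int c)))"
    using M(1) by blast
qed

end
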